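(* Let $N\ge1$ be an integer and let $p_N$ be the mean eigenvalue density of the $\mathrm{GUE}(N)$. For every $s\in\mathbb{C}$, the bilateral Laplace transform of $p_N$ is given by the convergent series $$\int_{-\infty}^\infty e^{st}p_N(t)\,\mathrm{d}t=\sum_{k=0}^\infty\frac{c_k(s)}{N^{2k}},$$ where $c_k(s)=\alpha_k(e^{s\,\cdot})$ is the bilateral Laplace transform of $\alpha_k$; in particular $c_0(s)=\frac1{2\pi}\int_{-2}^2e^{sx}\sqrt{4-x^2}\,\mathrm{d}x$ is the bilateral Laplace transform of the semicircle law.
   Context: GUE: a $\mathrm{GUE}(N)$ matrix $X_N$ is a random $N\times N$ Hermitian matrix whose entries are jointly independent up to the condition $X_{jk}=\overline{X_{kj}}$, with diagonal entries distributed as $N(0,\frac1N)$ and, for $j<k$, $\Re X_{jk}$ and $\Im X_{jk}$ independent with distribution $N(0,\frac1{2N})$. With eigenvalues $\lambda_1\le\dots\le\lambda_N$, the mean eigenvalue density $p_N$ is defined by $\frac1N\mathbb{E}\sum_{j=1}^N\mathbbm{1}_{a<\lambda_j<b}=\int_a^b p_N(x)\,\mathrm{d}x$ for all $a<b$. The functionals $\alpha_k$ are $\alpha_k(f)=\frac1{2\pi}\int_{-2}^2[T^kf](x)\sqrt{4-x^2}\,\mathrm{d}x$, where $T$ is the following operator. For a polynomial $g$ (complex coefficients), $Sg$ is the unique polynomial solution of $$g(t)=\frac1{2\pi}\int_{-2}^2 g(s)\sqrt{4-s^2}\,\mathrm{d}s+(t^2-4)[Sg]'(t)+3t\,[Sg](t),$$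 and $Tg=(Sg)'''$. Extension of $T$ to entire functions: let $f_n(t)=C_n^{(2)}(t/2)$, $n=0,1,2,\dots$, where $C_n^{(2)}$ is the Gegenbauer polynomial with parameter $\lambda=2$ (standard normalization, generating function $\sum_n C_n^{(2)}(x)u^n=(1-2xu+u^2)^{-2}$). For $f=\sum_n a_nf_n$ and $c,K>0$ put $\|f\|_{c,K}=\sup_{n\ge0}\left(\frac nK\right)^{cn}|a_n|$ (with $0^0=1$). Every entire function $f$ with $\sigma_f=\limsup_{|z|\to\infty}\frac{\log|f(z)|}{|z|^2}<\infty$ (in particular $f(t)=e^{st}$) has an expansion $f=\sum_{n\ge0}a_nf_n$ converging locally uniformly, with $\|f\|_{\frac12,K}<\infty$ for every $K>8e\sigma_f$, $K>0$. The operator $T$ is bounded on polynomials with respect to $\|\cdot\|_{\frac12,K}$ for each $K>0$, and is extended by continuity to the completions of the polynomials (consistently for different $K$); thus $Tf$ is the $\|\cdot\|_{\frac12,K}$-limit of $T\left(\sum_{n\le M}a_nf_n\right)$ as $M\to\infty$, for any $K>8e\sigma_f$, $K>0$. $T^k$ is the $k$-fold iterate. *)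

theory Defs
  imports
    "HOL-Probability.Probability"
    "HOL-Computational_Algebra.Computational_Algebra"
    "Jordan_Normal_Form.Char_Poly"
begin

section \<open>The Gaussian unitary ensemble and its mean eigenvalue density\<close>

text \<open>The diagonal entries are real by the Hermitian condition. The second argument of
  \<^const>\<open>normal_density\<close> is the standard deviation, not the variance.\<close>

definition GUE :: "'a measure \<Rightarrow> nat \<Rightarrow> ('a \<Rightarrow> complex mat) \<Rightarrow> bool" where
  "GUE M N X \<longleftrightarrow>
     prob_space M \<and>
     (\<forall>\<omega>\<in>space M. X \<omega> \<in> carrier_mat N N \<and>
        (\<forall>j<N. \<forall>k<N. X \<omega> $$ (j, k) = cnj (X \<omega> $$ (k, j)))) \<and>
     prob_space.indep_vars M (\<lambda>_. borel) (\<lambda>(j, k) \<omega>. X \<omega> $$ (j, k))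
        {(j, k). j \<le> k \<and> k < N} \<and>
     (\<forall>j<N. distributed M lborel (\<lambda>\<omega>. Re (X \<omega> $$ (j, j)))
        (\<lambda>x. ennreal (normal_density 0 (sqrt (1 / real N)) x))) \<and>
     (\<forall>k<N. \<forall>j<k.
        prob_space.indep_var M
          borel (\<lambda>\<omega>. Re (X \<omega> $$ (j, k))) borel (\<lambda>\<omega>. Im (X \<omega> $$ (j, k))) \<and>
        distributed M lborel (\<lambda>\<omega>. Re (X \<omega> $$ (j, k)))
          (\<lambda>x. ennreal (normal_density 0 (sqrt (1 / (2 * real N))) x)) \<and>
        distributed M lborel (\<lambda>\<omega>. Im (X \<omega> $$ (j, k)))
          (\<lambda>x. ennreal (normal_density 0 (sqrt (1 / (2 * real N))) x)))"

text \<open>Increasing list of the eigenvalues with multiplicity; for a Hermitian matrix all of them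
  are real, so that taking real parts loses nothing.\<close>

definition hermitian_eigenvalues :: "complex mat \<Rightarrow> real list" where
  "hermitian_eigenvalues A =
     sorted_list_of_multiset (image_mset Re (proots (char_poly A)))"

definition mean_eigenvalue_density ::
  "'a measure \<Rightarrow> nat \<Rightarrow> ('a \<Rightarrow> complex mat) \<Rightarrow> (real \<Rightarrow> real) \<Rightarrow> bool" where
  "mean_eigenvalue_density M N X p \<longleftrightarrow>
     (\<forall>a b. a < b \<longrightarrow>
        set_integrable lborel {a<..<b} p \<and>
        1 / real N *
          (LINT \<omega>|M. (\<Sum>j<N. indicator {a<..<b} (hermitian_eigenvalues (X \<omega>) ! j))) =
        (LINT x:{a<..<b}|lborel. p x))"

section \<open>The operator \<open>T\<close> on polynomials\<close>

definition semicircle :: "(complex \<Rightarrow> complex) \<Rightarrow> complex" where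
  "semicircle f = 1 / (2 * of_real pi) *
     (LINT x:{-2..2}|lborel. f (of_real x) * of_real (sqrt (4 - x\<^sup>2)))"

definition S_poly :: "complex poly \<Rightarrow> complex poly" where
  "S_poly g = (THE h. g = [:semicircle (poly g):] + [:-4, 0, 1:] * pderiv h + [:0, 3:] * h)"

definition T_poly :: "complex poly \<Rightarrow> complex poly" where
  "T_poly g = (pderiv ^^ 3) (S_poly g)"

section \<open>Gegenbauer expansions\<close>

text \<open>The power series \<open>(1 - 2xu + u\<^sup>2)\<^sup>-\<^sup>2\<close> in \<open>u\<close>, with coefficients polynomials in \<open>x\<close>;
  its constant coefficient is 1, so it is the (unique) inverse in the commutative ring of
  power series over polynomials.\<close>

definition gegenbauer2_gf :: "complex poly fps" where
  "gegenbauer2_gf =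
     fps_right_inverse ((1 - fps_const [:0, 2:] * fps_X + fps_X\<^sup>2)\<^sup>2) 1"

lemma gegenbauer2_gf_inverse:
  "(1 - fps_const [:0, 2:] * fps_X + fps_X\<^sup>2)\<^sup>2 * gegenbauer2_gf = 1"
  unfolding gegenbauer2_gf_def by (rule fps_right_inverse) (simp add: power2_eq_square)

definition gegenbauer2 :: "nat \<Rightarrow> complex poly" where
  "gegenbauer2 n = fps_nth gegenbauer2_gf n"

definition gegenbauer_basis :: "nat \<Rightarrow> complex poly" where
  "gegenbauer_basis n = pcompose (gegenbauer2 n) [:0, 1/2:]"

definition has_gegenbauer_expansion :: "(nat \<Rightarrow> complex) \<Rightarrow> (complex \<Rightarrow> complex) \<Rightarrow> bool" where
  "has_gegenbauer_expansion a f \<longleftrightarrow>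
     (\<forall>C. compact C \<longrightarrow>
        uniform_limit C (\<lambda>m t. \<Sum>n\<le>m. a n * poly (gegenbauer_basis n) t) f sequentially)"

definition gegenbauer_coeff :: "(complex \<Rightarrow> complex) \<Rightarrow> nat \<Rightarrow> complex" where
  "gegenbauer_coeff f = (THE a. has_gegenbauer_expansion a f)"

text \<open>The case distinction implements \<open>0\<^sup>0 = 1\<close>, as \<open>0 powr 0 = 0\<close> in the library.\<close>

definition gegenbauer_norm :: "real \<Rightarrow> real \<Rightarrow> (complex \<Rightarrow> complex) \<Rightarrow> ennreal" where
  "gegenbauer_norm c K f =
     (SUP n. ennreal ((if n = 0 then 1 else (real n / K) powr (c * real n)) *
        cmod (gegenbauer_coeff f n)))"

section \<open>Extension of \<open>T\<close> to entire functions and the functionals \<open>\<alpha>\<^sub>k\<close>\<close>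

definition quadratic_growth :: "(complex \<Rightarrow> complex) \<Rightarrow> ereal" where
  "quadratic_growth f =
     Limsup at_infinity
       (\<lambda>z. if f z = 0 then -\<infinity> else ereal (ln (cmod (f z)) / (cmod z)\<^sup>2))"

text \<open>An element of the completion of the polynomials is identified with the sum of its
  Gegenbauer expansion.\<close>

definition T_entire :: "(complex \<Rightarrow> complex) \<Rightarrow> complex \<Rightarrow> complex" where
  "T_entire f =
     (THE g. (\<exists>b. has_gegenbauer_expansion b g) \<and>
        (\<forall>K>0. ereal (8 * exp 1) * quadratic_growth f < ereal K \<longrightarrow>
           (\<lambda>m. gegenbauer_norm (1/2) K
              (\<lambda>t. g t - poly (T_poly (\<Sum>n\<le>m. Polynomial.smult (gegenbauer_coeff f n) (gegenbauer_basis n))) t))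
           \<longlonglongrightarrow> 0))"

definition alpha :: "nat \<Rightarrow> (complex \<Rightarrow> complex) \<Rightarrow> complex" where
  "alpha k f = semicircle ((T_entire ^^ k) f)"

definition alpha_laplace :: "nat \<Rightarrow> complex \<Rightarrow> complex" where
  "alpha_laplace k s = alpha k (\<lambda>t. exp (s * t))"

end

theory Submission
  imports Defs
begin

text \<open>
  Let \<open>h\<^sub>k\<close> be the complete homogeneous symmetric polynomials of the eigenvalues of \<open>X\<close>, so that
  \<open>\<Sum>\<^sub>k h\<^sub>k u\<^sup>k = 1 / det (1 - uX)\<close>. They are the moments \<open>E\<^sub>g (g\<^sup>* X g)\<^sup>k / k!\<close> for a standard complex Gaussian
  vector \<open>g\<close>. For fixed \<open>g\<close>, Gaussian integration by parts in the single variable \<open>g\<^sup>* X g\<close> moves \<open>X\<close> by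
  a rank-one matrix, along which \<open>det (z - X)\<close> is affine; this makes \<open>E (det (z - X) h\<^sub>k)\<close> explicit.
  Since \<open>tr X\<^sup>n\<close> is a bilinear expression in the coefficients of \<open>det (z - X)\<close> and the \<open>h\<^sub>k\<close>, the
  generating series of \<open>E tr X\<^sup>n\<close> becomes a Wronskian-like expression in two series that satisfy Hermite
  equations, and differentiating it gives the Harer--Zagier recursion
  \<open>k(k+2) m\<^sub>k = 4k(k-1) m\<^sub>k\<^sub>-\<^sub>2 + N\<^sup>-\<^sup>2 k(k-1)(k-2)(k-3) m\<^sub>k\<^sub>-\<^sub>4\<close> for the moments of \<open>p\<^sub>N\<close>.

  Equivalently, \<open>\<integral> ((t\<^sup>2 - 4) h' + 3th) p\<^sub>N = N\<^sup>-\<^sup>2 \<integral> h''' p\<^sub>N\<close> for polynomials \<open>h\<close>, whence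
  \<open>\<integral> g p\<^sub>N = \<alpha>\<^sub>0 g + N\<^sup>-\<^sup>2 \<integral> (T g) p\<^sub>N\<close>. In the basis \<open>f\<^sub>n\<close> the operator \<open>T\<close> lowers the degree and has
  nonnegative entries, so \<open>\<integral> f\<^sub>n p\<^sub>N = \<Sum>\<^sub>k N\<^sup>-\<^sup>2\<^sup>k \<alpha>\<^sub>k f\<^sub>n\<close> is a finite sum of nonnegative terms. The expansion
  \<open>\<Sum>\<^sub>n a\<^sub>n f\<^sub>n\<close> of the exponential has \<open>\<bar>a\<^sub>n\<bar> \<le> A B\<^sup>n / n!\<close>, so \<open>\<Sum>\<^sub>n \<bar>a\<^sub>n\<bar> \<integral> f\<^sub>n p\<^sub>N\<close> converges and the sums over
  \<open>n\<close> and \<open>k\<close> may be interchanged.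
\<close>

section \<open>Polynomials in a finite Gaussian family\<close>

text \<open>Integration by parts applied to traces alone does not close: it produces expectations of
  products of two traces. The pair of det (z - X) and its reciprocal closes instead, because the
  mean of a coefficient of one times a coefficient of the other is a sum of only two products of
  scalar sequences. Only moments of the entries enter, so every expectation is a finite combination
  of monomial moments, and even the auxiliary vector is averaged without a product measure. Two
  definitions shape the rest. The density \<open>p\<close> is specified only through integrals over
  bounded intervals, while only symmetric functions of the eigenvalues are polynomial in the
  entries; measurability, sign and moments have to be recovered from this. \<open>T_entire\<close>
  is a definite description, so it is evaluated by norm convergence together with uniqueness of
  Gegenbauer expansions. Sequences bounded by A B^n / n! are a convenient class: it contains the
  expansions of exponentials, is preserved by the matrix of \<open>T\<close>, and decays faster than
  the weight n^(n/2) of the norm grows.\<close>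

fun gauss_moment :: "real \<Rightarrow> nat \<Rightarrow> real" where
  "gauss_moment v 0 = 1"
| "gauss_moment v (Suc 0) = 0"
| "gauss_moment v (Suc (Suc n)) = v * real (Suc n) * gauss_moment v n"

lemma gauss_moment_Suc: "gauss_moment v (Suc n) = v * real n * gauss_moment v (n - 1)"
  by (cases n) auto

text \<open>Only the joint moments are assumed. Every later expectation is that of a polynomial in
  the family, so integrability comes with the moments, and integration by parts is the recursion
  \<open>gauss_moment_Suc\<close>. The numbers \<open>v j\<close> are variances;
  \<open>v j = 0\<close> describes a variable that vanishes almost surely.\<close>

locale gauss_family =
  fixes M :: "'a measure" and J :: "'j set" and \<xi> :: "'j \<Rightarrow> 'a \<Rightarrow> real" and v :: "'j \<Rightarrow> real"
  assumes fin: "finite J"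
    and mom: "\<And>e. has_bochner_integral M (\<lambda>\<omega>. \<Prod>j\<in>J. \<xi> j \<omega> ^ e j)
                     (\<Prod>j\<in>J. gauss_moment (v j) (e j))"
begin

definition lin :: "('j \<Rightarrow> complex) \<Rightarrow> 'a \<Rightarrow> complex" where
  "lin c \<omega> = (\<Sum>j\<in>J. c j * of_real (\<xi> j \<omega>))"

definition cov :: "('j \<Rightarrow> complex) \<Rightarrow> ('j \<Rightarrow> complex) \<Rightarrow> complex" where
  "cov c d = (\<Sum>j\<in>J. of_real (v j) * c j * d j)"

definition mon :: "('j \<Rightarrow> nat) \<Rightarrow> 'a \<Rightarrow> complex" where
  "mon e \<omega> = of_real (\<Prod>j\<in>J. \<xi> j \<omega> ^ e j)"

fun word :: "('j \<Rightarrow> complex) list \<Rightarrow> 'a \<Rightarrow> complex" where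
  "word [] \<omega> = 1"
| "word (d # ds) \<omega> = lin d \<omega> * word ds \<omega>"

text \<open>The derivation on words that sends each linear form \<open>lin d\<close> to the number
  \<open>\<kappa> d\<close>; for \<open>\<kappa> = cov c\<close> it is the derivative in the
  covariance direction of \<open>c\<close>.\<close>

fun dword :: "(('j \<Rightarrow> complex) \<Rightarrow> complex) \<Rightarrow> ('j \<Rightarrow> complex) list \<Rightarrow> 'a \<Rightarrow> complex" where
  "dword \<kappa> [] \<omega> = 0"
| "dword \<kappa> (d # ds) \<omega> = \<kappa> d * word ds \<omega> + lin d \<omega> * dword \<kappa> ds \<omega>"

lemma word_append: "word (ds @ es) \<omega> = word ds \<omega> * word es \<omega>"
  by (induction ds) auto

lemma dword_append: "dword \<kappa> (ds @ es) \<omega> = dword \<kappa> ds \<omega> * word es \<omega> + word ds \<omega> * dword \<kappa> es \<omega>"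
  by (induction ds) (auto simp: word_append algebra_simps)

lemma mon_Suc: "i \<in> J \<Longrightarrow> mon (e(i := Suc (e i))) \<omega> = of_real (\<xi> i \<omega>) * mon e \<omega>"
proof -
  assume i: "i \<in> J"
  have "(\<Prod>j\<in>J. \<xi> j \<omega> ^ (e(i := Suc (e i))) j) = \<xi> i \<omega> ^ Suc (e i) * (\<Prod>j\<in>J-{i}. \<xi> j \<omega> ^ (e(i := Suc (e i))) j)"
    using i fin by (subst prod.remove[of _ i]) auto
  also have "(\<Prod>j\<in>J-{i}. \<xi> j \<omega> ^ (e(i := Suc (e i))) j) = (\<Prod>j\<in>J-{i}. \<xi> j \<omega> ^ e j)"
    by (intro prod.cong) auto
  also have "\<xi> i \<omega> ^ Suc (e i) * \<dots> = \<xi> i \<omega> * (\<Prod>j\<in>J. \<xi> j \<omega> ^ e j)"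
    using i fin by (subst prod.remove[of J i]) auto
  finally show ?thesis by (simp add: mon_def)
qed

lemma mon_lin: "mon e \<omega> * lin d \<omega> = (\<Sum>j\<in>J. d j * mon (e(j := Suc (e j))) \<omega>)"
  unfolding lin_def sum_distrib_left by (intro sum.cong) (auto simp: mon_Suc algebra_simps)

lemma has_bochner_integral_mon: 
  "has_bochner_integral M (mon e) (of_real (\<Prod>j\<in>J. gauss_moment (v j) (e j)))"
  unfolding mon_def by (rule has_bochner_integral_of_real[OF mom])

text \<open>The monomial in front makes the induction work: a linear form stripped from the word is
  absorbed into the exponents \<open>e\<close>.\<close>

lemma integrable_mon_word: "integrable M (\<lambda>\<omega>. mon e \<omega> * word ds \<omega>)"
proof (induction ds arbitrary: e)
  case Nil
  then show ?case using has_bochner_integral_mon[of e] by (simp add: has_bochner_integral_iff)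
next
  case (Cons d ds)
  have "mon e \<omega> * word (d # ds) \<omega> = (\<Sum>j\<in>J. d j * (mon (e(j := Suc (e j))) \<omega> * word ds \<omega>))" for \<omega>
    by (simp add: mon_lin mult.assoc[symmetric] sum_distrib_right)
  then show ?case using Cons by simp
qed

lemma mon_0: "mon (\<lambda>_. 0) = (\<lambda>_. 1)"
  by (simp add: mon_def fun_eq_iff)

lemma mon_dword_Cons: "mon e \<omega> * dword \<kappa> (d # ds) \<omega> = \<kappa> d * (mon e \<omega> * word ds \<omega>)
  + (\<Sum>j\<in>J. d j * (mon (e(j := Suc (e j))) \<omega> * dword \<kappa> ds \<omega>))"
  using mon_lin[of e \<omega> d]
  by (simp only: dword.simps distrib_left mult.assoc[symmetric] sum_distrib_right[symmetric] mult.commute[of "mon e \<omega>" "\<kappa> d"])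

lemma integrable_mon_dword: "integrable M (\<lambda>\<omega>. mon e \<omega> * dword \<kappa> ds \<omega>)"
proof (induction ds arbitrary: e)
  case (Cons d ds)
  show ?case unfolding mon_dword_Cons using Cons integrable_mon_word by simp
qed auto

text \<open>For an empty word this is the moment recursion in coordinate \<open>i\<close>. A longer
  word reduces to it by moving its first form into the monomial, which is why the exponents are
  arbitrary. For \<open>e i = 0\<close> the truncated exponent is harmless, as its coefficient is
  zero.\<close>

lemma stein_coordinate:
  assumes i: "i \<in> J"
  shows "(LINT \<omega>|M. mon (e(i := Suc (e i))) \<omega> * word ds \<omega>) =
    of_real (v i) * of_nat (e i) * (LINT \<omega>|M. mon (e(i := e i - 1)) \<omega> * word ds \<omega>)
    + (LINT \<omega>|M. mon e \<omega> * dword (\<lambda>d. of_real (v i) * d i) ds \<omega>)"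
proof (induction ds arbitrary: e)
  case Nil
  have *: "(\<Prod>j\<in>J. gauss_moment (v j) ((e(i := k)) j)) = gauss_moment (v i) k * (\<Prod>j\<in>J-{i}. gauss_moment (v j) (e j))" for k
  proof -
    have "(\<Prod>j\<in>J. gauss_moment (v j) ((e(i := k)) j)) = gauss_moment (v i) k * (\<Prod>j\<in>J-{i}. gauss_moment (v j) ((e(i := k)) j))"
      using i fin by (subst prod.remove[of _ i]) auto
    also have "(\<Prod>j\<in>J-{i}. gauss_moment (v j) ((e(i := k)) j)) = (\<Prod>j\<in>J-{i}. gauss_moment (v j) (e j))"
      by (intro prod.cong) auto
    finally show ?thesis .
  qed
  have "(LINT \<omega>|M. mon e' \<omega>) = of_real (\<Prod>j\<in>J. gauss_moment (v j) (e' j))" for e'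
    using has_bochner_integral_mon[of e'] by (simp add: has_bochner_integral_iff)
  then show ?case by (simp only: word.simps dword.simps mult_1_right mult_zero_right *)
      (simp add: gauss_moment_Suc)
next
  case (Cons d ds)
  let ?\<kappa> = "\<lambda>d. complex_of_real (v i) * d i"
  let ?u = "\<lambda>(e::'j\<Rightarrow>nat) j. e(j := Suc (e j))"
  let ?l = "\<lambda>e::'j\<Rightarrow>nat. e(i := e i - 1)"
  let ?W = "\<lambda>e. (LINT \<omega>|M. mon e \<omega> * word ds \<omega>)"
  let ?D = "\<lambda>e. (LINT \<omega>|M. mon e \<omega> * dword ?\<kappa> ds \<omega>)"
  have exp: "(LINT \<omega>|M. mon e \<omega> * word (d # ds) \<omega>) = (\<Sum>j\<in>J. d j * ?W (?u e j))" for e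
  proof -
    have "mon e \<omega> * word (d # ds) \<omega> = (\<Sum>j\<in>J. d j * (mon (?u e j) \<omega> * word ds \<omega>))" for \<omega>
      by (simp add: mon_lin mult.assoc[symmetric] sum_distrib_right)
    then show ?thesis by (simp add: integrable_mon_word)
  qed
  have expd: "(LINT \<omega>|M. mon e \<omega> * dword ?\<kappa> (d # ds) \<omega>) = ?\<kappa> d * ?W e + (\<Sum>j\<in>J. d j * ?D (?u e j))"
  proof -
    have "mon e \<omega> * dword ?\<kappa> (d # ds) \<omega> = ?\<kappa> d * (mon e \<omega> * word ds \<omega>)
      + (\<Sum>j\<in>J. d j * (mon (?u e j) \<omega> * dword ?\<kappa> ds \<omega>))" for \<omega>
      by (rule mon_dword_Cons)
    then show ?thesis by (simp add: integrable_mon_word integrable_mon_dword)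
  qed
  have comm: "?u (?u e i) j = ?u (?u e j) i" for j
    by (auto simp: fun_eq_iff)
  have alg: "w = a * c * b + z \<Longrightarrow> c * b = n * m + t \<Longrightarrow> x * w = a * n * (x * m) + x * a * t + x * z"
    for w a c b z n m t x :: complex by (simp add: algebra_simps)
  have step: "d j * ?W (?u (?u e i) j) =
      of_real (v i) * of_nat (e i) * (d j * ?W (?u (?l e) j)) + (if j = i then ?\<kappa> d * ?W e else 0)
      + d j * ?D (?u e j)" if "j \<in> J" for j
  proof -
    have "?W (?u (?u e i) j) = of_real (v i) * of_nat (?u e j i) * ?W (?l (?u e j)) + ?D (?u e j)"
      unfolding comm by (rule Cons)
    \<comment> \<open>Lowering \<open>i\<close> commutes with raising \<open>j\<close> unless the
      indices agree; then the coefficient is \<open>e i + 1\<close>, and the surplus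
      \<open>?W e\<close> is the derivative of the form \<open>d\<close>.\<close>
    moreover have "of_nat (?u e j i) * ?W (?l (?u e j)) = of_nat (e i) * ?W (?u (?l e) j) + (if j = i then ?W e else 0)"
    proof (cases "j = i")
      case True
      have "?l (?u e i) = e" by auto
      moreover have "?u (?l e) i = e" if "e i > 0" using that by auto
      ultimately show ?thesis using True by (cases "e i = 0") (auto simp: algebra_simps)
    next
      case False
      then have "?l (?u e j) = ?u (?l e) j" by (auto simp: fun_eq_iff)
      then show ?thesis using False by simp
    qed
    ultimately have "d j * ?W (?u (?u e i) j) = of_real (v i) * of_nat (e i) * (d j * ?W (?u (?l e) j))
        + d j * of_real (v i) * (if j = i then ?W e else 0) + d j * ?D (?u e j)"
      by (rule alg)
    moreover have "d j * of_real (v i) * (if j = i then ?W e else 0) = (if j = i then ?\<kappa> d * ?W e else 0)"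
      by (simp only: mult.commute split: if_splits) simp
    ultimately show ?thesis by (simp only:)
  qed
  have "(LINT \<omega>|M. mon (?u e i) \<omega> * word (d # ds) \<omega>) = (\<Sum>j\<in>J. d j * ?W (?u (?u e i) j))"
    by (rule exp)
  also have "\<dots> = (\<Sum>j\<in>J. of_real (v i) * of_nat (e i) * (d j * ?W (?u (?l e) j)) + (if j = i then ?\<kappa> d * ?W e else 0)
      + d j * ?D (?u e j))"
    by (intro sum.cong refl step)
  also have "\<dots> = of_real (v i) * of_nat (e i) * (\<Sum>j\<in>J. d j * ?W (?u (?l e) j))
      + (?\<kappa> d * ?W e + (\<Sum>j\<in>J. d j * ?D (?u e j)))"
    using i fin by (simp only: sum.distrib sum_distrib_left[symmetric] sum.delta if_True add.assoc)
  finally show ?case unfolding exp[symmetric] expd[symmetric] .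
qed

lemma integrable_word: "integrable M (word ds)"
  using integrable_mon_word[of "\<lambda>_. 0" ds] by (simp add: mon_0)

lemma integrable_dword: "integrable M (dword \<kappa> ds)"
  using integrable_mon_dword[of "\<lambda>_. 0" \<kappa> ds] by (simp add: mon_0)

lemma dword_cov: "dword (cov c) ds \<omega> = (\<Sum>i\<in>J. c i * dword (\<lambda>d. of_real (v i) * d i) ds \<omega>)"
  by (induction ds) (auto simp: cov_def sum_distrib_left sum_distrib_right sum.distrib[symmetric] algebra_simps intro!: sum.cong)

text \<open>Coordinate identities at exponent zero, weighted by \<open>c\<close>;
  \<open>dword\<close> is linear in its derivation, so the weights assemble into
  \<open>cov c\<close>.\<close>

lemma stein_word: "(LINT \<omega>|M. lin c \<omega> * word ds \<omega>) = (LINT \<omega>|M. dword (cov c) ds \<omega>)"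
proof -
  have 1: "(LINT \<omega>|M. of_real (\<xi> i \<omega>) * word ds \<omega>) = (LINT \<omega>|M. dword (\<lambda>d. of_real (v i) * d i) ds \<omega>)"
    if "i \<in> J" for i
    using stein_coordinate[OF that, of "\<lambda>_. 0" ds] mon_Suc[OF that, of "\<lambda>_. 0"] by (simp add: mon_0)
  have 2: "integrable M (\<lambda>\<omega>. of_real (\<xi> i \<omega>) * word ds \<omega>)" if "i \<in> J" for i
    using integrable_mon_word[of "(\<lambda>_. 0)(i := Suc 0)" ds] mon_Suc[OF that, of "\<lambda>_. 0"]
    by (simp add: mon_0)
  show ?thesis
    unfolding dword_cov lin_def
    by (simp add: sum_distrib_right mult.assoc 1 2 integrable_dword)
qed

text \<open>A function of \<omega> carries no formal derivative, so polynomials are represented by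
  lists of coefficients and words; \<open>dwords\<close> differentiates the list.\<close>

definition words :: "(complex \<times> ('j \<Rightarrow> complex) list) list \<Rightarrow> 'a \<Rightarrow> complex" where
  "words L \<omega> = (\<Sum>(k, ds)\<leftarrow>L. k * word ds \<omega>)"

definition dwords ::
  "(('j \<Rightarrow> complex) \<Rightarrow> complex) \<Rightarrow> (complex \<times> ('j \<Rightarrow> complex) list) list \<Rightarrow> 'a \<Rightarrow> complex" where
  "dwords \<kappa> L \<omega> = (\<Sum>(k, ds)\<leftarrow>L. k * dword \<kappa> ds \<omega>)"

lemma words_simps: "words [] \<omega> = 0" "words ((k, ds) # L) \<omega> = k * word ds \<omega> + words L \<omega>"
  "words (L @ L') \<omega> = words L \<omega> + words L' \<omega>"
  by (simp_all add: words_def)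

lemma dwords_simps: "dwords \<kappa> [] \<omega> = 0" "dwords \<kappa> ((k, ds) # L) \<omega> = k * dword \<kappa> ds \<omega> + dwords \<kappa> L \<omega>"
  "dwords \<kappa> (L @ L') \<omega> = dwords \<kappa> L \<omega> + dwords \<kappa> L' \<omega>"
  by (simp_all add: dwords_def)

definition poly_rv :: "('a \<Rightarrow> complex) \<Rightarrow> bool" where
  "poly_rv F \<longleftrightarrow> (\<exists>L. F = words L)"

text \<open>\<open>\<Phi> \<omega>\<close> stands for \<open>s \<mapsto> F (\<xi> + s \<cdot> cov c)\<close> for a polynomial \<open>F\<close>; only the value and the
  derivative at \<open>s = 0\<close> are recorded.\<close>

definition shifted :: "('j \<Rightarrow> complex) \<Rightarrow> ('a \<Rightarrow> complex poly) \<Rightarrow> bool" where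
  "shifted c \<Phi> \<longleftrightarrow>
     (\<exists>L. (\<lambda>\<omega>. coeff (\<Phi> \<omega>) 0) = words L \<and> (\<lambda>\<omega>. coeff (\<Phi> \<omega>) 1) = dwords (cov c) L)"

lemma integrable_words: "integrable M (words L)"
proof -
  have "words [] = (\<lambda>\<omega>. 0)" "words ((k, ds) # L) = (\<lambda>\<omega>. k * word ds \<omega> + words L \<omega>)" for k ds L
    by (auto simp: words_simps)
  then show ?thesis
    by (induction L) (auto intro!: Bochner_Integration.integrable_add integrable_mult_right integrable_word)
qed

lemma integrable_dwords: "integrable M (dwords \<kappa> L)"
proof -
  have "dwords \<kappa> [] = (\<lambda>\<omega>. 0)"
    "dwords \<kappa> ((k, ds) # L) = (\<lambda>\<omega>. k * dword \<kappa> ds \<omega> + dwords \<kappa> L \<omega>)" for k ds L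
    by (auto simp: dwords_simps)
  then show ?thesis
    by (induction L) (auto intro!: Bochner_Integration.integrable_add integrable_mult_right integrable_dword)
qed

lemma stein:
  assumes "shifted c \<Phi>"
  shows "(LINT \<omega>|M. lin c \<omega> * coeff (\<Phi> \<omega>) 0) = (LINT \<omega>|M. coeff (\<Phi> \<omega>) 1)"
proof -
  have i: "integrable M (\<lambda>\<omega>. lin c \<omega> * word ds \<omega>)" for ds
    using integrable_word[of "c # ds"] unfolding word.simps(2)[abs_def] .
  have A: "integrable M (\<lambda>\<omega>. lin c \<omega> * words L \<omega>) \<and>
    (LINT \<omega>|M. lin c \<omega> * words L \<omega>) = (LINT \<omega>|M. dwords (cov c) L \<omega>)" for L
  proof (induction L)
    case (Cons a L)
    obtain k ds where a: "a = (k, ds)" by (cases a)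
    have "(\<lambda>\<omega>. lin c \<omega> * words (a # L) \<omega>) =
      (\<lambda>\<omega>. k * (lin c \<omega> * word ds \<omega>) + lin c \<omega> * words L \<omega>)"
      by (simp add: a words_simps algebra_simps)
    then show ?case using Cons i[of ds]
      by (simp add: a dwords_simps stein_word integrable_dword integrable_dwords)
  qed (simp add: words_simps dwords_simps)
  obtain L where L: "(\<lambda>\<omega>. coeff (\<Phi> \<omega>) 0) = words L" "(\<lambda>\<omega>. coeff (\<Phi> \<omega>) 1) = dwords (cov c) L"
    using assms unfolding shifted_def by blast
  then have "coeff (\<Phi> \<omega>) 0 = words L \<omega>" "coeff (\<Phi> \<omega>) 1 = dwords (cov c) L \<omega>" for \<omega>
    by (auto dest: fun_cong)
  then show ?thesis using A[of L] by (simp only:)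
qed

lemma poly_rv_integrable: "poly_rv F \<Longrightarrow> integrable M F"
  unfolding poly_rv_def using integrable_words by auto

lemma poly_rv_const: "poly_rv (\<lambda>\<omega>. k)"
  unfolding poly_rv_def by (rule exI[of _ "[(k, [])]"]) (simp add: words_simps fun_eq_iff)

lemma poly_rv_lin: "poly_rv (lin d)"
  unfolding poly_rv_def by (rule exI[of _ "[(1, [d])]"]) (simp add: words_simps fun_eq_iff)

lemma poly_rv_add: "poly_rv F \<Longrightarrow> poly_rv G \<Longrightarrow> poly_rv (\<lambda>\<omega>. F \<omega> + G \<omega>)"
  unfolding poly_rv_def using words_simps(3) by (metis (no_types, lifting) ext)

definition words_prod where
  "words_prod L L' = concat (map (\<lambda>(k, ds). map (\<lambda>(k', ds'). (k * k' :: complex, ds @ ds')) L') L)"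

lemma words_mult: "words (words_prod L L') \<omega> = words L \<omega> * words L' \<omega>"
proof (induction L)
  case (Cons a L)
  obtain k ds where a: "a = (k, ds)" by (cases a)
  have "words (map (\<lambda>(k', ds'). (k * k', ds @ ds')) L') \<omega> = k * word ds \<omega> * words L' \<omega>"
    by (induction L') (auto simp: algebra_simps word_append words_simps)
  then show ?case using Cons by (simp add: a algebra_simps words_prod_def words_simps)
qed (simp add: words_prod_def words_simps)

lemma dwords_mult: "dwords \<kappa> (words_prod L L') \<omega> = words L \<omega> * dwords \<kappa> L' \<omega> + dwords \<kappa> L \<omega> * words L' \<omega>"
proof (induction L)
  case (Cons a L)
  obtain k ds where a: "a = (k, ds)" by (cases a)
  have "dwords \<kappa> (map (\<lambda>(k', ds'). (k * k', ds @ ds')) L') \<omega> =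
      k * word ds \<omega> * dwords \<kappa> L' \<omega> + k * dword \<kappa> ds \<omega> * words L' \<omega>"
    by (induction L') (auto simp: algebra_simps dword_append words_simps dwords_simps)
  then show ?case using Cons by (simp add: a algebra_simps words_prod_def words_simps dwords_simps)
qed (simp add: words_prod_def words_simps dwords_simps)

lemma poly_rv_mult: "poly_rv F \<Longrightarrow> poly_rv G \<Longrightarrow> poly_rv (\<lambda>\<omega>. F \<omega> * G \<omega>)"
  unfolding poly_rv_def using words_mult by (metis (no_types, lifting) ext)

lemma poly_rv_sum: "(\<And>x. x \<in> A \<Longrightarrow> poly_rv (F x)) \<Longrightarrow> poly_rv (\<lambda>\<omega>. \<Sum>x\<in>A. F x \<omega>)"
  by (induction A rule: infinite_finite_induct) (simp_all add: poly_rv_const poly_rv_add)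

lemma poly_rv_prod: "(\<And>x. x \<in> A \<Longrightarrow> poly_rv (F x)) \<Longrightarrow> poly_rv (\<lambda>\<omega>. \<Prod>x\<in>A. F x \<omega>)"
  by (induction A rule: infinite_finite_induct) (simp_all add: poly_rv_const poly_rv_mult)

lemma poly_rv_power: "poly_rv F \<Longrightarrow> poly_rv (\<lambda>\<omega>. F \<omega> ^ n)"
  by (induction n) (simp_all add: poly_rv_const poly_rv_mult)

lemma shifted_const: "shifted c (\<lambda>\<omega>. [:k:])"
  unfolding shifted_def
  by (rule exI[of _ "[(k, [])]"]) (simp add: words_simps dwords_simps fun_eq_iff)

lemma shifted_lin: "shifted c (\<lambda>\<omega>. [:lin d \<omega>, cov c d:])"
  unfolding shifted_def
  by (rule exI[of _ "[(1, [d])]"]) (simp add: words_simps dwords_simps fun_eq_iff)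

lemma shifted_add:
  assumes "shifted c F" "shifted c G"
  shows "shifted c (\<lambda>\<omega>. F \<omega> + G \<omega>)"
proof -
  obtain L L' where "(\<lambda>\<omega>. coeff (F \<omega>) 0) = words L" "(\<lambda>\<omega>. coeff (F \<omega>) 1) = dwords (cov c) L"
    "(\<lambda>\<omega>. coeff (G \<omega>) 0) = words L'" "(\<lambda>\<omega>. coeff (G \<omega>) 1) = dwords (cov c) L'"
    using assms unfolding shifted_def by blast
  note * = this[THEN fun_cong]
  show ?thesis unfolding shifted_def
    by (rule exI[of _ "L @ L'"]) (simp only: fun_eq_iff coeff_add * words_simps dwords_simps simp_thms)
qed

lemma shifted_mult:
  assumes "shifted c F" "shifted c G"
  shows "shifted c (\<lambda>\<omega>. F \<omega> * G \<omega>)"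
proof -
  obtain L L' where "(\<lambda>\<omega>. coeff (F \<omega>) 0) = words L" "(\<lambda>\<omega>. coeff (F \<omega>) 1) = dwords (cov c) L"
    "(\<lambda>\<omega>. coeff (G \<omega>) 0) = words L'" "(\<lambda>\<omega>. coeff (G \<omega>) 1) = dwords (cov c) L'"
    using assms unfolding shifted_def by blast
  note * = this[THEN fun_cong]
  have 0: "coeff (p * q) 0 = coeff p 0 * coeff q 0"
    "coeff (p * q) 1 = coeff p 0 * coeff q 1 + coeff p 1 * coeff q 0" for p q :: "complex poly"
    by (simp_all add: coeff_mult)
  show ?thesis unfolding shifted_def
    by (rule exI[of _ "words_prod L L'"]) (simp only: fun_eq_iff 0 * words_mult dwords_mult simp_thms)
qed

lemma shifted_sum: "(\<And>x. x \<in> A \<Longrightarrow> shifted c (F x)) \<Longrightarrow> shifted c (\<lambda>\<omega>. \<Sum>x\<in>A. F x \<omega>)"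
  using shifted_const[of c 0] by (induction A rule: infinite_finite_induct) (simp_all add: shifted_add)

lemma shifted_prod: "(\<And>x. x \<in> A \<Longrightarrow> shifted c (F x)) \<Longrightarrow> shifted c (\<lambda>\<omega>. \<Prod>x\<in>A. F x \<omega>)"
  using shifted_const[of c 1] by (induction A rule: infinite_finite_induct) (simp_all add: one_pCons shifted_mult)

lemma shifted_power: "shifted c F \<Longrightarrow> shifted c (\<lambda>\<omega>. F \<omega> ^ n)"
  using shifted_const[of c 1] by (induction n) (simp_all add: one_pCons shifted_mult)

end

section \<open>The Harer--Zagier recursion from Hermite equations\<close>

text \<open>Euler operator \<open>u d/du\<close>; with \<open>z = 1/u\<close> it is \<open>- z d/dz\<close>.\<close>

definition fps_euler :: "complex fps \<Rightarrow> complex fps" where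
  "fps_euler f = fps_X * fps_deriv f"

lemma fps_euler_nth [simp]: "fps_nth (fps_euler f) n = of_nat n * fps_nth f n"
  by (cases n) (simp_all add: fps_euler_def)

lemma fps_euler_add: "fps_euler (f + g) = fps_euler f + fps_euler g"
  and fps_euler_diff: "fps_euler (f - g) = fps_euler f - fps_euler g"
  and fps_euler_uminus: "fps_euler (- f) = - fps_euler f"
  and fps_euler_numeral: "fps_euler (numeral k) = 0"
  and fps_euler_mult: "fps_euler (f * g) = fps_euler f * g + f * fps_euler g"
  and fps_euler_const: "fps_euler (fps_const c) = 0"
  and fps_euler_X2: "fps_euler (fps_X\<^sup>2) = 2 * fps_X\<^sup>2"
  by (simp_all add: fps_euler_def algebra_simps power2_eq_square)

text \<open>Put p(z) = z^N a(1/z) and q(z) = z^(-N) b(1/z). Then \<open>a1\<close> and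
  \<open>- b1\<close> are z^(1-N) p' and z^(N+1) q', \<open>ode_b\<close> reads \<sigma>2 q'' + z q'
  + N q = 0, \<open>one\<close> reads N p q + \<sigma>2 p' q' = N, and \<open>w\<close> is given by
  N w = z (N p' q + \<sigma>2 p'' q'). The products of p, p' with q, q' form a closed linear system,
  from which everything but \<open>w\<close> is eliminated.\<close>

lemma third_order_recurrence:
  fixes a b w Y n :: "complex fps" and N :: nat and \<sigma>2 :: complex
  assumes N: "N > 0" and \<sigma>2: "\<sigma>2 \<noteq> 0" and b0: "fps_nth b 0 = 1"
  defines "n \<equiv> fps_const (of_nat N)" and "Y \<equiv> fps_const \<sigma>2 * fps_X\<^sup>2"
  defines "a1 \<equiv> n * a - fps_euler a" and "b1 \<equiv> n * b + fps_euler b"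
  assumes ode_b: "Y * (n * b1 + fps_euler b1 + b1) = fps_euler b"
    and one: "n * a * b - Y * a1 * b1 = n"
    and w: "n * w = n * a1 * b - Y * (n * a1 - fps_euler a1 - a1) * b1"
  shows "of_nat k * of_nat (k + 2) * fps_nth w k =
    4 * of_nat N * \<sigma>2 * (if k \<ge> 2 then of_nat k * of_nat (k - 1) * fps_nth w (k - 2) else 0)
    + \<sigma>2\<^sup>2 * (if k \<ge> 4 then of_nat k * of_nat (k - 1) * of_nat (k - 2) * of_nat (k - 3) * fps_nth w (k - 4) else 0)"
proof -
  let ?D = "fps_euler"
  have eY: "?D Y = 2 * Y" unfolding Y_def
    by (simp add: fps_euler_mult fps_euler_X2 fps_euler_const)
  have en: "?D (n * f) = n * ?D f" for f unfolding n_def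
    by (simp add: fps_euler_mult fps_euler_const)
  have Dn: "?D n = 0" by (simp add: n_def fps_euler_const)
  have n0: "n \<noteq> 0" using N by (simp add: n_def)
  have b1: "b1 \<noteq> 0"
  proof
    assume "b1 = 0"
    then have "fps_nth b1 0 = 0" by simp
    then show False using N by (simp add: b1_def n_def b0)
  qed
  have Da: "?D a = n * a - a1" and Db: "?D b = b1 - n * b" by (simp_all add: a1_def b1_def)
  have Yb: "Y * ?D b1 = b1 - n * b - Y * n * b1 - Y * b1"
    using ode_b unfolding Db by (simp add: algebra_simps)
  text \<open>Differentiating the identity \<open>one\<close> yields the Hermite equation for \<open>a\<close>, up to the factor \<open>b1\<close>.\<close>
  have "?D (n * a * b - Y * a1 * b1) = 0"
    unfolding one by (simp add: n_def fps_euler_const)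
  then have "n * (?D a * b + a * ?D b) - (2 * Y * a1 * b1 + Y * ?D a1 * b1 + a1 * (Y * ?D b1)) = 0"
    by (simp add: fps_euler_diff fps_euler_mult eY Dn algebra_simps)
  then have "b1 * (n * a - a1 + Y * (n * a1 - ?D a1 - a1)) = 0"
    unfolding Da Db Yb by (simp add: algebra_simps)
  then have Ya: "Y * ?D a1 = n * a - a1 + Y * n * a1 - Y * a1"
  proof -
    have "n * a - a1 + Y * (n * a1 - ?D a1 - a1) = 0"
      using \<open>b1 * _ = 0\<close> b1 by (simp only: mult_eq_0_iff simp_thms)
    then show ?thesis by (simp add: algebra_simps)
  qed
  \<comment> \<open>These are p q, z p' q, z p q' and z^2 p' q'.\<close>
  define A B C E where "A = a * b" and "B = a1 * b" and "C = - a * b1" and "E = - a1 * b1"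
  have DA: "?D A = - (B + C)"
    by (simp add: A_def B_def C_def fps_euler_mult Da Db algebra_simps)
  have "Y * ?D B = (Y * ?D a1) * b + Y * a1 * ?D b" by (simp add: B_def fps_euler_mult algebra_simps)
  then have DB: "Y * ?D B = - (B - n * A + Y * (E + B))"
    unfolding Ya Db by (simp add: A_def B_def C_def E_def algebra_simps)
  have "Y * ?D C = - (Y * ?D a * b1 + a * (Y * ?D b1))"
    by (simp add: C_def fps_euler_mult fps_euler_def algebra_simps)
  then have DC: "Y * ?D C = C + n * A - Y * (E + C)"
    unfolding Yb Da by (simp add: A_def B_def C_def E_def algebra_simps)
  have "Y * ?D E = - ((Y * ?D a1) * b1 + a1 * (Y * ?D b1))"
    by (simp add: E_def fps_euler_mult fps_euler_def algebra_simps)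
  then have DE: "Y * ?D E = n * (B + C) - 2 * Y * E"
    unfolding Ya Yb by (simp add: A_def B_def C_def E_def algebra_simps)
  have nw: "n * w = n * (B - C) + E"
  proof -
    have "Y * (n * a1 - ?D a1 - a1) = a1 - n * a" using Ya by (simp add: algebra_simps)
    then show ?thesis unfolding w by (simp only:) (simp add: B_def C_def E_def algebra_simps)
  qed
  \<comment> \<open>Elimination: \<open>nw\<close> and its derivative give \<open>E\<close>, the
    derivative of \<open>E\<close> gives \<open>v = B + C\<close>, and \<open>A\<close> disappears
    after differentiating the equation for \<open>v\<close>, since its own derivative is
    \<open>- v\<close>.\<close>
  have "Y * ?D (n * w) = n * (Y * ?D B - Y * ?D C) + Y * ?D E"
    unfolding nw by (simp add: fps_euler_add fps_euler_diff fps_euler_mult Dn algebra_simps)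
  also have "\<dots> = Y * (- n * w - E)"
    unfolding DB DC DE using arg_cong[OF nw, of "\<lambda>x. Y * x"] by (simp add: algebra_simps)
  finally have "Y * ?D (n * w) - Y * (- n * w - E) = 0" by simp
  moreover have "Y * ?D (n * w) - Y * (- n * w - E) = Y * (n * ?D w + n * w + E)"
    by (simp add: fps_euler_mult Dn algebra_simps)
  ultimately have "Y * (n * ?D w + n * w + E) = 0" by metis
  moreover have "Y \<noteq> 0" using \<sigma>2 by (simp add: Y_def)
  ultimately have "n * ?D w + n * w + E = 0" by (metis mult_eq_0_iff)
  then have E: "E = - n * (?D w + w)" by (simp add: eq_neg_iff_add_eq_0 algebra_simps)
  define v where "v = B + C"
  have DEE: "?D E = - n * (?D (?D w) + ?D w)"
    unfolding E by (simp add: fps_euler_add fps_euler_mult fps_euler_uminus Dn)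
  have "n * (v + Y * (?D (?D w) + 3 * ?D w + 2 * w)) = n * (B + C) - 2 * Y * E - Y * ?D E"
    unfolding DEE by (simp add: E v_def algebra_simps)
  then have "v + Y * (?D (?D w) + 3 * ?D w + 2 * w) = 0"
    using n0 unfolding DE by simp
  then have v: "v = - Y * (?D (?D w) + 3 * ?D w + 2 * w)" by (simp add: eq_neg_iff_add_eq_0)
  have "n * (B - C) = n * (2 * w + ?D w)" using nw unfolding E by (simp add: algebra_simps)
  then have BC: "B - C = 2 * w + ?D w" using n0 by simp
  have "Y * ?D v = - Y * v - 2 * Y * E - (B - C) + 2 * n * A"
    unfolding v_def fps_euler_add distrib_left DB DC by (simp add: algebra_simps)
  then have "Y * ?D v = - Y * v + 2 * n * Y * (?D w + w) - (2 * w + ?D w) + 2 * n * A"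
    unfolding BC E by (simp add: algebra_simps)
  then have "?D (Y * ?D v) = ?D (- (Y * v) + 2 * n * Y * (?D w + w) - (2 * w + ?D w) + 2 * n * A)" by simp
  then have fin: "?D (Y * ?D v) + ?D (Y * v) = 2 * (n * ?D (Y * (?D w + w))) - (2 * ?D w + ?D (?D w)) - 2 * (n * v)"
    using DA unfolding v_def[symmetric]
    by (simp add: fps_euler_add fps_euler_diff fps_euler_uminus fps_euler_mult fps_euler_numeral eY Dn algebra_simps)
  have Ynth: "fps_nth (Y * f) k = (if k \<ge> 2 then \<sigma>2 * fps_nth f (k - 2) else 0)" for f k
    unfolding Y_def by (simp add: mult.assoc fps_X_power_mult_nth not_less)
  have nnth: "fps_nth (n * f) k = of_nat N * fps_nth f k" for f k
    by (simp add: n_def)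
  have n2: "fps_nth (numeral c * f) k = numeral c * fps_nth f k"
    "fps_nth (f * numeral c) k = numeral c * fps_nth f k" for c k and f :: "complex fps"
    by (simp_all add: numeral_fps_const mult.commute)
  have vn: "fps_nth v k = (if k \<ge> 2 then - \<sigma>2 * of_nat (k - 1) * of_nat k * fps_nth w (k - 2) else 0)" for k
    unfolding v by (auto simp: Ynth n2 of_nat_diff algebra_simps power2_eq_square)
  note co = arg_cong[OF fin, of "\<lambda>f. fps_nth f k", unfolded fps_add_nth fps_sub_nth fps_euler_nth n2 nnth Ynth vn]
  \<comment> \<open>Indices below 4 are separated because subtraction on naturals truncates.\<close>
  consider "k < 2" | "k = 2" | "k = 3" | j where "k = j + 4"
  proof -
    have "k < 2 \<or> k = 2 \<or> k = 3 \<or> k = (k - 4) + 4" by arith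
    then show ?thesis using that by blast
  qed
  then show ?thesis
  proof cases
    case 4
    have "j + 4 - 2 = j + 2" "j + 4 - 2 - 2 = j" "j + 4 - 4 = j" "j + 4 - 1 = j + 3" "j + 4 - 3 = j + 1" by auto
    with co show ?thesis unfolding 4 by (simp add: algebra_simps power2_eq_square)
  qed (use co in \<open>auto simp: algebra_simps less_2_cases_iff\<close>)
qed

section \<open>Characteristic polynomials\<close>

lemma det_replace_row:
  assumes A: "A \<in> carrier_mat n n" and j: "j < n"
  shows "det (mat n n (\<lambda>(i, k). if i = j then r k else A $$ (i, k))) = (\<Sum>k<n. r k * cofactor A j k)"
proof -
  let ?B = "mat n n (\<lambda>(i, k). if i = j then r k else A $$ (i, k))"
  have "det ?B = (\<Sum>k<n. ?B $$ (j, k) * cofactor ?B j k)"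
    by (rule laplace_expansion_row) (use j in auto)
  also have "\<dots> = (\<Sum>k<n. r k * cofactor A j k)"
  proof (intro sum.cong refl)
    fix k assume k: "k \<in> {..<n}"
    have "mat_delete ?B j k = mat_delete A j k"
      by (rule eq_matI) (use A j k in \<open>auto simp: mat_delete_def\<close>)
    then show "?B $$ (j, k) * cofactor ?B j k = r k * cofactor A j k"
      using j k by (simp add: cofactor_def)
  qed
  finally show ?thesis .
qed

text \<open>Perturb the rows one after another. Expanding along the new row replaces it by
  \<open>v\<close>, and the multiples of \<open>v\<close> in the rows perturbed earlier can then be
  removed by row operations; so each step contributes cofactors of the original \<open>A\<close>
  only.\<close>

lemma det_add_rank_one:
  fixes A :: "'a :: comm_ring_1 mat"
  assumes A: "A \<in> carrier_mat n n"
  shows "det (mat n n (\<lambda>(i, k). A $$ (i, k) + u i * v k)) =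
    det A + (\<Sum>i<n. \<Sum>k<n. u i * v k * cofactor A i k)"
proof -
  define B where "B m = mat n n (\<lambda>(i, k). A $$ (i, k) + (if i < m then u i * v k else 0))" for m
  define C where "C m l = mat n n (\<lambda>(i, k). if i = m then v k else A $$ (i, k) + (if i < l then u i * v k else 0))" for m l
  have BC: "B m \<in> carrier_mat n n" "C m l \<in> carrier_mat n n" for m l
    by (auto simp: B_def C_def)
  have C: "det (C m l) = (\<Sum>k<n. v k * cofactor A m k)" if "l \<le> m" "m < n" for l m
    using that
  proof (induction l)
    case 0
    have "C m 0 = mat n n (\<lambda>(i, k). if i = m then v k else A $$ (i, k))"
      by (auto simp: C_def)
    then show ?case using det_replace_row[OF A, of m v] 0 by simp
  next
    case (Suc l)
    \<comment> \<open>Row \<open>m\<close> equals \<open>v\<close>, so adding a multiple of it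
      perturbs row \<open>l\<close> without changing the determinant.\<close>
    have "C m (Suc l) = addrow (u l) l m (C m l)"
      by (rule eq_matI) (use Suc in \<open>auto simp: C_def less_Suc_eq algebra_simps\<close>)
    then have "det (C m (Suc l)) = det (C m l)"
      using det_addrow[of m n l "C m l" "u l"] Suc BC by simp
    then show ?case using Suc by simp
  qed
  have B: "det (B m) = det A + (\<Sum>i<m. \<Sum>k<n. u i * v k * cofactor A i k)" if "m \<le> n" for m
    using that
  proof (induction m)
    case 0
    have "B 0 = A" by (rule eq_matI) (use A in \<open>auto simp: B_def\<close>)
    then show ?case by simp
  next
    case (Suc m)
    have "det (B (Suc m)) = (\<Sum>k<n. B (Suc m) $$ (m, k) * cofactor (B m) m k)"
    proof -
      have "B (Suc m) = mat n n (\<lambda>(i, k). if i = m then B (Suc m) $$ (m, k) else B m $$ (i, k))"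
        by (rule eq_matI) (use Suc in \<open>auto simp: B_def less_Suc_eq\<close>)
      then show ?thesis using det_replace_row[OF BC(1)[of m], of m "\<lambda>k. B (Suc m) $$ (m, k)"] Suc by simp
    qed
    also have "\<dots> = (\<Sum>k<n. (B m $$ (m, k) + u m * v k) * cofactor (B m) m k)"
      by (intro sum.cong refl) (use Suc in \<open>auto simp: B_def\<close>)
    also have "\<dots> = det (B m) + u m * (\<Sum>k<n. v k * cofactor (B m) m k)"
      using laplace_expansion_row[OF BC(1)[of m], of m] Suc
      by (simp add: algebra_simps sum.distrib sum_distrib_left)
    also have "(\<Sum>k<n. v k * cofactor (B m) m k) = det (C m m)"
    proof -
      have "C m m = mat n n (\<lambda>(i, k). if i = m then v k else B m $$ (i, k))"
        by (rule eq_matI) (auto simp: B_def C_def)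
      then show ?thesis using det_replace_row[OF BC(1)[of m], of m v] Suc by simp
    qed
    also have "det (C m m) = (\<Sum>k<n. v k * cofactor A m k)"
      using C[of m m] Suc by simp
    finally show ?case using Suc by (simp add: sum_distrib_left mult.assoc)
  qed
  have "B n = mat n n (\<lambda>(i, k). A $$ (i, k) + u i * v k)"
    by (rule eq_matI) (auto simp: B_def)
  then show ?thesis using B[of n] by simp
qed

section \<open>Traces of powers as power sums of eigenvalues\<close>

definition shift_mat :: "nat \<Rightarrow> complex \<Rightarrow> complex mat \<Rightarrow> complex mat" where
  "shift_mat n z A = mat n n (\<lambda>(i, j). (if i = j then z else 0) - A $$ (i, j))"

lemma shift_mat_carrier [simp]: "shift_mat n z A \<in> carrier_mat n n"
  by (simp add: shift_mat_def)

lemma det_shift_mat: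
  assumes "A \<in> carrier_mat n n"
  shows "det (shift_mat n z A) = poly (char_poly A) z"
proof -
  have "- char_matrix A z = shift_mat n z A"
    by (rule eq_matI) (use assms in \<open>auto simp: char_matrix_def shift_mat_def\<close>)
  then show ?thesis using char_poly_matrix[OF assms, of z] by simp
qed

lemma sum_cofactor_shift_mat:
  assumes A: "A \<in> carrier_mat n n"
  shows "(\<Sum>i<n. cofactor (shift_mat n z A) i i) = poly (pderiv (char_poly A)) z"
proof -
  have "cofactor (shift_mat n z A) i i = poly (char_poly (mat_delete A i i)) z" if i: "i < n" for i
  proof -
    have c: "mat_delete A i i \<in> carrier_mat (n - 1) (n - 1)" using A i by (auto simp: mat_delete_def)
    have "mat_delete (shift_mat n z A) i i = shift_mat (n - 1) z (mat_delete A i i)"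
      by (rule eq_matI) (use A i in \<open>auto simp: mat_delete_def shift_mat_def\<close>)
    then show ?thesis by (simp add: cofactor_def det_shift_mat[OF c[unfolded One_nat_def]] flip: power_mult_distrib power_add mult_2)
  qed
  then show ?thesis by (simp add: pderiv_char_poly[OF A] poly_sum)
qed

lemma proots_linear_factors: "proots (\<Prod>a\<leftarrow>as. [:- a, 1:]) = mset (as :: 'a :: idom list)"
proof (induction as)
  case (Cons a as)
  have "(\<Prod>a\<leftarrow>as. [:- a, 1:]) \<noteq> 0" by (auto simp: prod_list_zero_iff)
  then show ?case using Cons by (simp add: proots_mult del: mult_pCons_left)
qed simp

text \<open>The polynomial \<open>\<Sum>\<^sub>a a\<^sup>k \<Prod>\<^sub>b\<^sub>\<noteq>\<^sub>a (x - b)\<close>, to be identified with \<open>tr (A\<^sup>k adj (x - A))\<close>: both satisfy the same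
  recursion in \<open>k\<close> and have degree less than the size of \<open>A\<close>.\<close>

primrec power_sum_quotient :: "nat \<Rightarrow> complex list \<Rightarrow> complex poly" where
  "power_sum_quotient k [] = 0"
| "power_sum_quotient k (a # as) =
     Polynomial.smult (a ^ k) (\<Prod>b\<leftarrow>as. [:- b, 1:]) + [:- a, 1:] * power_sum_quotient k as"

lemma power_sum_quotient_0: "power_sum_quotient 0 as = pderiv (\<Prod>a\<leftarrow>as. [:- a, 1:])"
proof (induction as)
  case (Cons a as)
  have "pderiv ([:- a, 1:] * p) = p + [:- a, 1:] * pderiv p" for p :: "complex poly"
    unfolding pderiv_mult by (simp add: pderiv_pCons)
  then show ?case using Cons by (simp only: list.map prod_list.Cons power_sum_quotient.simps power_0 smult_1_left)
qed (simp add: pderiv_1)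

lemma power_sum_quotient_Suc:
  "power_sum_quotient (Suc k) as = [:0, 1:] * power_sum_quotient k as
     - Polynomial.smult (\<Sum>a\<leftarrow>as. a ^ k) (\<Prod>a\<leftarrow>as. [:- a, 1:])"
proof (induction as)
  case (Cons a as)
  define P where "P = (\<Prod>b\<leftarrow>as. [:- b, 1 :: complex:])"
  define Q where "Q = power_sum_quotient k as"
  define s where "s = (\<Sum>b\<leftarrow>as. b ^ k)"
  have "Polynomial.smult (a ^ Suc k) P + [:- a, 1:] * ([:0, 1:] * Q - Polynomial.smult s P) =
    [:0, 1:] * (Polynomial.smult (a ^ k) P + [:- a, 1:] * Q) - Polynomial.smult (a ^ k + s) ([:- a, 1:] * P)"
    by (rule poly_ext) (simp add: algebra_simps)
  then show ?case using Cons by (simp only: list.map prod_list.Cons sum_list.Cons power_sum_quotient.simps P_def Q_def s_def)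
qed simp

lemma degree_power_sum_quotient: "degree (power_sum_quotient k as) \<le> length as - 1"
proof (induction as)
  case (Cons a as)
  have "degree (Polynomial.smult (a ^ k) (\<Prod>b\<leftarrow>as. [:- b, 1:])) \<le> length as"
    using degree_smult_le[of "a ^ k" "\<Prod>b\<leftarrow>as. [:- b, 1:]"] degree_linear_factors[of uminus as] by simp
  moreover have "degree ([:- a, 1:] * power_sum_quotient k as) \<le> length as"
  proof (cases as)
    case (Cons b bs)
    have "degree ([:- a, 1:] * power_sum_quotient k as) \<le> degree [:- a, 1:] + degree (power_sum_quotient k as)"
      by (rule degree_mult_le)
    then show ?thesis using Cons.IH Cons by simp
  qed simp
  ultimately show ?case using degree_add_le[of "Polynomial.smult (a ^ k) (\<Prod>b\<leftarrow>as. [:- b, 1:])" "length as"] by simp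
qed simp

lemma sum_diag_pow_eq_power_sum:
  fixes A :: "complex mat"
  assumes A: "A \<in> carrier_mat n n"
  shows "(\<Sum>i<n. (A ^\<^sub>m k) $$ (i, i)) = (\<Sum>x\<in>#proots (char_poly A). x ^ k)"
proof -
  obtain as where as: "char_poly A = (\<Prod>a\<leftarrow>as. [:- a, 1:])" "length as = n" using char_poly_factorized[OF A] by auto
  have "(\<Sum>x\<in>#proots (char_poly A). x ^ k) = (\<Sum>a\<leftarrow>as. a ^ k)"
    unfolding as(1) proots_linear_factors by (simp only: sum_mset_sum_list mset_map[symmetric])
  moreover have "(\<Sum>i<n. (A ^\<^sub>m k) $$ (i, i)) = (\<Sum>a\<leftarrow>as. a ^ k)"
  proof (cases "n = 0")
    case True
    then show ?thesis using as(2) by simp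
  next
    case n: False
    define C where "C = char_poly_matrix A"
    define b where "b j i = cofactor C i j" for i j
    define F where "F k = (\<Sum>i<n. \<Sum>j<n. Polynomial.smult ((A ^\<^sub>m k) $$ (i, j)) (b j i))" for k
    have C: "C \<in> carrier_mat n n" using A by (simp add: C_def)
    have Ce: "C $$ (l, j) = (if l = j then [:0, 1:] else 0) + [:- (A $$ (l, j)):]" if "l < n" "j < n" for l j
      using that A by (simp add: C_def char_poly_matrix_def)
    have adj: "(\<Sum>j<n. C $$ (l, j) * b j i) = (if l = i then char_poly A else 0)" if "l < n" "i < n" for l i
    proof -
      have "(C * adj_mat C) $$ (l, i) = (\<Sum>j<n. C $$ (l, j) * b j i)"
        using that C by (simp add: scalar_prod_def adj_mat_def b_def atLeast0LessThan)
      moreover have "(C * adj_mat C) $$ (l, i) = (if l = i then char_poly A else 0)"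
        unfolding adj_mat(2)[OF C] using that by (simp add: char_poly_def C_def)
      ultimately show ?thesis by simp
    qed
    have shift: "(\<Sum>j<n. Polynomial.smult (A $$ (l, j)) (b j i)) = [:0, 1:] * b l i - (if l = i then char_poly A else 0)"
      if "l < n" "i < n" for l i
    proof -
      have "(\<Sum>j<n. C $$ (l, j) * b j i) = (\<Sum>j<n. (if j = l then [:0, 1:] * b l i else 0) - Polynomial.smult (A $$ (l, j)) (b j i))"
        using that by (intro sum.cong refl) (auto simp: Ce algebra_simps)
      also have "\<dots> = [:0, 1:] * b l i - (\<Sum>j<n. Polynomial.smult (A $$ (l, j)) (b j i))"
        using that by (simp add: sum_subtractf)
      finally have "[:0, 1:] * b l i - (\<Sum>j<n. Polynomial.smult (A $$ (l, j)) (b j i)) = (if l = i then char_poly A else 0)"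
        unfolding adj[OF that] ..
      then show ?thesis by (simp only: diff_eq_eq eq_diff_eq add.commute)
    qed
    have F_Suc: "F (Suc k) = [:0, 1:] * F k - Polynomial.smult (\<Sum>i<n. (A ^\<^sub>m k) $$ (i, i)) (char_poly A)" for k
    proof -
      have "(A ^\<^sub>m Suc k) $$ (i, j) = (\<Sum>l<n. (A ^\<^sub>m k) $$ (i, l) * A $$ (l, j))" if "i < n" "j < n" for i j
        using that A by (simp add: scalar_prod_def atLeast0LessThan)
      then have "F (Suc k) = (\<Sum>i<n. \<Sum>j<n. \<Sum>l<n. Polynomial.smult ((A ^\<^sub>m k) $$ (i, l)) (Polynomial.smult (A $$ (l, j)) (b j i)))"
        unfolding F_def by (intro sum.cong refl) (simp add: smult_sum del: pow_mat.simps)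
      also have "\<dots> = (\<Sum>i<n. \<Sum>l<n. Polynomial.smult ((A ^\<^sub>m k) $$ (i, l)) (\<Sum>j<n. Polynomial.smult (A $$ (l, j)) (b j i)))"
        by (rule sum.cong[OF refl], subst sum.swap) (simp only: smult_sum2)
      also have "\<dots> = (\<Sum>i<n. \<Sum>l<n. [:0, 1:] * Polynomial.smult ((A ^\<^sub>m k) $$ (i, l)) (b l i) -
          (if l = i then Polynomial.smult ((A ^\<^sub>m k) $$ (i, i)) (char_poly A) else 0))"
        by (intro sum.cong refl) (auto simp: shift smult_diff_right)
      also have "\<dots> = [:0, 1:] * F k - Polynomial.smult (\<Sum>i<n. (A ^\<^sub>m k) $$ (i, i)) (char_poly A)"
        unfolding F_def by (simp add: sum_subtractf sum_distrib_left smult_sum)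
      finally show ?thesis .
    qed
    have F_0: "F 0 = pderiv (char_poly A)"
    proof -
      have "F 0 = (\<Sum>i<n. \<Sum>j<n. if j = i then b i i else 0)"
        unfolding F_def using A by (intro sum.cong refl) auto
      also have "\<dots> = (\<Sum>i<n. b i i)" by simp
      also have "\<dots> = (\<Sum>i<n. char_poly (mat_delete A i i))"
      proof (intro sum.cong refl)
        fix i assume "i \<in> {..<n}"
        then have "mat_delete C i i = char_poly_matrix (mat_delete A i i)"
          using A by (intro eq_matI) (auto simp: C_def char_poly_matrix_def mat_delete_def)
        then show "b i i = char_poly (mat_delete A i i)"
          by (simp add: b_def cofactor_def char_poly_def flip: power_mult_distrib power_add mult_2)
      qed
      finally show ?thesis using pderiv_char_poly[OF A] by simp
    qed
    have deg_b: "degree (b j i) \<le> n - 1" if "i < n" "j < n" for i j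
    proof -
      have D: "mat_delete C i j \<in> carrier_mat (n - 1) (n - 1)" using C by (auto simp: mat_delete_def)
      have "degree (det (mat_delete C i j)) \<le> 1 * (n - 1)"
      proof (rule degree_det_le[OF _ D])
        fix i' j' assume "i' < n - 1" "j' < n - 1"
        then show "degree (mat_delete C i j $$ (i', j')) \<le> 1"
          using C by (auto simp: mat_delete_def Ce intro!: degree_add_le)
      qed
      moreover have "degree (b j i) \<le> degree ((- 1 :: complex poly) ^ (i + j)) + degree (det (mat_delete C i j))"
        unfolding b_def cofactor_def by (rule degree_mult_le)
      moreover have "degree ((- 1 :: complex poly) ^ (i + j)) = 0"
        by (cases "even (i + j)") simp_all
      ultimately show ?thesis by simp
    qed
    have F_n: "coeff (F k) n = 0" for k
    proof -
      have "coeff (b j i) n = 0" if "i < n" "j < n" for i j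
        using deg_b[OF that] n by (intro coeff_eq_0) auto
      then show ?thesis by (simp add: F_def coeff_sum)
    qed
    have G_n: "coeff (power_sum_quotient k as) n = 0" for k
      using degree_power_sum_quotient[of k as] as(2) n by (intro coeff_eq_0) auto
    have top: "coeff (char_poly A) n = 1" using degree_monic_char_poly[OF A] by simp
    \<comment> \<open>One induction proves both: equality of the polynomials at \<open>k\<close>
      gives equality of the traces, by comparing the vanishing coefficients of x^n at
      \<open>Suc k\<close> and using that the characteristic polynomial is monic; the common
      recursion then gives equality of the polynomials at \<open>Suc k\<close>.\<close>
    have "F k = power_sum_quotient k as \<and> (\<Sum>i<n. (A ^\<^sub>m k) $$ (i, i)) = (\<Sum>a\<leftarrow>as. a ^ k)" for k
    proof (induction k)
      have *: "(\<Sum>i<n. (A ^\<^sub>m k) $$ (i, i)) = (\<Sum>a\<leftarrow>as. a ^ k)" if F: "F k = power_sum_quotient k as" for k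
      proof -
        have "coeff (F (Suc k)) n = coeff (power_sum_quotient (Suc k) as) n" by (simp only: F_n G_n)
        then show ?thesis unfolding F_Suc power_sum_quotient_Suc F as(1)[symmetric] by (simp add: top)
      qed
      {
        case 0
        have "F 0 = power_sum_quotient 0 as" unfolding F_0 power_sum_quotient_0 as(1) ..
        then show ?case using * by blast
      next
        case (Suc k)
        then have "F (Suc k) = power_sum_quotient (Suc k) as"
          unfolding F_Suc power_sum_quotient_Suc as(1)[symmetric] by simp
        then show ?case using * by blast
      }
    qed
    then show ?thesis by blast
  qed
  ultimately show ?thesis by simp
qed

lemma hermitian_eigenvalue_real:
  fixes A :: "complex mat"
  assumes A: "A \<in> carrier_mat n n" and h: "\<And>j k. j < n \<Longrightarrow> k < n \<Longrightarrow> A $$ (j, k) = cnj (A $$ (k, j))"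
    and x: "x \<in># proots (char_poly A)"
  shows "Im x = 0"
proof -
  have "char_poly A \<noteq> 0" using degree_monic_char_poly[OF A] by auto
  then have "eigenvalue A x" using x eigenvalue_root_char_poly[OF A] by simp
  then obtain w where w: "w \<in> carrier_vec n" "w \<noteq> 0\<^sub>v n" "A *\<^sub>v w = x \<cdot>\<^sub>v w"
    unfolding eigenvalue_def eigenvector_def using A by auto
  have Aw: "(\<Sum>k<n. A $$ (j, k) * w $ k) = x * w $ j" if "j < n" for j
  proof -
    have "(A *\<^sub>v w) $ j = (\<Sum>k<n. A $$ (j, k) * w $ k)"
      using that A w(1) by (simp add: scalar_prod_def atLeast0LessThan)
    then show ?thesis using w that by simp
  qed
  define q where "q = (\<Sum>j<n. \<Sum>k<n. cnj (w $ j) * (A $$ (j, k) * w $ k))"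
  define r where "r = (\<Sum>j<n. (cmod (w $ j))\<^sup>2)"
  have "q = (\<Sum>j<n. cnj (w $ j) * (x * w $ j))"
    unfolding q_def by (simp add: sum_distrib_left[symmetric] Aw)
  also have "\<dots> = x * of_real r"
    unfolding r_def of_real_sum sum_distrib_left
    by (intro sum.cong refl) (simp add: complex_norm_square[symmetric] mult_ac flip: of_real_power)
  finally have 1: "q = x * of_real r" .
  have hc: "cnj (A $$ (j, k)) = A $$ (k, j)" if "j < n" "k < n" for j k
    using h[OF that] by (simp only: complex_cnj_cnj)
  have "cnj q = (\<Sum>j<n. \<Sum>k<n. w $ j * (cnj (A $$ (j, k)) * cnj (w $ k)))"
    by (simp add: q_def)
  also have "\<dots> = (\<Sum>k<n. \<Sum>j<n. cnj (w $ k) * (A $$ (k, j) * w $ j))"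
    by (subst sum.swap) (intro sum.cong refl, use hc in \<open>simp add: mult_ac\<close>)
  finally have 2: "cnj q = q" by (simp add: q_def)
  have "r > 0"
  proof -
    obtain i where i: "i < n" "w $ i \<noteq> 0" using w by (auto simp: vec_eq_iff)
    have "(cmod (w $ i))\<^sup>2 \<le> r" unfolding r_def using i by (intro member_le_sum) auto
    moreover have "(cmod (w $ i))\<^sup>2 > 0" using i by simp
    ultimately show ?thesis by linarith
  qed
  then show ?thesis using 1 2 by (auto simp: complex_eq_iff)
qed

section \<open>An auxiliary complex Gaussian vector\<close>

lemma gauss_moment_even: "gauss_moment v (2 * k) = fact (2 * k) / (2 ^ k * fact k) * v ^ k"
proof (induction k)
  case (Suc k)
  have "gauss_moment v (2 * Suc k) = v * real (Suc (2 * k)) * gauss_moment v (2 * k)" by simp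
  also have "\<dots> = fact (2 * Suc k) / (2 ^ Suc k * fact (Suc k)) * v ^ Suc k"
    unfolding Suc by (simp add: divide_simps)
  finally show ?case .
qed simp

lemma gauss_moment_odd: "gauss_moment v (2 * k + 1) = 0"
  by (induction k) simp_all

lemma normal_density_moment:
  assumes "\<sigma> > 0"
  shows "has_bochner_integral lborel (\<lambda>x. normal_density 0 \<sigma> x * x ^ n) (gauss_moment (\<sigma>\<^sup>2) n)"
proof (cases "even n")
  case True
  then obtain k where "n = 2 * k" by auto
  then show ?thesis using normal_moment_even[OF assms, of 0 k] assms
    using gauss_moment_even[of "\<sigma>\<^sup>2" k] by (simp add: power_divide mult.commute)
next
  case False
  then obtain k where "n = 2 * k + 1" by (auto elim: oddE)
  then show ?thesis using normal_moment_odd[OF assms, of 0 k] gauss_moment_odd[of "\<sigma>\<^sup>2" k]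
    by (simp del: gauss_moment.simps)
qed

text \<open>Variance 1/2 for real and imaginary parts gives each complex coordinate second absolute
  moment 1. The flag \<open>True\<close> marks the imaginary part.\<close>

definition std_gauss :: "nat \<Rightarrow> (nat \<times> bool \<Rightarrow> real) measure" where
  "std_gauss N = PiM ({..<N} \<times> UNIV) (\<lambda>_. density lborel (\<lambda>x. ennreal (normal_density 0 (sqrt (1/2)) x)))"

lemma std_gauss_family: "gauss_family (std_gauss N) ({..<N} \<times> UNIV) (\<lambda>j \<omega>. \<omega> j) (\<lambda>_. 1/2)"
proof
  let ?D = "density lborel (\<lambda>x. ennreal (normal_density 0 (sqrt (1/2)) x))"
  interpret prob_space ?D by (rule prob_space_normal_density) simp
  interpret product_sigma_finite "\<lambda>_::nat \<times> bool. ?D" by standard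
  have m: "has_bochner_integral ?D (\<lambda>x. x ^ n) (gauss_moment (1/2) n)" for n
    using normal_density_moment[of "sqrt (1/2)" n]
    by (subst has_bochner_integral_density) simp_all
  then have i: "integrable ?D (\<lambda>x. x ^ n)" "(LINT x|?D. x ^ n) = gauss_moment (1/2) n" for n
    by (simp_all only: has_bochner_integral_iff)
  fix e :: "nat \<times> bool \<Rightarrow> nat"
  show "has_bochner_integral (std_gauss N) (\<lambda>\<omega>. \<Prod>j\<in>{..<N} \<times> UNIV. \<omega> j ^ e j)
            (\<Prod>j\<in>{..<N} \<times> UNIV. gauss_moment (1 / 2) (e j))"
    unfolding has_bochner_integral_iff std_gauss_def
    using product_integrable_prod[of "{..<N} \<times> UNIV" "\<lambda>j x. x ^ e j"]
      product_integral_prod[of "{..<N} \<times> UNIV" "\<lambda>j x. x ^ e j"] i by simp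
qed simp

definition gvar :: "nat \<Rightarrow> (nat \<times> bool \<Rightarrow> real) \<Rightarrow> complex" where
  "gvar a \<omega> = Complex (\<omega> (a, False)) (\<omega> (a, True))"

definition qform :: "nat \<Rightarrow> (nat \<Rightarrow> nat \<Rightarrow> complex) \<Rightarrow> (nat \<times> bool \<Rightarrow> real) \<Rightarrow> complex" where
  "qform N B \<omega> = (\<Sum>a<N. \<Sum>b<N. B a b * cnj (gvar a \<omega>) * gvar b \<omega>)"

lemma integral_sum_mult:
  fixes f :: "'i \<Rightarrow> 'a \<Rightarrow> complex"
  assumes "\<And>i. i \<in> I \<Longrightarrow> integrable M (f i)"
  shows "(LINT \<omega>|M. (\<Sum>i\<in>I. c i * f i \<omega>)) = (\<Sum>i\<in>I. c i * (LINT \<omega>|M. f i \<omega>))"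
    and "integrable M (\<lambda>\<omega>. \<Sum>i\<in>I. c i * f i \<omega>)"
proof -
  show "(LINT \<omega>|M. (\<Sum>i\<in>I. c i * f i \<omega>)) = (\<Sum>i\<in>I. c i * (LINT \<omega>|M. f i \<omega>))"
    using assms by (subst Bochner_Integration.integral_sum) auto
  show "integrable M (\<lambda>\<omega>. \<Sum>i\<in>I. c i * f i \<omega>)"
    using assms by (intro Bochner_Integration.integrable_sum integrable_mult_right)
qed

lemma coeff_mult_01:
  fixes p q :: "'a :: comm_ring_1 poly"
  shows "coeff (p * q) 0 = coeff p 0 * coeff q 0"
    "coeff (p * q) 1 = coeff p 0 * coeff q 1 + coeff p 1 * coeff q 0"
  by (simp_all add: coeff_mult)

lemma coeff_power_01:
  fixes p :: "'a :: comm_ring_1 poly"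
  shows "coeff (p ^ k) 0 = coeff p 0 ^ k" "coeff (p ^ k) 1 = of_nat k * coeff p 0 ^ (k - 1) * coeff p 1"
proof -
  show 0: "coeff (p ^ k) 0 = coeff p 0 ^ k" for k
    by (induction k) (simp_all only: power_Suc coeff_mult_01 power_0 one_poly_eq_simps coeff_pCons_0 one_pCons)
  show "coeff (p ^ k) 1 = of_nat k * coeff p 0 ^ (k - 1) * coeff p 1"
  proof (induction k)
    case 0
    then show ?case by simp
  next
    case (Suc k)
    have "coeff (p ^ Suc k) 1 = coeff p 0 * (of_nat k * coeff p 0 ^ (k - 1) * coeff p 1) + coeff p 1 * coeff p 0 ^ k"
      by (simp only: power_Suc coeff_mult_01 0 Suc)
    also have "coeff p 0 * (of_nat k * coeff p 0 ^ (k - 1) * coeff p 1) = of_nat k * coeff p 0 ^ k * coeff p 1"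
      by (cases k) (simp_all add: ac_simps)
    finally show ?case by (simp add: algebra_simps)
  qed
qed

section \<open>Integration by parts for quadratic forms of the complex Gaussian vector\<close>

context
  fixes N :: nat
begin

interpretation gauss_family "std_gauss N" "{..<N} \<times> UNIV" "\<lambda>j \<omega>. \<omega> j" "\<lambda>_. 1/2"
  by (rule std_gauss_family)

text \<open>Coefficient vector of the coordinate \<open>gvar a\<close>, as \<open>gcoc\<close> is of
  its conjugate. Since \<open>cov\<close> is bilinear without conjugation, differentiating along
  \<open>gcoc a\<close> is exactly the complex derivative by \<open>gvar a\<close>.\<close>

definition gco :: "nat \<Rightarrow> nat \<times> bool \<Rightarrow> complex" where
  "gco a = (\<lambda>(b, t). if b = a then if t then \<i> else 1 else 0)"

definition gcoc :: "nat \<Rightarrow> nat \<times> bool \<Rightarrow> complex" where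
  "gcoc a = (\<lambda>(b, t). if b = a then if t then - \<i> else 1 else 0)"

lemma sum_bool_prod: "(\<Sum>x\<in>A \<times> UNIV. f x) = (\<Sum>b\<in>A. f (b, True) + f (b, False) :: complex)"
  unfolding sum.cartesian_product' by (simp add: UNIV_bool add.commute)

lemma lin_gco: "a < N \<Longrightarrow> lin (gco a) \<omega> = gvar a \<omega>"
proof -
  assume a: "a < N"
  have "lin (gco a) \<omega> = (\<Sum>b<N. if b = a then gvar a \<omega> else 0)"
    unfolding lin_def sum_bool_prod
    by (intro sum.cong refl) (auto simp: gco_def gvar_def complex_eq_iff)
  then show ?thesis using a by (simp add: sum.delta)
qed

lemma lin_gcoc: "a < N \<Longrightarrow> lin (gcoc a) \<omega> = cnj (gvar a \<omega>)"
proof -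
  assume a: "a < N"
  have "lin (gcoc a) \<omega> = (\<Sum>b<N. if b = a then cnj (gvar a \<omega>) else 0)"
    unfolding lin_def sum_bool_prod
    by (intro sum.cong refl) (auto simp: gcoc_def gvar_def complex_eq_iff)
  then show ?thesis using a by (simp add: sum.delta)
qed

lemma cov_gcoc_gcoc: "cov (gcoc a) (gcoc b) = 0"
  unfolding cov_def sum_bool_prod by (intro sum.neutral ballI) (auto simp: gcoc_def)

lemma cov_gcoc_gco: "a < N \<Longrightarrow> cov (gcoc a) (gco b) = (if a = b then 1 else 0)"
proof -
  assume a: "a < N"
  have "cov (gcoc a) (gco b) = (\<Sum>c<N. if c = a then (if a = b then 1 else 0) else 0)"
    unfolding cov_def sum_bool_prod
    by (intro sum.cong refl) (auto simp: gcoc_def gco_def)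
  then show ?thesis using a by (simp add: sum.delta)
qed

lemma poly_rv_gvar: "a < N \<Longrightarrow> poly_rv (gvar a)" "a < N \<Longrightarrow> poly_rv (\<lambda>\<omega>. cnj (gvar a \<omega>))"
proof -
  assume a: "a < N"
  have "lin (gco a) = gvar a" "lin (gcoc a) = (\<lambda>\<omega>. cnj (gvar a \<omega>))"
    using lin_gco[OF a] lin_gcoc[OF a] by auto
  then show "poly_rv (gvar a)" "poly_rv (\<lambda>\<omega>. cnj (gvar a \<omega>))"
    using poly_rv_lin[of "gco a"] poly_rv_lin[of "gcoc a"] by simp_all
qed

lemma poly_rv_qform: "poly_rv (qform N B)"
proof -
  have "poly_rv (\<lambda>\<omega>. qform N B \<omega>)"
    unfolding qform_def by (intro poly_rv_sum poly_rv_mult poly_rv_const poly_rv_gvar) auto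
  then show ?thesis .
qed

lemma shifted_gvar: "a < N \<Longrightarrow> b < N \<Longrightarrow> shifted (gcoc a) (\<lambda>\<omega>. [:gvar b \<omega>, if a = b then 1 else 0:])"
  using shifted_lin[of "gcoc a" "gco b"] by (simp add: lin_gco cov_gcoc_gco)

lemma shifted_cnj_gvar: "b < N \<Longrightarrow> shifted (gcoc a) (\<lambda>\<omega>. [:cnj (gvar b \<omega>), 0:])"
  using shifted_lin[of "gcoc a" "gcoc b"] by (simp add: lin_gcoc cov_gcoc_gcoc)

lemma integrable_gvar_qform:
  assumes "a < N" "b < N"
  shows "integrable (std_gauss N) (\<lambda>\<omega>. B * cnj (gvar a \<omega>) * gvar b \<omega> * qform N X \<omega> ^ k)"
  using assms by (intro poly_rv_integrable poly_rv_mult poly_rv_power poly_rv_const poly_rv_gvar poly_rv_qform)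

text \<open>Integration by parts against the conjugate of \<open>gvar a\<close>: it differentiates
  \<open>gvar b\<close> and one factor of the power by \<open>gvar a\<close>.\<close>

lemma gauss_qform_step:
  assumes a: "a < N" and b: "b < N"
  shows "(LINT \<omega>|std_gauss N. cnj (gvar a \<omega>) * gvar b \<omega> * qform N X \<omega> ^ k) =
    (if a = b then 1 else 0) * (LINT \<omega>|std_gauss N. qform N X \<omega> ^ k)
    + of_nat k * (\<Sum>c<N. X c a * (LINT \<omega>|std_gauss N. cnj (gvar c \<omega>) * gvar b \<omega> * qform N X \<omega> ^ (k - 1)))"
proof -
  define \<Psi> where "\<Psi> \<omega> = (\<Sum>c<N. \<Sum>d<N. [:X c d:] * [:cnj (gvar c \<omega>), 0:] * [:gvar d \<omega>, if a = d then 1 else 0:])" for \<omega>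
  define \<Phi> where "\<Phi> \<omega> = [:gvar b \<omega>, if a = b then 1 else 0:] * \<Psi> \<omega> ^ k" for \<omega>
  have \<Psi>0: "coeff (\<Psi> \<omega>) 0 = qform N X \<omega>" for \<omega>
    unfolding \<Psi>_def qform_def by (simp only: coeff_sum coeff_mult_01 coeff_pCons_0)
  have \<Psi>1: "coeff (\<Psi> \<omega>) 1 = (\<Sum>c<N. X c a * cnj (gvar c \<omega>))" for \<omega>
  proof -
    have "coeff (\<Psi> \<omega>) 1 = (\<Sum>c<N. \<Sum>d<N. if d = a then X c a * cnj (gvar c \<omega>) else 0)"
      unfolding \<Psi>_def coeff_sum coeff_mult_01 by (intro sum.cong refl) auto
    then show ?thesis using a by (simp add: sum.delta)
  qed
  have "shifted (gcoc a) \<Phi>"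
    unfolding \<Phi>_def \<Psi>_def using a b
    by (intro shifted_mult shifted_power shifted_sum shifted_gvar shifted_cnj_gvar shifted_const) auto
  from stein[OF this] have "(LINT \<omega>|std_gauss N. cnj (gvar a \<omega>) * coeff (\<Phi> \<omega>) 0) = (LINT \<omega>|std_gauss N. coeff (\<Phi> \<omega>) 1)"
    by (simp only: lin_gcoc[OF a])
  also have "(\<lambda>\<omega>. coeff (\<Phi> \<omega>) 1) = (\<lambda>\<omega>. (if a = b then 1 else 0) * qform N X \<omega> ^ k
      + of_nat k * (\<Sum>c<N. X c a * (1 * cnj (gvar c \<omega>) * gvar b \<omega> * qform N X \<omega> ^ (k - 1))))"
    unfolding \<Phi>_def coeff_mult_01 coeff_power_01 \<Psi>0 \<Psi>1
    by (simp add: sum_distrib_left sum_distrib_right algebra_simps)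
  also have "(LINT \<omega>|std_gauss N. (if a = b then 1 else 0) * qform N X \<omega> ^ k
      + of_nat k * (\<Sum>c<N. X c a * (1 * cnj (gvar c \<omega>) * gvar b \<omega> * qform N X \<omega> ^ (k - 1)))) =
     (if a = b then 1 else 0) * (LINT \<omega>|std_gauss N. qform N X \<omega> ^ k)
    + of_nat k * (\<Sum>c<N. X c a * (LINT \<omega>|std_gauss N. 1 * cnj (gvar c \<omega>) * gvar b \<omega> * qform N X \<omega> ^ (k - 1)))"
  proof -
    have i: "integrable (std_gauss N) (\<lambda>\<omega>. 1 * cnj (gvar c \<omega>) * gvar b \<omega> * qform N X \<omega> ^ (k - 1))" if "c \<in> {..<N}" for c
      using that b by (intro integrable_gvar_qform) auto
    have i2: "integrable (std_gauss N) (\<lambda>\<omega>. (if a = b then 1 else 0) * qform N X \<omega> ^ k)"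
      by (intro integrable_mult_right poly_rv_integrable poly_rv_power poly_rv_qform)
    let ?S = "\<lambda>\<omega>. (\<Sum>c<N. X c a * (1 * cnj (gvar c \<omega>) * gvar b \<omega> * qform N X \<omega> ^ (k - 1)))"
    have S: "(LINT \<omega>|std_gauss N. ?S \<omega>) = (\<Sum>c<N. X c a * (LINT \<omega>|std_gauss N. 1 * cnj (gvar c \<omega>) * gvar b \<omega> * qform N X \<omega> ^ (k - 1)))"
      "integrable (std_gauss N) ?S"
      by (rule integral_sum_mult[OF i]; assumption)+
    show ?thesis
      using Bochner_Integration.integral_add[OF i2 integrable_mult_right[OF S(2), of "of_nat k"]]
      unfolding integral_mult_right_zero S(1) .
  qed
  also have "(\<lambda>\<omega>. cnj (gvar a \<omega>) * coeff (\<Phi> \<omega>) 0) = (\<lambda>\<omega>. cnj (gvar a \<omega>) * gvar b \<omega> * qform N X \<omega> ^ k)"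
    unfolding \<Phi>_def coeff_mult_01 coeff_power_01 \<Psi>0 by (simp add: mult.assoc)
  finally show ?thesis by simp
qed

text \<open>With \<open>B\<close> a power of \<open>X\<close>, the recursion splits off the trace of
  \<open>B\<close> and passes to the next power of \<open>X\<close>, which is the mechanism of
  Newton's identities.\<close>

lemma gauss_qform_recursion:
  "(LINT \<omega>|std_gauss N. qform N B \<omega> * qform N X \<omega> ^ k) =
    (\<Sum>a<N. B a a) * (LINT \<omega>|std_gauss N. qform N X \<omega> ^ k)
    + of_nat k * (LINT \<omega>|std_gauss N. qform N (\<lambda>c b. \<Sum>a<N. X c a * B a b) \<omega> * qform N X \<omega> ^ (k - 1))"
proof -
  let ?M = "\<lambda>k a b. (LINT \<omega>|std_gauss N. cnj (gvar a \<omega>) * gvar b \<omega> * qform N X \<omega> ^ k)"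
  have T: "(LINT \<omega>|std_gauss N. qform N B \<omega> * qform N X \<omega> ^ k) = (\<Sum>a<N. \<Sum>b<N. B a b * ?M k a b)" for B k
  proof -
    have "(\<lambda>\<omega>. qform N B \<omega> * qform N X \<omega> ^ k) =
        (\<lambda>\<omega>. \<Sum>a<N. \<Sum>b<N. B a b * (1 * cnj (gvar a \<omega>) * gvar b \<omega> * qform N X \<omega> ^ k))"
      unfolding qform_def[of N B] by (simp add: sum_distrib_right mult.assoc)
    moreover have "(LINT \<omega>|std_gauss N. (\<Sum>a<N. \<Sum>b<N. B a b * (1 * cnj (gvar a \<omega>) * gvar b \<omega> * qform N X \<omega> ^ k)))
      = (\<Sum>a<N. \<Sum>b<N. B a b * (LINT \<omega>|std_gauss N. 1 * cnj (gvar a \<omega>) * gvar b \<omega> * qform N X \<omega> ^ k))"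
      by (subst Bochner_Integration.integral_sum)
        (intro integral_sum_mult sum.cong refl integrable_gvar_qform; simp)+
    ultimately show ?thesis by simp
  qed
  have step: "x * w = (if e then x * z else 0) + of_nat k * (\<Sum>c<N. X c a * x * F c)"
    if "w = (if e then 1 else 0) * z + of_nat k * (\<Sum>c<N. X c a * F c)" for x w z F a and e :: bool
    unfolding that by (simp add: sum_distrib_left algebra_simps)
  have "(\<Sum>a<N. \<Sum>b<N. B a b * ?M k a b) =
      (\<Sum>a<N. \<Sum>b<N. (if a = b then B a b * (LINT \<omega>|std_gauss N. qform N X \<omega> ^ k) else 0)
       + of_nat k * (\<Sum>c<N. X c a * B a b * ?M (k - 1) c b))"
    by (intro sum.cong refl step gauss_qform_step) auto
  also have "\<dots> = (\<Sum>a<N. B a a) * (LINT \<omega>|std_gauss N. qform N X \<omega> ^ k)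
      + of_nat k * (\<Sum>a<N. \<Sum>b<N. \<Sum>c<N. X c a * B a b * ?M (k - 1) c b)"
    by (simp add: sum.distrib sum.delta sum_distrib_left sum_distrib_right)
  also have "(\<Sum>a<N. \<Sum>b<N. \<Sum>c<N. X c a * B a b * ?M (k - 1) c b) =
      (\<Sum>c<N. \<Sum>b<N. \<Sum>a<N. X c a * B a b * ?M (k - 1) c b)"
  proof -
    have "(\<Sum>a<N. \<Sum>b<N. \<Sum>c<N. X c a * B a b * ?M (k - 1) c b) = (\<Sum>b<N. \<Sum>a<N. \<Sum>c<N. X c a * B a b * ?M (k - 1) c b)"
      by (rule sum.swap)
    also have "\<dots> = (\<Sum>b<N. \<Sum>c<N. \<Sum>a<N. X c a * B a b * ?M (k - 1) c b)"
      by (intro sum.cong refl sum.swap)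
    also have "\<dots> = (\<Sum>c<N. \<Sum>b<N. \<Sum>a<N. X c a * B a b * ?M (k - 1) c b)"
      by (rule sum.swap)
    finally show ?thesis .
  qed
  also have "\<dots> = (\<Sum>c<N. \<Sum>b<N. (\<Sum>a<N. X c a * B a b) * ?M (k - 1) c b)"
    by (simp add: sum_distrib_right)
  finally show ?thesis unfolding T .
qed

lemma std_gauss_one: "(LINT \<omega>|std_gauss N. 1) = (1::complex)"
  using has_bochner_integral_mon[of "\<lambda>_. 0"] by (simp add: mon_0 has_bochner_integral_iff)

lemma integrable_qform_power: "integrable (std_gauss N) (\<lambda>\<omega>. qform N B \<omega> * qform N X \<omega> ^ k)"
  "integrable (std_gauss N) (\<lambda>\<omega>. qform N X \<omega> ^ k)"
  by (intro poly_rv_integrable poly_rv_mult poly_rv_power poly_rv_qform)+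

end

text \<open>The complete homogeneous symmetric polynomials of the eigenvalues of \<open>X\<close>.\<close>

definition gauss_h :: "nat \<Rightarrow> (nat \<Rightarrow> nat \<Rightarrow> complex) \<Rightarrow> nat \<Rightarrow> complex" where
  "gauss_h N X k = (LINT \<omega>|std_gauss N. qform N X \<omega> ^ k) / fact k"

lemma pow_mat_mult_commute:
  "A \<in> carrier_mat n n \<Longrightarrow> A * A ^\<^sub>m k = A ^\<^sub>m k * A"
proof (induction k)
  case (Suc k)
  have "A * A ^\<^sub>m Suc k = (A * A ^\<^sub>m k) * A"
    using Suc.prems assoc_mult_mat[of A n n "A ^\<^sub>m k" n A n] by simp
  then show ?case using Suc by simp
qed simp

text \<open>Newton's identities, obtained by iterating \<open>gauss_qform_recursion\<close> with
  \<open>B\<close> running through the powers of \<open>A\<close>; at first power,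
  \<open>T 1 k\<close> is the moment of order \<open>k + 1\<close>.\<close>

lemma gauss_h_newton:
  assumes A: "A \<in> carrier_mat N N"
  defines "h \<equiv> gauss_h N (\<lambda>i j. A $$ (i, j))"
  shows "of_nat (Suc k) * h (Suc k) = (\<Sum>m\<le>k. (\<Sum>i<N. (A ^\<^sub>m Suc m) $$ (i, i)) * h (k - m))"
proof -
  define T where "T n k = (LINT \<omega>|std_gauss N. qform N (\<lambda>i j. (A ^\<^sub>m n) $$ (i, j)) \<omega> * qform N (\<lambda>i j. A $$ (i, j)) \<omega> ^ k)" for n k
  define t where "t n = (\<Sum>i<N. (A ^\<^sub>m n) $$ (i, i))" for n
  have rec: "T n k = t n * (fact k * h k) + of_nat k * T (Suc n) (k - 1)" for n k
  proof -
    have "qform N (\<lambda>c b. \<Sum>a<N. A $$ (c, a) * (A ^\<^sub>m n) $$ (a, b)) = qform N (\<lambda>i j. (A ^\<^sub>m Suc n) $$ (i, j))"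
    proof -
      have "(\<Sum>a<N. A $$ (c, a) * (A ^\<^sub>m n) $$ (a, b)) = (A ^\<^sub>m Suc n) $$ (c, b)" if "c < N" "b < N" for c b
      proof -
        have "(A * A ^\<^sub>m n) $$ (c, b) = (\<Sum>a<N. A $$ (c, a) * (A ^\<^sub>m n) $$ (a, b))"
          using that A by (simp add: scalar_prod_def atLeast0LessThan)
        then show ?thesis using pow_mat_mult_commute[OF A, of n] by simp
      qed
      then show ?thesis unfolding qform_def by (intro ext sum.cong refl) auto
    qed
    then show ?thesis unfolding T_def t_def h_def gauss_h_def
      using gauss_qform_recursion[of N "\<lambda>i j. (A ^\<^sub>m n) $$ (i, j)" "\<lambda>i j. A $$ (i, j)" k] by simp
  qed
  have T: "T n k = fact k * (\<Sum>m\<le>k. t (n + m) * h (k - m))" for n k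
  proof (induction k arbitrary: n)
    case 0
    then show ?case using rec[of n 0] by simp
  next
    case (Suc k)
    have "T n (Suc k) = fact (Suc k) * (t n * h (Suc k) + (\<Sum>m\<le>k. t (Suc n + m) * h (k - m)))"
      using rec[of n "Suc k"] Suc[of "Suc n"] by (simp add: algebra_simps)
    also have "t n * h (Suc k) + (\<Sum>m\<le>k. t (Suc n + m) * h (k - m)) = (\<Sum>m\<le>Suc k. t (n + m) * h (Suc k - m))"
      by (subst sum.atMost_Suc_shift) simp
    finally show ?case .
  qed
  have "T 1 k = (LINT \<omega>|std_gauss N. qform N (\<lambda>i j. A $$ (i, j)) \<omega> ^ Suc k)"
    unfolding T_def using A by simp
  also have "\<dots> = fact (Suc k) * h (Suc k)" by (simp add: h_def gauss_h_def del: power_Suc fact_Suc)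
  finally have "fact k * (of_nat (Suc k) * h (Suc k)) = fact k * (\<Sum>m\<le>k. t (1 + m) * h (k - m))"
    unfolding T by (simp add: algebra_simps)
  then have "of_nat (Suc k) * h (Suc k) = (\<Sum>m\<le>k. t (1 + m) * h (k - m))"
    by (simp only: mult_cancel_left fact_nonzero simp_thms)
  then show ?thesis by (simp add: t_def del: pow_mat.simps)
qed

lemma gauss_h_0: "gauss_h N X 0 = 1"
  using std_gauss_one[of N] by (simp add: gauss_h_def)

definition norm_form :: "nat \<Rightarrow> (nat \<times> bool \<Rightarrow> real) \<Rightarrow> complex" where
  "norm_form N = qform N (\<lambda>i j. if i = j then 1 else 0)"

text \<open>|g|^2 has a Gamma(N) law, whose moments are rising factorials, and by unitary invariance
  g^H B g averages to tr B / N times |g|^2. Both are derived from the recursion with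
  \<open>X\<close> the identity. The factor N in the second formula makes it valid for N = 0
  too.\<close>

lemma std_gauss_norm_form:
  "(LINT \<omega>|std_gauss N. norm_form N \<omega> ^ k) = pochhammer (of_nat N) k"
  "of_nat N * (LINT \<omega>|std_gauss N. qform N B \<omega> * norm_form N \<omega> ^ k) = (\<Sum>i<N. B i i) * pochhammer (of_nat N) (Suc k)"
proof -
  let ?T = "\<lambda>B k. (LINT \<omega>|std_gauss N. qform N B \<omega> * norm_form N \<omega> ^ k)"
  let ?Z = "\<lambda>k. (LINT \<omega>|std_gauss N. norm_form N \<omega> ^ k)"
  have rec: "?T B k = (\<Sum>i<N. B i i) * ?Z k + of_nat k * ?T B (k - 1)" for B k
  proof -
    have "qform N (\<lambda>c b. \<Sum>a<N. (if c = a then 1 else 0) * B a b) = qform N B"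
      unfolding qform_def
    proof (intro ext sum.cong refl, goal_cases)
      case (1 \<omega> c b)
      have "(\<Sum>a<N. (if c = a then 1 else 0) * B a b) = (\<Sum>a<N. if a = c then B c b else 0)"
        by (intro sum.cong) auto
      then show ?case using 1 by (simp add: sum.delta)
    qed
    then show ?thesis
      using gauss_qform_recursion[of N B "\<lambda>i j. if i = j then 1 else 0" k] by (simp add: norm_form_def)
  qed
  \<comment> \<open>The premise on \<open>?Z\<close> avoids a circle: the step for \<open>?Z\<close>
    is itself this formula with \<open>B\<close> the identity.\<close>
  have T: "of_nat N * ?T B k = (\<Sum>i<N. B i i) * (of_nat N + of_nat k) * ?Z k" if "\<And>j. j < k \<Longrightarrow> ?Z (Suc j) = (of_nat N + of_nat j) * ?Z j" for B k
    using that
  proof (induction k)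
    case 0
    then show ?case using rec[of B 0] by simp
  next
    case (Suc k)
    have "of_nat N * ?T B (Suc k) = of_nat N * (\<Sum>i<N. B i i) * ?Z (Suc k) + of_nat (Suc k) * (of_nat N * ?T B k)"
      unfolding rec[of B "Suc k"] by (simp add: algebra_simps)
    also have "of_nat N * ?T B k = (\<Sum>i<N. B i i) * ?Z (Suc k)"
      using Suc by simp
    finally show ?case by (simp add: algebra_simps)
  qed
  have Zs: "?Z (Suc k) = (of_nat N + of_nat k) * ?Z k" for k
  proof (induction k rule: less_induct)
    case (less k)
    have 1: "?T (\<lambda>i j. if i = j then 1 else 0) k = ?Z (Suc k)" by (simp add: norm_form_def)
    show ?case
    proof (cases "N = 0")
      case True
      then show ?thesis using rec[of "\<lambda>i j. if i = j then 1 else 0" k] 1 less[of "k - 1"] 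
        by (cases k) (simp_all add: norm_form_def qform_def)
    next
      case False
      then show ?thesis using T[OF less, of k "\<lambda>i j. if i = j then 1 else 0"] 1 by simp
    qed
  qed
  show Z: "?Z k = pochhammer (of_nat N) k" for k
  proof (induction k)
    case 0
    then show ?case using std_gauss_one[of N] by simp
  next
    case (Suc k)
    then show ?case using Zs[of k] by (simp only: pochhammer_Suc mult.commute)
  qed
  show "of_nat N * ?T B k = (\<Sum>i<N. B i i) * pochhammer (of_nat N) (Suc k)"
    using T[OF Zs, of B k] Z by (simp add: pochhammer_Suc mult_ac)
qed

section \<open>Logarithmic derivatives of the generating series\<close>

lemma fps_euler_eq_0_imp:
  assumes "fps_euler f = 0" "fps_nth f 0 = c"
  shows "f = fps_const c"
proof (rule fps_ext)
  fix n
  have "of_nat n * fps_nth f n = 0" using assms(1) fps_euler_nth[of f n] by simp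
  then show "fps_nth f n = fps_nth (fps_const c) n" using assms(2) by (cases n) (auto simp del: of_nat_Suc)
qed

text \<open>The series det (1 - uA), that is, z^(-N) det (z - A) at z = 1/u.\<close>

definition rev_char_poly :: "nat \<Rightarrow> complex mat \<Rightarrow> complex fps" where
  "rev_char_poly N A = Abs_fps (\<lambda>j. if j \<le> N then coeff (char_poly A) (N - j) else 0)"

definition trace_fps :: "nat \<Rightarrow> complex mat \<Rightarrow> complex fps" where
  "trace_fps N A = Abs_fps (\<lambda>n. \<Sum>i<N. (A ^\<^sub>m n) $$ (i, i))"

text \<open>Over the eigenvalues, det (1 - uA) is the product of the factors 1 - au, and
  \<open>G a\<close> is the geometric series 1 / (1 - au).\<close>

lemma fps_euler_rev_char_poly:
  assumes A: "A \<in> carrier_mat N N"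
  shows "fps_euler (rev_char_poly N A) = - rev_char_poly N A * (trace_fps N A - fps_const (of_nat N))"
proof -
  obtain as where as: "char_poly A = (\<Prod>a\<leftarrow>as. [:- a, 1:])" "length as = N"
    using char_poly_factorized[OF A] by auto
  define G where "G a = Abs_fps (\<lambda>n. a ^ n)" for a :: complex
  have G: "(1 - fps_const a * fps_X) * G a = 1" for a
  proof (rule fps_ext)
    fix n
    show "fps_nth ((1 - fps_const a * fps_X) * G a) n = fps_nth 1 n"
      by (cases n) (simp_all add: algebra_simps G_def mult.assoc)
  qed
  have prod: "fps_euler (\<Prod>a\<leftarrow>as. 1 - fps_const a * fps_X) =
      - (\<Prod>a\<leftarrow>as. 1 - fps_const a * fps_X) * ((\<Sum>a\<leftarrow>as. G a) - fps_const (of_nat (length as)))" for as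
  proof (induction as)
    case Nil
    then show ?case using fps_euler_const[of 1] by simp
  next
    case (Cons a as)
    let ?l = "1 - fps_const a * fps_X" and ?p = "\<Prod>a\<leftarrow>as. 1 - fps_const a * fps_X"
    have 1: "fps_euler ?l = - ?l * (G a - 1)"
    proof -
      have "fps_euler ?l = ?l - 1" by (simp add: fps_euler_def algebra_simps)
      then show ?thesis using G[of a] by (simp add: algebra_simps)
    qed
    have 2: "fps_const (of_nat (length (a # as))) = 1 + fps_const (of_nat (length as) :: complex)"
      by (simp add: fps_eq_iff)
    show ?case
      unfolding list.map prod_list.Cons sum_list.Cons fps_euler_mult 1 2 Cons by (simp add: algebra_simps)
  qed
  have "reflect_poly (char_poly A) = (\<Prod>a\<leftarrow>as. [:1, - a:])"
  proof -
    have "reflect_poly [:- a, 1:] = [:1, - a:]" for a :: complex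
      by (cases "a = 0") (simp_all add: reflect_poly_def cCons_def one_pCons)
    then show ?thesis unfolding as(1) by (simp add: reflect_poly_prod_list comp_def)
  qed
  moreover have "fps_of_poly (\<Prod>a\<leftarrow>as. [:1, - a:]) = (\<Prod>a\<leftarrow>as. 1 - fps_const a * fps_X)"
    by (induction as) (simp_all add: fps_of_poly_mult fps_of_poly_pCons del: mult_pCons_left)
  moreover have "rev_char_poly N A = fps_of_poly (reflect_poly (char_poly A))"
    using degree_monic_char_poly[OF A] by (auto simp: rev_char_poly_def fps_eq_iff coeff_reflect_poly)
  ultimately have 1: "rev_char_poly N A = (\<Prod>a\<leftarrow>as. 1 - fps_const a * fps_X)" by simp
  have 2: "trace_fps N A = (\<Sum>a\<leftarrow>as. G a)"
  proof (rule fps_ext)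
    fix n
    have "fps_nth (\<Sum>a\<leftarrow>as. G a) n = (\<Sum>a\<leftarrow>as. a ^ n)" by (induction as) (auto simp: G_def)
    then show "fps_nth (trace_fps N A) n = fps_nth (\<Sum>a\<leftarrow>as. G a) n"
      by (simp add: trace_fps_def sum_diag_pow_eq_power_sum[OF A] as(1) proots_linear_factors sum_mset_sum_list flip: mset_map)
  qed
  show ?thesis unfolding 1 2 prod as(2) ..
qed

definition gauss_h_fps :: "nat \<Rightarrow> complex mat \<Rightarrow> complex fps" where
  "gauss_h_fps N A = Abs_fps (gauss_h N (\<lambda>i j. A $$ (i, j)))"

lemma fps_euler_gauss_h:
  assumes A: "A \<in> carrier_mat N N"
  shows "fps_euler (gauss_h_fps N A) = gauss_h_fps N A * (trace_fps N A - fps_const (of_nat N))"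
proof (rule fps_ext)
  fix n
  let ?h = "gauss_h N (\<lambda>i j. A $$ (i, j))"
  show "fps_nth (fps_euler (gauss_h_fps N A)) n = fps_nth (gauss_h_fps N A * (trace_fps N A - fps_const (of_nat N))) n"
  proof (cases n)
    case 0
    then show ?thesis using A by (simp add: trace_fps_def)
  next
    case (Suc k)
    have "fps_nth ((trace_fps N A - fps_const (of_nat N)) * gauss_h_fps N A) (Suc k) =
      (\<Sum>m=0..Suc k. (if m = 0 then 0 else (\<Sum>i<N. (A ^\<^sub>m m) $$ (i, i))) * ?h (Suc k - m))"
      using A by (auto simp: fps_mult_nth trace_fps_def gauss_h_fps_def intro!: sum.cong)
    also have "\<dots> = (\<Sum>m\<le>k. (\<Sum>i<N. (A ^\<^sub>m Suc m) $$ (i, i)) * ?h (k - m))"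
      unfolding atLeast0AtMost by (subst sum.atMost_Suc_shift) (simp del: pow_mat.simps)
    also have "\<dots> = of_nat (Suc k) * ?h (Suc k)" using gauss_h_newton[OF A, of k] by simp
    finally show ?thesis using Suc by (simp add: gauss_h_fps_def mult.commute del: of_nat_Suc)
  qed
qed

text \<open>The two series have opposite logarithmic derivatives, so their product is constant.
  Hence the trace series is bilinear in their coefficients.\<close>

lemma rev_char_poly_mult_gauss_h:
  assumes A: "A \<in> carrier_mat N N"
  shows "rev_char_poly N A * gauss_h_fps N A = 1"
    and "- fps_euler (rev_char_poly N A) * gauss_h_fps N A = trace_fps N A - fps_const (of_nat N)"
proof -
  let ?D = "rev_char_poly N A" and ?H = "gauss_h_fps N A"
  have "fps_euler (?D * ?H) = 0"
    by (simp add: fps_euler_mult fps_euler_rev_char_poly[OF A] fps_euler_gauss_h[OF A] algebra_simps)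
  moreover have "fps_nth (?D * ?H) 0 = 1"
    using degree_monic_char_poly[OF A] by (simp add: rev_char_poly_def gauss_h_fps_def gauss_h_0)
  ultimately show 1: "?D * ?H = 1" using fps_euler_eq_0_imp[of "?D * ?H" 1] by simp
  have "- fps_euler ?D * ?H = (?D * ?H) * (trace_fps N A - fps_const (of_nat N))"
    unfolding fps_euler_rev_char_poly[OF A] by (simp add: algebra_simps)
  then show "- fps_euler ?D * ?H = trace_fps N A - fps_const (of_nat N)" unfolding 1 by simp
qed

section \<open>Rank-one perturbations inside determinants\<close>

context gauss_family begin

definition rank_one_term :: "nat \<Rightarrow> (nat \<Rightarrow> complex) \<Rightarrow> (nat \<Rightarrow> complex) \<Rightarrow> complex mat \<Rightarrow> complex" where
  "rank_one_term n u w A = (\<Sum>i<n. \<Sum>k<n. u i * w k * cofactor A i k)"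

lemma det_add_smult_rank_one:
  assumes "A \<in> carrier_mat n n"
  shows "det (mat n n (\<lambda>(i, k). A $$ (i, k) + s * (u i * w k))) = det A + s * rank_one_term n u w A"
  using det_add_rank_one[OF assms, of "\<lambda>i. s * u i" w]
  by (simp add: rank_one_term_def sum_distrib_left mult.assoc)

text \<open>The determinant is affine along the rank-one direction, so its slope does not depend on
  the base point; the values at 0, 1 and 2 are compared.\<close>

lemma rank_one_term_invariant:
  assumes A: "A \<in> carrier_mat n n"
  shows "rank_one_term n u w (mat n n (\<lambda>(i, k). A $$ (i, k) + u i * w k)) = rank_one_term n u w A"
proof -
  let ?B = "mat n n (\<lambda>(i, k). A $$ (i, k) + u i * w k)"
  have "mat n n (\<lambda>(i, k). ?B $$ (i, k) + 1 * (u i * w k)) = mat n n (\<lambda>(i, k). A $$ (i, k) + 2 * (u i * w k))"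
    by (rule eq_matI) auto
  then show ?thesis
    using det_add_smult_rank_one[of ?B n 1 u w] det_add_smult_rank_one[OF A, of 2 u w]
      det_add_smult_rank_one[OF A, of 1 u w] by simp
qed

text \<open>The Leibniz formula over polynomials in s represents det (A + s u w^T); as a polynomial
  in s this is affine, with slope \<open>rank_one_term\<close>.\<close>

lemma shifted_det:
  assumes sh: "\<And>i j. i < n \<Longrightarrow> j < n \<Longrightarrow> shifted c (\<lambda>\<omega>. [:A \<omega> $$ (i, j), u i * w j:])"
    and A: "\<And>\<omega>. A \<omega> \<in> carrier_mat n n"
  shows "shifted c (\<lambda>\<omega>. [:det (A \<omega>), rank_one_term n u w (A \<omega>):])"
proof -
  define P where "P \<omega> = mat n n (\<lambda>(i, j). [:A \<omega> $$ (i, j), u i * w j:])" for \<omega>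
  have P: "P \<omega> \<in> carrier_mat n n" for \<omega> by (simp add: P_def)
  have sg: "signof p = [:signof p:]" for p :: "nat \<Rightarrow> nat"
    by (cases p rule: sign_cases) (simp_all add: one_pCons)
  have "shifted c (\<lambda>\<omega>. \<Sum>p | p permutes {0..<n}. [:signof p:] * (\<Prod>i = 0..<n. [:A \<omega> $$ (i, p i), u i * w (p i):]))"
    by (intro shifted_sum shifted_mult shifted_prod shifted_const sh) auto
  moreover have "(\<Sum>p | p permutes {0..<n}. [:signof p:] * (\<Prod>i = 0..<n. [:A \<omega> $$ (i, p i), u i * w (p i):])) = det (P \<omega>)" for \<omega>
    unfolding det_def'[OF P] by (intro sum.cong refl arg_cong2[of _ _ _ _ "(*)"] sg[symmetric] prod.cong) (auto simp: P_def)
  moreover have "det (P \<omega>) = [:det (A \<omega>), rank_one_term n u w (A \<omega>):]" for \<omega>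
  proof -
    have "poly (det (P \<omega>)) s = poly [:det (A \<omega>), rank_one_term n u w (A \<omega>):] s" for s
    proof -
      have "poly (det (P \<omega>)) s = det (mat n n (\<lambda>(i, k). A \<omega> $$ (i, k) + s * (u i * w k)))"
        by (rule poly_det_cong[of _ n]) (auto simp: P_def)
      then show ?thesis using det_add_smult_rank_one[OF A[of \<omega>], of s u w] by simp
    qed
    then show ?thesis by (simp add: poly_eq_poly_eq_iff[symmetric] ext)
  qed
  ultimately show ?thesis by simp
qed

text \<open>The term is the difference of the determinants of the perturbed matrix and of
  \<open>A\<close>, whose derivatives agree by invariance.\<close>

lemma shifted_rank_one_term:
  assumes sh: "\<And>i j. i < n \<Longrightarrow> j < n \<Longrightarrow> shifted c (\<lambda>\<omega>. [:A \<omega> $$ (i, j), u i * w j:])"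
    and A: "\<And>\<omega>. A \<omega> \<in> carrier_mat n n"
  shows "shifted c (\<lambda>\<omega>. [:rank_one_term n u w (A \<omega>), 0:])"
proof -
  define B where "B \<omega> = mat n n (\<lambda>(i, k). A \<omega> $$ (i, k) + u i * w k)" for \<omega>
  have B: "B \<omega> \<in> carrier_mat n n" for \<omega> by (simp add: B_def)
  have "shifted c (\<lambda>\<omega>. [:B \<omega> $$ (i, j), u i * w j:])" if "i < n" "j < n" for i j
  proof -
    have "shifted c (\<lambda>\<omega>. [:A \<omega> $$ (i, j), u i * w j:] + [:u i * w j:])"
      by (intro shifted_add shifted_const sh that)
    then show ?thesis using that by (simp add: B_def)
  qed
  from shifted_det[OF this B] have "shifted c (\<lambda>\<omega>. [:det (B \<omega>), rank_one_term n u w (B \<omega>):])" by simp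
  from shifted_add[OF this shifted_mult[OF shifted_const[of c "-1"] shifted_det[OF sh A]]]
  have "shifted c (\<lambda>\<omega>. [:det (B \<omega>), rank_one_term n u w (B \<omega>):] + [:-1:] * [:det (A \<omega>), rank_one_term n u w (A \<omega>):])" by simp
  moreover have "[:det (B \<omega>), rank_one_term n u w (B \<omega>):] + [:-1:] * [:det (A \<omega>), rank_one_term n u w (A \<omega>):]
      = [:rank_one_term n u w (A \<omega>), 0:]" for \<omega>
    using det_add_smult_rank_one[OF A[of \<omega>], of 1 u w] rank_one_term_invariant[OF A[of \<omega>], of u w]
    by (simp add: B_def)
  ultimately show ?thesis by simp
qed

end

section \<open>Random matrices with polynomial entries\<close>

context gauss_family begin

definition poly_rv_poly :: "('a \<Rightarrow> complex poly) \<Rightarrow> bool" where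
  "poly_rv_poly \<Psi> \<longleftrightarrow> (\<forall>n. poly_rv (\<lambda>\<omega>. coeff (\<Psi> \<omega>) n))"

lemma poly_rv_poly_mult: "poly_rv_poly F \<Longrightarrow> poly_rv_poly G \<Longrightarrow> poly_rv_poly (\<lambda>\<omega>. F \<omega> * G \<omega>)"
  unfolding poly_rv_poly_def coeff_mult by (intro allI poly_rv_sum poly_rv_mult) auto

lemma poly_rv_poly_const: "poly_rv_poly (\<lambda>\<omega>. p)"
  unfolding poly_rv_poly_def by (intro allI poly_rv_const)

lemma poly_rv_poly_sum: "(\<And>x. x \<in> I \<Longrightarrow> poly_rv_poly (F x)) \<Longrightarrow> poly_rv_poly (\<lambda>\<omega>. \<Sum>x\<in>I. F x \<omega>)"
  unfolding poly_rv_poly_def coeff_sum by (intro allI poly_rv_sum) auto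

lemma poly_rv_poly_prod: "(\<And>x. x \<in> I \<Longrightarrow> poly_rv_poly (F x)) \<Longrightarrow> poly_rv_poly (\<lambda>\<omega>. \<Prod>x\<in>I. F x \<omega>)"
  by (induction I rule: infinite_finite_induct) (simp_all add: poly_rv_poly_const poly_rv_poly_mult)

lemma poly_rv_char_poly:
  assumes A: "\<And>\<omega>. A \<omega> \<in> carrier_mat n n"
    and rv: "\<And>i j. i < n \<Longrightarrow> j < n \<Longrightarrow> poly_rv (\<lambda>\<omega>. A \<omega> $$ (i, j))"
  shows "poly_rv (\<lambda>\<omega>. coeff (char_poly (A \<omega>)) k)"
proof -
  have C: "char_poly_matrix (A \<omega>) \<in> carrier_mat n n" for \<omega> using A by simp
  have e: "poly_rv_poly (\<lambda>\<omega>. char_poly_matrix (A \<omega>) $$ (i, j))" if "i < n" "j < n" for i j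
  proof -
    have "(\<lambda>\<omega>. char_poly_matrix (A \<omega>) $$ (i, j)) = (\<lambda>\<omega>. [:0, if i = j then 1 else 0:] + [:-1:] * [:A \<omega> $$ (i, j):])"
      using carrier_matD[OF A] that by (auto simp: char_poly_matrix_def fun_eq_iff)
    moreover have "poly_rv_poly (\<lambda>\<omega>. [:A \<omega> $$ (i, j):])"
      unfolding poly_rv_poly_def
    proof
      fix k show "poly_rv (\<lambda>\<omega>. coeff [:A \<omega> $$ (i, j):] k)"
        using rv[OF that] poly_rv_const[of 0] by (cases k) simp_all
    qed
    moreover have "poly_rv_poly (\<lambda>\<omega>. F \<omega> + G \<omega>)" if "poly_rv_poly F" "poly_rv_poly G" for F G
      using that unfolding poly_rv_poly_def coeff_add by (intro allI poly_rv_add) auto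
    ultimately show ?thesis by (simp only: poly_rv_poly_const poly_rv_poly_mult)
  qed
  have "poly_rv_poly (\<lambda>\<omega>. \<Sum>p | p permutes {0..<n}. signof p * (\<Prod>i = 0..<n. char_poly_matrix (A \<omega>) $$ (i, p i)))"
    by (intro poly_rv_poly_sum poly_rv_poly_mult poly_rv_poly_prod poly_rv_poly_const e) auto
  then have "poly_rv_poly (\<lambda>\<omega>. char_poly (A \<omega>))"
    unfolding char_poly_def det_def'[OF C] .
  then show ?thesis by (simp add: poly_rv_poly_def)
qed

lemma poly_rv_det:
  assumes A: "\<And>\<omega>. A \<omega> \<in> carrier_mat n n"
    and rv: "\<And>i j. i < n \<Longrightarrow> j < n \<Longrightarrow> poly_rv (\<lambda>\<omega>. A \<omega> $$ (i, j))"
  shows "poly_rv (\<lambda>\<omega>. det (A \<omega>))"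
  unfolding det_def'[OF A] by (intro poly_rv_sum poly_rv_mult poly_rv_prod poly_rv_const rv) auto

lemma poly_rv_cofactor:
  assumes A: "\<And>\<omega>. A \<omega> \<in> carrier_mat n n"
    and rv: "\<And>i j. i < n \<Longrightarrow> j < n \<Longrightarrow> poly_rv (\<lambda>\<omega>. A \<omega> $$ (i, j))"
    and ij: "i < n" "j < n"
  shows "poly_rv (\<lambda>\<omega>. cofactor (A \<omega>) i j)"
proof -
  have "poly_rv (\<lambda>\<omega>. det (mat_delete (A \<omega>) i j))"
  proof (rule poly_rv_det)
    show "mat_delete (A \<omega>) i j \<in> carrier_mat (n - 1) (n - 1)" for \<omega>
      using A[of \<omega>] by (auto simp: mat_delete_def)
    fix i' j' assume "i' < n - 1" "j' < n - 1"
    then show "poly_rv (\<lambda>\<omega>. mat_delete (A \<omega>) i j $$ (i', j'))"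
      using A carrier_matD[OF A] by (simp add: mat_delete_def) (intro conjI impI rv, auto)
  qed
  then show ?thesis unfolding cofactor_def by (intro poly_rv_mult poly_rv_const)
qed

lemma poly_rv_trace_pow:
  assumes A: "\<And>\<omega>. A \<omega> \<in> carrier_mat n n"
    and rv: "\<And>i j. i < n \<Longrightarrow> j < n \<Longrightarrow> poly_rv (\<lambda>\<omega>. A \<omega> $$ (i, j))"
  shows "poly_rv (\<lambda>\<omega>. \<Sum>i<n. (A \<omega> ^\<^sub>m k) $$ (i, i))"
proof -
  have "poly_rv (\<lambda>\<omega>. (A \<omega> ^\<^sub>m k) $$ (i, j))" if "i < n" "j < n" for i j
    using that
  proof (induction k arbitrary: i j)
    case 0
    then show ?case using carrier_matD[OF A] by (auto intro: poly_rv_const)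
  next
    case (Suc k)
    have "(A \<omega> ^\<^sub>m Suc k) $$ (i, j) = (\<Sum>l<n. (A \<omega> ^\<^sub>m k) $$ (i, l) * A \<omega> $$ (l, j))" for \<omega>
      using Suc.prems A[of \<omega>] by (simp add: scalar_prod_def atLeast0LessThan)
    then show ?case using Suc by (simp only:) (intro poly_rv_sum poly_rv_mult Suc rv, auto)
  qed
  then show ?thesis by (intro poly_rv_sum) auto
qed

end

section \<open>Gaussian Hermitian matrices\<close>

text \<open>Of the ensemble only the linear forms of the entries and their covariances, taken
  without conjugation, are retained.\<close>

locale gauss_hermitian = gauss_family M J \<xi> v
  for M :: "'a measure" and J :: "'j set" and \<xi> v +
  fixes N :: nat and co :: "nat \<Rightarrow> nat \<Rightarrow> 'j \<Rightarrow> complex"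
  assumes N: "N > 0"
    and cov_co: "\<And>a b c d. a < N \<Longrightarrow> b < N \<Longrightarrow> c < N \<Longrightarrow> d < N \<Longrightarrow>
      cov (co a b) (co c d) = (if a = d \<and> b = c then 1 / of_nat N else 0)"
begin

definition Y :: "'a \<Rightarrow> complex mat" where
  "Y \<omega> = mat N N (\<lambda>(a, b). lin (co a b) \<omega>)"

lemma Y_carrier [simp]: "Y \<omega> \<in> carrier_mat N N"
  by (simp add: Y_def)

lemma poly_rv_Y: "a < N \<Longrightarrow> b < N \<Longrightarrow> poly_rv (\<lambda>\<omega>. Y \<omega> $$ (a, b))"
  unfolding Y_def by (simp add: poly_rv_lin)

lemma poly_rv_shift_Y: "a < N \<Longrightarrow> b < N \<Longrightarrow> poly_rv (\<lambda>\<omega>. shift_mat N z (Y \<omega>) $$ (a, b))"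
proof -
  assume ab: "a < N" "b < N"
  have "(\<lambda>\<omega>. shift_mat N z (Y \<omega>) $$ (a, b)) = (\<lambda>\<omega>. (if a = b then z else 0) + (-1) * Y \<omega> $$ (a, b))"
    using ab by (simp add: shift_mat_def fun_eq_iff)
  moreover have "poly_rv (\<lambda>\<omega>. (if a = b then z else 0) + (-1) * Y \<omega> $$ (a, b))"
    using ab by (intro poly_rv_add poly_rv_mult poly_rv_const poly_rv_Y)
  ultimately show ?thesis by simp
qed

lemma cov_sum_left: "cov (\<lambda>j. \<Sum>i\<in>I. f i j) d = (\<Sum>i\<in>I. cov (f i) d)"
  unfolding cov_def by (simp add: sum_distrib_left sum_distrib_right) (rule sum.swap)

lemma cov_smult_left: "cov (\<lambda>j. k * f j) d = k * cov f d"
  unfolding cov_def by (simp add: sum_distrib_left mult_ac)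

lemma cov_commute: "cov c d = cov d c"
  unfolding cov_def by (simp add: mult_ac)

section \<open>Expectations along a fixed test vector\<close>

context
  fixes \<gamma> :: "nat \<Rightarrow> complex" and z :: complex
begin

abbreviation "D \<equiv> \<lambda>\<omega>. det (shift_mat N z (Y \<omega>))"

definition Q :: "'a \<Rightarrow> complex" where
  "Q \<omega> = (\<Sum>a<N. \<Sum>b<N. Y \<omega> $$ (a, b) * cnj (\<gamma> a) * \<gamma> b)"

definition G :: complex where "G = (\<Sum>a<N. cnj (\<gamma> a) * \<gamma> a)"

text \<open>Shifting the Gaussian family along the covariance with \<open>Q\<close> adds the rank-one matrix
  \<open>\<gamma> \<gamma>\<^sup>* / N\<close> to \<open>Y\<close>; \<open>K\<close> is the derivative of \<open>D\<close> in this direction, and it is constant along it.\<close>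

definition K :: "'a \<Rightarrow> complex" where
  "K \<omega> = rank_one_term N (\<lambda>i. - (\<gamma> i / of_nat N)) (\<lambda>k. cnj (\<gamma> k)) (shift_mat N z (Y \<omega>))"

definition qc :: "'j \<Rightarrow> complex" where
  "qc = (\<lambda>j. \<Sum>a<N. \<Sum>b<N. cnj (\<gamma> a) * \<gamma> b * co a b j)"

lemma lin_qc: "lin qc \<omega> = Q \<omega>"
proof -
  have "lin qc \<omega> = (\<Sum>j\<in>J. \<Sum>a<N. \<Sum>b<N. cnj (\<gamma> a) * \<gamma> b * co a b j * of_real (\<xi> j \<omega>))"
    unfolding lin_def qc_def by (simp add: sum_distrib_right)
  also have "\<dots> = (\<Sum>a<N. \<Sum>b<N. \<Sum>j\<in>J. cnj (\<gamma> a) * \<gamma> b * co a b j * of_real (\<xi> j \<omega>))"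
    by (subst sum.swap, intro sum.cong refl, rule sum.swap)
  also have "\<dots> = Q \<omega>" unfolding Q_def
    by (intro sum.cong refl) (simp add: Y_def lin_def sum_distrib_left sum_distrib_right mult_ac)
  finally show ?thesis .
qed

lemma cov_qc: "c < N \<Longrightarrow> d < N \<Longrightarrow> cov qc (co c d) = cnj (\<gamma> d) * \<gamma> c / of_nat N"
proof -
  assume cd: "c < N" "d < N"
  have "cov qc (co c d) = (\<Sum>a<N. \<Sum>b<N. cnj (\<gamma> a) * \<gamma> b * cov (co a b) (co c d))"
    unfolding qc_def cov_sum_left cov_smult_left ..
  also have "\<dots> = (\<Sum>a<N. \<Sum>b<N. if b = c then (if a = d then cnj (\<gamma> d) * \<gamma> c / of_nat N else 0) else 0)"
    by (intro sum.cong refl) (use cd in \<open>auto simp: cov_co\<close>)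
  also have "\<dots> = cnj (\<gamma> d) * \<gamma> c / of_nat N" using cd by (simp add: sum.delta)
  finally show ?thesis .
qed

lemma cov_qc_qc: "cov qc qc = G\<^sup>2 / of_nat N"
proof -
  have "cov qc qc = (\<Sum>a<N. \<Sum>b<N. cnj (\<gamma> a) * \<gamma> b * cov qc (co a b))"
    by (subst (2) qc_def) (simp only: cov_commute[of qc] cov_sum_left cov_smult_left)
  also have "\<dots> = (\<Sum>a<N. \<Sum>b<N. (cnj (\<gamma> a) * \<gamma> a) * (cnj (\<gamma> b) * \<gamma> b) / of_nat N)"
    by (intro sum.cong refl) (auto simp: cov_qc)
  also have "\<dots> = G\<^sup>2 / of_nat N"
    unfolding G_def power2_eq_square sum_product by (simp add: sum_divide_distrib)
  finally show ?thesis .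
qed

lemma shifted_Q: "shifted qc (\<lambda>\<omega>. [:Q \<omega>, G\<^sup>2 / of_nat N:])"
  using shifted_lin[of qc qc] by (simp add: lin_qc cov_qc_qc)

lemma shifted_entry:
  assumes "i < N" "j < N"
  shows "shifted qc (\<lambda>\<omega>. [:shift_mat N z (Y \<omega>) $$ (i, j), - (\<gamma> i / of_nat N) * cnj (\<gamma> j):])"
proof -
  have "shifted qc (\<lambda>\<omega>. [:if i = j then z else 0:] + [:-1:] * [:lin (co i j) \<omega>, cov qc (co i j):])"
    by (intro shifted_add shifted_mult shifted_const shifted_lin)
  moreover have "[:if i = j then z else 0:] + [:-1:] * [:lin (co i j) \<omega>, cov qc (co i j):] =
    [:shift_mat N z (Y \<omega>) $$ (i, j), - (\<gamma> i / of_nat N) * cnj (\<gamma> j):]" for \<omega>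
    using assms by (simp add: cov_qc shift_mat_def Y_def)
  ultimately show ?thesis by simp
qed

lemma shifted_D: "shifted qc (\<lambda>\<omega>. [:D \<omega>, K \<omega>:])"
  unfolding K_def by (rule shifted_det[OF shifted_entry]) auto

lemma shifted_K: "shifted qc (\<lambda>\<omega>. [:K \<omega>, 0:])"
  unfolding K_def by (rule shifted_rank_one_term[OF shifted_entry]) auto

lemma poly_rv_DKQ: "poly_rv D" "poly_rv K" "poly_rv Q"
proof -
  show "poly_rv D" by (intro poly_rv_det[of _ N] poly_rv_shift_Y) auto
  have "poly_rv (\<lambda>\<omega>. K \<omega>)" unfolding K_def rank_one_term_def
    by (intro poly_rv_sum poly_rv_mult poly_rv_const poly_rv_cofactor[of _ N] poly_rv_shift_Y) auto
  then show "poly_rv K" .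
  have "poly_rv (\<lambda>\<omega>. Q \<omega>)" unfolding Q_def
    by (intro poly_rv_sum poly_rv_mult poly_rv_const poly_rv_Y) auto
  then show "poly_rv Q" .
qed

abbreviation "\<mu> k \<equiv> complex_of_real (gauss_moment (1 / real N) k)"

lemma \<mu>_Suc: "\<mu> (Suc k) = of_nat k / of_nat N * \<mu> (k - 1)"
  by (simp add: gauss_moment_Suc)

text \<open>\<open>K\<close> does not vary in the covariance direction of \<open>Q\<close>, so
  against it \<open>Q\<close> behaves like an independent centred Gaussian of variance G^2 / N.
  Integration by parts lowers the power by two, hence the strong induction.\<close>

lemma expectation_KQ: "(LINT \<omega>|M. K \<omega> * Q \<omega> ^ k) = \<mu> k * G ^ k * (LINT \<omega>|M. K \<omega>)"
proof (induction k rule: less_induct)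
  case (less k)
  show ?case
  proof (cases k)
    case 0
    then show ?thesis by simp
  next
    case (Suc m)
    have "shifted qc (\<lambda>\<omega>. [:K \<omega>, 0:] * [:Q \<omega>, G\<^sup>2 / of_nat N:] ^ m)"
      by (intro shifted_mult shifted_power shifted_K shifted_Q)
    from stein[OF this] have "(LINT \<omega>|M. Q \<omega> * (K \<omega> * Q \<omega> ^ m)) =
        (LINT \<omega>|M. (of_nat m * (G\<^sup>2 / of_nat N)) * (K \<omega> * Q \<omega> ^ (m - 1)))"
      unfolding coeff_mult_01 coeff_power_01 by (simp add: lin_qc mult_ac)
    also have "\<dots> = of_nat m * (G\<^sup>2 / of_nat N) * (LINT \<omega>|M. K \<omega> * Q \<omega> ^ (m - 1))" by simp
    also have "\<dots> = \<mu> k * G ^ k * (LINT \<omega>|M. K \<omega>)"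
    proof (cases m)
      case 0
      then show ?thesis using Suc by simp
    next
      case (Suc l)
      then show ?thesis using less[of "m - 1"] \<open>k = Suc m\<close> \<mu>_Suc[of m]
        by (simp add: power2_eq_square del: gauss_moment.simps)
    qed
    finally show ?thesis using Suc by (simp add: mult_ac)
  qed
qed

text \<open>The same reduction, except that differentiating \<open>D\<close> gives \<open>K\<close>;
  the terms collected in this way over the induction add up to the factor \<open>k\<close>.\<close>

lemma expectation_DQ: "(LINT \<omega>|M. D \<omega> * Q \<omega> ^ k) =
  \<mu> k * G ^ k * (LINT \<omega>|M. D \<omega>) + of_nat k * \<mu> (k - 1) * G ^ (k - 1) * (LINT \<omega>|M. K \<omega>)"
proof (induction k rule: less_induct)
  case (less k)
  show ?case
  proof (cases k)
    case 0
    then show ?thesis by simp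
  next
    case (Suc m)
    have i: "integrable M (\<lambda>\<omega>. K \<omega> * Q \<omega> ^ m)" "integrable M (\<lambda>\<omega>. D \<omega> * Q \<omega> ^ (m - 1))"
      by (intro poly_rv_integrable poly_rv_mult poly_rv_power poly_rv_DKQ)+
    have "shifted qc (\<lambda>\<omega>. [:D \<omega>, K \<omega>:] * [:Q \<omega>, G\<^sup>2 / of_nat N:] ^ m)"
      by (intro shifted_mult shifted_power shifted_D shifted_Q)
    from stein[OF this] have "(LINT \<omega>|M. Q \<omega> * (D \<omega> * Q \<omega> ^ m)) =
        (LINT \<omega>|M. (of_nat m * (G\<^sup>2 / of_nat N)) * (D \<omega> * Q \<omega> ^ (m - 1)) + K \<omega> * Q \<omega> ^ m)"
      unfolding coeff_mult_01 coeff_power_01 by (simp add: lin_qc mult_ac)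
    also have "\<dots> = of_nat m * (G\<^sup>2 / of_nat N) * (LINT \<omega>|M. D \<omega> * Q \<omega> ^ (m - 1)) + \<mu> m * G ^ m * (LINT \<omega>|M. K \<omega>)"
      using i by (simp add: expectation_KQ)
    also have "\<dots> = \<mu> k * G ^ k * (LINT \<omega>|M. D \<omega>) + of_nat k * \<mu> (k - 1) * G ^ (k - 1) * (LINT \<omega>|M. K \<omega>)"
    proof (cases m)
      case 0
      then show ?thesis using Suc by simp
    next
      case (Suc l)
      have G: "G\<^sup>2 * G ^ l = G ^ k" "G\<^sup>2 * (of_nat l * G ^ (l - 1)) = of_nat l * G ^ m"
        using Suc \<open>k = Suc m\<close> by (auto simp: power2_eq_square power_eq_if)
      have "of_nat m * (G\<^sup>2 / of_nat N) * (LINT \<omega>|M. D \<omega> * Q \<omega> ^ (m - 1)) =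
        of_nat m / of_nat N * \<mu> l * (G\<^sup>2 * G ^ l) * (LINT \<omega>|M. D \<omega>) +
        of_nat m * (1 / of_nat N * \<mu> (l - 1)) * (G\<^sup>2 * (of_nat l * G ^ (l - 1))) * (LINT \<omega>|M. K \<omega>)"
        using less[of l] Suc \<open>k = Suc m\<close> by (simp add: algebra_simps)
      also have "\<dots> = \<mu> k * G ^ k * (LINT \<omega>|M. D \<omega>) + of_nat m * \<mu> m * G ^ m * (LINT \<omega>|M. K \<omega>)"
        unfolding G using \<mu>_Suc[of m] \<mu>_Suc[of l] Suc \<open>k = Suc m\<close> by (simp add: mult_ac del: gauss_moment.simps)
      finally show ?thesis using \<open>k = Suc m\<close> by (simp add: algebra_simps)
    qed
    finally show ?thesis using Suc by (simp add: mult_ac)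
  qed
qed

end

end

lemma poly_altdef_le:
  fixes p :: "'a :: comm_semiring_1 poly"
  assumes "degree p \<le> n"
  shows "poly p x = (\<Sum>j\<le>n. coeff p j * x ^ j)"
  unfolding poly_altdef using assms
  by (intro sum.mono_neutral_left) (auto simp: coeff_eq_0)

lemma qform_mult: "qform N B \<eta> * x = (\<Sum>a<N. \<Sum>b<N. B a b * cnj (gvar a \<eta>) * gvar b \<eta> * x)"
  by (simp add: qform_def sum_distrib_right)

section \<open>Averaging over the auxiliary Gaussian vector\<close>

context gauss_hermitian begin

abbreviation "YF \<omega> \<equiv> \<lambda>i j. Y \<omega> $$ (i, j)"

abbreviation "sg_rv \<equiv> gauss_family.poly_rv ({..<N} \<times> (UNIV :: bool set)) (\<lambda>j (\<eta> :: nat \<times> bool \<Rightarrow> real). \<eta> j)"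

lemma qform_integral_Suc:
  assumes "sg_rv V"
  shows "(LINT \<eta>|std_gauss N. V \<eta> * qform N (YF \<omega>) \<eta> ^ Suc k) =
    (\<Sum>a<N. \<Sum>b<N. YF \<omega> a b * (LINT \<eta>|std_gauss N. (V \<eta> * cnj (gvar a \<eta>) * gvar b \<eta>) * qform N (YF \<omega>) \<eta> ^ k))"
proof -
  interpret sg: gauss_family "std_gauss N" "{..<N} \<times> UNIV" "\<lambda>j \<omega>. \<omega> j" "\<lambda>_. 1/2"
    by (rule std_gauss_family)
  have i: "integrable (std_gauss N) (\<lambda>\<eta>. (V \<eta> * cnj (gvar a \<eta>) * gvar b \<eta>) * qform N (YF \<omega>) \<eta> ^ k)"
    if "a \<in> {..<N}" "b \<in> {..<N}" for a b
    using that by (intro sg.poly_rv_integrable sg.poly_rv_mult sg.poly_rv_power poly_rv_gvar poly_rv_qform assms) auto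
  have "(\<lambda>\<eta>. V \<eta> * qform N (YF \<omega>) \<eta> ^ Suc k) =
    (\<lambda>\<eta>. \<Sum>a<N. \<Sum>b<N. YF \<omega> a b * ((V \<eta> * cnj (gvar a \<eta>) * gvar b \<eta>) * qform N (YF \<omega>) \<eta> ^ k))"
  proof (rule ext)
    fix \<eta>
    have "V \<eta> * qform N (YF \<omega>) \<eta> ^ Suc k = qform N (YF \<omega>) \<eta> * (V \<eta> * qform N (YF \<omega>) \<eta> ^ k)" by simp
    also have "\<dots> = (\<Sum>a<N. \<Sum>b<N. YF \<omega> a b * ((V \<eta> * cnj (gvar a \<eta>) * gvar b \<eta>) * qform N (YF \<omega>) \<eta> ^ k))"
      unfolding qform_mult by (intro sum.cong refl) (simp only: mult_ac)
    finally show "V \<eta> * qform N (YF \<omega>) \<eta> ^ Suc k =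
      (\<Sum>a<N. \<Sum>b<N. YF \<omega> a b * ((V \<eta> * cnj (gvar a \<eta>) * gvar b \<eta>) * qform N (YF \<omega>) \<eta> ^ k))" .
  qed
  moreover have "(LINT \<eta>|std_gauss N. (\<Sum>a<N. \<Sum>b<N. YF \<omega> a b * ((V \<eta> * cnj (gvar a \<eta>) * gvar b \<eta>) * qform N (YF \<omega>) \<eta> ^ k))) =
    (\<Sum>a<N. \<Sum>b<N. YF \<omega> a b * (LINT \<eta>|std_gauss N. (V \<eta> * cnj (gvar a \<eta>) * gvar b \<eta>) * qform N (YF \<omega>) \<eta> ^ k))"
    by (subst Bochner_Integration.integral_sum) (intro integral_sum_mult sum.cong refl i; assumption)+
  ultimately show ?thesis by simp
qed

lemma poly_rv_gauss_integral:
  assumes "sg_rv V"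
  shows "poly_rv (\<lambda>\<omega>. LINT \<eta>|std_gauss N. V \<eta> * qform N (YF \<omega>) \<eta> ^ k)"
  using assms
proof (induction k arbitrary: V)
  case 0
  then show ?case by (simp add: poly_rv_const)
next
  case (Suc k)
  interpret sg: gauss_family "std_gauss N" "{..<N} \<times> UNIV" "\<lambda>j \<omega>. \<omega> j" "\<lambda>_. 1/2"
    by (rule std_gauss_family)
  show ?case unfolding qform_integral_Suc[OF Suc.prems]
    by (intro poly_rv_sum poly_rv_mult poly_rv_Y Suc.IH sg.poly_rv_mult poly_rv_gvar Suc.prems) auto
qed

lemma expectation_qform_Suc:
  assumes "poly_rv F"
  shows "(LINT \<omega>|M. F \<omega> * qform N (YF \<omega>) \<eta> ^ Suc k) =
    (\<Sum>a<N. \<Sum>b<N. (cnj (gvar a \<eta>) * gvar b \<eta>) * (LINT \<omega>|M. (F \<omega> * YF \<omega> a b) * qform N (YF \<omega>) \<eta> ^ k))"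
proof -
  have q: "poly_rv (\<lambda>\<omega>. qform N (YF \<omega>) \<eta>)"
    unfolding qform_def by (intro poly_rv_sum poly_rv_mult poly_rv_const poly_rv_Y) auto
  have i: "integrable M (\<lambda>\<omega>. (F \<omega> * YF \<omega> a b) * qform N (YF \<omega>) \<eta> ^ k)"
    if "a \<in> {..<N}" "b \<in> {..<N}" for a b
    using that by (intro poly_rv_integrable poly_rv_mult poly_rv_power poly_rv_Y q assms) auto
  have "(\<lambda>\<omega>. F \<omega> * qform N (YF \<omega>) \<eta> ^ Suc k) =
    (\<lambda>\<omega>. \<Sum>a<N. \<Sum>b<N. (cnj (gvar a \<eta>) * gvar b \<eta>) * ((F \<omega> * YF \<omega> a b) * qform N (YF \<omega>) \<eta> ^ k))"
  proof (rule ext)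
    fix \<omega>
    have "F \<omega> * qform N (YF \<omega>) \<eta> ^ Suc k = qform N (YF \<omega>) \<eta> * (F \<omega> * qform N (YF \<omega>) \<eta> ^ k)" by simp
    also have "\<dots> = (\<Sum>a<N. \<Sum>b<N. (cnj (gvar a \<eta>) * gvar b \<eta>) * ((F \<omega> * YF \<omega> a b) * qform N (YF \<omega>) \<eta> ^ k))"
      unfolding qform_mult by (intro sum.cong refl) (simp only: mult_ac)
    finally show "F \<omega> * qform N (YF \<omega>) \<eta> ^ Suc k =
      (\<Sum>a<N. \<Sum>b<N. (cnj (gvar a \<eta>) * gvar b \<eta>) * ((F \<omega> * YF \<omega> a b) * qform N (YF \<omega>) \<eta> ^ k))" .
  qed
  moreover have "(LINT \<omega>|M. (\<Sum>a<N. \<Sum>b<N. (cnj (gvar a \<eta>) * gvar b \<eta>) * ((F \<omega> * YF \<omega> a b) * qform N (YF \<omega>) \<eta> ^ k))) =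
    (\<Sum>a<N. \<Sum>b<N. (cnj (gvar a \<eta>) * gvar b \<eta>) * (LINT \<omega>|M. (F \<omega> * YF \<omega> a b) * qform N (YF \<omega>) \<eta> ^ k))"
    by (subst Bochner_Integration.integral_sum) (intro integral_sum_mult sum.cong refl i; assumption)+
  ultimately show ?thesis by simp
qed

lemma sg_rv_expectation:
  assumes "poly_rv F"
  shows "sg_rv (\<lambda>\<eta>. LINT \<omega>|M. F \<omega> * qform N (YF \<omega>) \<eta> ^ k)"
  using assms
proof (induction k arbitrary: F)
  case 0
  interpret sg: gauss_family "std_gauss N" "{..<N} \<times> UNIV" "\<lambda>j \<omega>. \<omega> j" "\<lambda>_. 1/2"
    by (rule std_gauss_family)
  show ?case by (simp add: sg.poly_rv_const)
next
  case (Suc k)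
  interpret sg: gauss_family "std_gauss N" "{..<N} \<times> UNIV" "\<lambda>j \<omega>. \<omega> j" "\<lambda>_. 1/2"
    by (rule std_gauss_family)
  show ?case unfolding expectation_qform_Suc[OF Suc.prems]
    by (intro sg.poly_rv_sum sg.poly_rv_mult poly_rv_gvar Suc.IH poly_rv_mult poly_rv_Y Suc.prems) auto
qed

text \<open>Each factor \<open>qform\<close> is a finite sum of products of a function of \<omega>
  and a function of \<eta>, which are absorbed into \<open>F\<close> and \<open>V\<close>; so the
  interchange is linearity of both integrals, and \<open>F\<close> and \<open>V\<close> have to be
  arbitrary in the induction.\<close>

lemma expectation_gauss_swap:
  assumes "poly_rv F" "sg_rv V"
  shows "(LINT \<omega>|M. F \<omega> * (LINT \<eta>|std_gauss N. V \<eta> * qform N (YF \<omega>) \<eta> ^ k)) =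
    (LINT \<eta>|std_gauss N. V \<eta> * (LINT \<omega>|M. F \<omega> * qform N (YF \<omega>) \<eta> ^ k))"
  using assms
proof (induction k arbitrary: F V)
  case 0
  then show ?case by simp
next
  case (Suc k)
  interpret sg: gauss_family "std_gauss N" "{..<N} \<times> UNIV" "\<lambda>j \<omega>. \<omega> j" "\<lambda>_. 1/2"
    by (rule std_gauss_family)
  let ?V = "\<lambda>a b \<eta>. V \<eta> * cnj (gvar a \<eta>) * gvar b \<eta>" and ?F = "\<lambda>a b \<omega>. F \<omega> * YF \<omega> a b"
  have V: "sg_rv (?V a b)" and F: "poly_rv (?F a b)" if "a \<in> {..<N}" "b \<in> {..<N}" for a b
    using that by (auto intro!: sg.poly_rv_mult poly_rv_mult poly_rv_gvar poly_rv_Y Suc.prems)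
  have "(LINT \<omega>|M. F \<omega> * (LINT \<eta>|std_gauss N. V \<eta> * qform N (YF \<omega>) \<eta> ^ Suc k)) =
    (LINT \<omega>|M. (\<Sum>a<N. \<Sum>b<N. ?F a b \<omega> * (LINT \<eta>|std_gauss N. ?V a b \<eta> * qform N (YF \<omega>) \<eta> ^ k)))"
    unfolding qform_integral_Suc[OF Suc.prems(2)] by (simp add: sum_distrib_left mult.assoc)
  also have "\<dots> = (\<Sum>a<N. \<Sum>b<N. LINT \<omega>|M. ?F a b \<omega> * (LINT \<eta>|std_gauss N. ?V a b \<eta> * qform N (YF \<omega>) \<eta> ^ k))"
    by (subst Bochner_Integration.integral_sum, intro poly_rv_integrable poly_rv_sum poly_rv_mult poly_rv_gauss_integral V F; assumption?)
      (intro sum.cong refl Bochner_Integration.integral_sum poly_rv_integrable poly_rv_mult poly_rv_gauss_integral V F; assumption)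
  also have "\<dots> = (\<Sum>a<N. \<Sum>b<N. LINT \<eta>|std_gauss N. ?V a b \<eta> * (LINT \<omega>|M. ?F a b \<omega> * qform N (YF \<omega>) \<eta> ^ k))"
    by (intro sum.cong refl Suc.IH F V)
  also have "\<dots> = (LINT \<eta>|std_gauss N. (\<Sum>a<N. \<Sum>b<N. ?V a b \<eta> * (LINT \<omega>|M. ?F a b \<omega> * qform N (YF \<omega>) \<eta> ^ k)))"
    by (subst Bochner_Integration.integral_sum, intro sg.poly_rv_integrable sg.poly_rv_sum sg.poly_rv_mult sg_rv_expectation V F; assumption?)
      (intro sum.cong refl Bochner_Integration.integral_sum[symmetric] sg.poly_rv_integrable sg.poly_rv_mult sg_rv_expectation V F; assumption)
  also have "\<dots> = (LINT \<eta>|std_gauss N. V \<eta> * (LINT \<omega>|M. F \<omega> * qform N (YF \<omega>) \<eta> ^ Suc k))"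
    unfolding expectation_qform_Suc[OF Suc.prems(1)] by (simp add: sum_distrib_left mult.assoc)
  finally show ?case .
qed

lemma poly_rv_gauss_h: "poly_rv (\<lambda>\<omega>. gauss_h N (YF \<omega>) k)"
proof -
  interpret sg: gauss_family "std_gauss N" "{..<N} \<times> UNIV" "\<lambda>j \<omega>. \<omega> j" "\<lambda>_. 1/2"
    by (rule std_gauss_family)
  have "poly_rv (\<lambda>\<omega>. (LINT \<eta>|std_gauss N. 1 * qform N (YF \<omega>) \<eta> ^ k) * (1 / fact k))"
    by (intro poly_rv_mult poly_rv_gauss_integral poly_rv_const sg.poly_rv_const)
  then show ?thesis by (simp add: gauss_h_def)
qed

text \<open>For a fixed test vector \<open>expectation_DQ\<close> leaves powers of |g|^2 and a form
  in the mean adjugate of z - Y. Averaging over the vector turns these into rising factorials and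
  into the trace of the adjugate, which is the derivative of the characteristic polynomial.\<close>

lemma expectation_det_gauss_h:
  "fact k * (LINT \<omega>|M. poly (char_poly (Y \<omega>)) z * gauss_h N (YF \<omega>) k) =
    pochhammer (of_nat N) k * (\<mu> k * (LINT \<omega>|M. poly (char_poly (Y \<omega>)) z)
      - of_nat k * \<mu> (k - 1) / (of_nat N)\<^sup>2 * (LINT \<omega>|M. poly (pderiv (char_poly (Y \<omega>))) z))"
proof -
  interpret sg: gauss_family "std_gauss N" "{..<N} \<times> UNIV" "\<lambda>j \<omega>. \<omega> j" "\<lambda>_. 1/2"
    by (rule std_gauss_family)
  let ?g = "\<lambda>\<eta> a. gvar a \<eta>"
  let ?H = "LINT \<omega>|M. D z \<omega>"
  \<comment> \<open>The transposed indices make \<open>B\<close> the mean adjugate of z - Y.\<close>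
  define B where "B = (\<lambda>a b. LINT \<omega>|M. cofactor (shift_mat N z (Y \<omega>)) b a)"
  have rvc: "poly_rv (\<lambda>\<omega>. cofactor (shift_mat N z (Y \<omega>)) i j)" if "i < N" "j < N" for i j
    by (intro poly_rv_cofactor[of _ N] poly_rv_shift_Y that) auto
  have Q: "Q (?g \<eta>) \<omega> = qform N (YF \<omega>) \<eta>" for \<eta> \<omega>
    by (simp add: Q_def qform_def)
  have G: "G (?g \<eta>) = norm_form N \<eta>" for \<eta>
  proof -
    have "norm_form N \<eta> = (\<Sum>a<N. \<Sum>b<N. if b = a then cnj (gvar a \<eta>) * gvar a \<eta> else 0)"
      unfolding norm_form_def qform_def by (intro sum.cong refl) auto
    then show ?thesis by (simp add: G_def sum.delta)
  qed
  have K: "(LINT \<omega>|M. K (?g \<eta>) z \<omega>) = - (qform N B \<eta> / of_nat N)" for \<eta>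
  proof -
    let ?c = "\<lambda>i k. - (gvar i \<eta> / of_nat N) * cnj (gvar k \<eta>)"
    have i: "integrable M (\<lambda>\<omega>. \<Sum>k<N. ?c i k * cofactor (shift_mat N z (Y \<omega>)) i k)" if "i \<in> {..<N}" for i
      using that by (intro integral_sum_mult(2) poly_rv_integrable rvc) auto
    have "(LINT \<omega>|M. K (?g \<eta>) z \<omega>) = (\<Sum>i<N. LINT \<omega>|M. (\<Sum>k<N. ?c i k * cofactor (shift_mat N z (Y \<omega>)) i k))"
      unfolding K_def rank_one_term_def by (rule Bochner_Integration.integral_sum[OF i])
    also have "\<dots> = (\<Sum>i<N. \<Sum>k<N. ?c i k * B k i)"
      unfolding B_def by (intro sum.cong refl integral_sum_mult(1) poly_rv_integrable rvc) auto
    also have "\<dots> = (\<Sum>k<N. \<Sum>i<N. - (gvar i \<eta> / of_nat N) * cnj (gvar k \<eta>) * B k i)"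
      by (rule sum.swap)
    also have "\<dots> = - (qform N B \<eta> / of_nat N)"
      unfolding qform_def by (simp add: sum_divide_distrib sum_negf mult_ac)
    finally show ?thesis .
  qed
  have Bsum: "(\<Sum>i<N. B i i) = (LINT \<omega>|M. poly (pderiv (char_poly (Y \<omega>))) z)"
    unfolding B_def sum_cofactor_shift_mat[OF Y_carrier, symmetric]
    by (rule Bochner_Integration.integral_sum[symmetric]) (intro poly_rv_integrable rvc; simp)
  \<comment> \<open>The factor \<open>k\<close> absorbs the truncated exponent at
    \<open>k = 0\<close>.\<close>
  have qB: "of_nat k * (LINT \<eta>|std_gauss N. qform N B \<eta> * norm_form N \<eta> ^ (k - 1)) =
      of_nat k * ((\<Sum>i<N. B i i) * pochhammer (of_nat N) k / of_nat N)"
    using std_gauss_norm_form(2)[of N B "k - 1"] N by (cases k) (simp_all add: field_simps)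
  have "fact k * (LINT \<omega>|M. D z \<omega> * gauss_h N (YF \<omega>) k) = (LINT \<omega>|M. D z \<omega> * (LINT \<eta>|std_gauss N. 1 * qform N (YF \<omega>) \<eta> ^ k))"
    unfolding gauss_h_def by simp
  also have "\<dots> = (LINT \<eta>|std_gauss N. 1 * (LINT \<omega>|M. D z \<omega> * qform N (YF \<omega>) \<eta> ^ k))"
    by (intro expectation_gauss_swap poly_rv_DKQ sg.poly_rv_const)
  also have "\<dots> = (LINT \<eta>|std_gauss N. \<mu> k * ?H * norm_form N \<eta> ^ k
      + (- (of_nat k * \<mu> (k - 1) / of_nat N)) * (qform N B \<eta> * norm_form N \<eta> ^ (k - 1)))"
    using expectation_DQ[of z "?g _" k] unfolding Q G K by (simp add: mult_ac)
  also have "\<dots> = \<mu> k * ?H * (LINT \<eta>|std_gauss N. norm_form N \<eta> ^ k)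
      + (- (of_nat k * \<mu> (k - 1) / of_nat N)) * (LINT \<eta>|std_gauss N. qform N B \<eta> * norm_form N \<eta> ^ (k - 1))"
    by (subst Bochner_Integration.integral_add)
      (auto intro!: integrable_mult_right integrable_qform_power simp: norm_form_def)
  also have "(- (of_nat k * \<mu> (k - 1) / of_nat N)) * (LINT \<eta>|std_gauss N. qform N B \<eta> * norm_form N \<eta> ^ (k - 1))
      = - (\<mu> (k - 1) / of_nat N) * (of_nat k * (LINT \<eta>|std_gauss N. qform N B \<eta> * norm_form N \<eta> ^ (k - 1)))"
    by simp
  finally show ?thesis
    unfolding qB std_gauss_norm_form(1) Bsum det_shift_mat[OF Y_carrier]
    using N by (simp add: field_simps power2_eq_square)
qed

definition mean_char_fps :: "complex fps" where
  "mean_char_fps = Abs_fps (\<lambda>j. if j \<le> N then (LINT \<omega>|M. coeff (char_poly (Y \<omega>)) (N - j)) else 0)"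

text \<open>For a fixed vector g the form g^H Y g has the moments of a centred Gaussian of variance
  |g|^4 / N; so these are the means of the homogeneous polynomials in closed form.\<close>

definition mean_h_fps :: "complex fps" where
  "mean_h_fps = Abs_fps (\<lambda>k. pochhammer (of_nat N) k * \<mu> k / fact k)"

definition mean_trace_fps :: "complex fps" where
  "mean_trace_fps = Abs_fps (\<lambda>n. LINT \<omega>|M. fps_nth (trace_fps N (Y \<omega>)) n)"

lemma poly_rv_coeff: "poly_rv (\<lambda>\<omega>. coeff (char_poly (Y \<omega>)) k)"
  by (intro poly_rv_char_poly[of _ N] poly_rv_Y) auto

text \<open>The identity of \<open>expectation_det_gauss_h\<close> holds for every z, so the two
  sides agree as polynomials in z.\<close>

lemma expectation_coeff_gauss_h:
  "fact k * (LINT \<omega>|M. coeff (char_poly (Y \<omega>)) j * gauss_h N (YF \<omega>) k) =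
    pochhammer (of_nat N) k * (\<mu> k * (LINT \<omega>|M. coeff (char_poly (Y \<omega>)) j)
      - of_nat k * \<mu> (k - 1) / (of_nat N)\<^sup>2 * (of_nat (Suc j) * (LINT \<omega>|M. coeff (char_poly (Y \<omega>)) (Suc j))))"
proof -
  have dg: "degree (char_poly (Y \<omega>)) = N" for \<omega> using degree_monic_char_poly[OF Y_carrier] by blast
  define c where "c j = (LINT \<omega>|M. coeff (char_poly (Y \<omega>)) j)" for j
  define e where "e j = (LINT \<omega>|M. coeff (char_poly (Y \<omega>)) j * gauss_h N (YF \<omega>) k)" for j
  define P where "P = (\<Sum>j\<le>N. monom (c j) j)"
  define E where "E = (\<Sum>j\<le>N. monom (e j) j)"
  have cP: "coeff P j = c j" for j
    using dg by (auto simp: P_def coeff_sum coeff_monom c_def coeff_eq_0 if_distrib sum.delta cong: if_cong)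
  have cE: "coeff E j = e j" for j
    using dg by (auto simp: E_def coeff_sum coeff_monom e_def coeff_eq_0 if_distrib sum.delta cong: if_cong)
  have P: "poly P z = (LINT \<omega>|M. poly (char_poly (Y \<omega>)) z)" for z
  proof -
    have "(LINT \<omega>|M. (\<Sum>j\<le>N. z ^ j * coeff (char_poly (Y \<omega>)) j)) = (\<Sum>j\<le>N. z ^ j * c j)"
      unfolding c_def by (intro integral_sum_mult poly_rv_integrable poly_rv_coeff)
    then show ?thesis by (simp add: P_def poly_sum poly_monom poly_altdef_le[of "char_poly _" N] dg mult.commute)
  qed
  have E: "poly E z = (LINT \<omega>|M. poly (char_poly (Y \<omega>)) z * gauss_h N (YF \<omega>) k)" for z
  proof -
    have "(LINT \<omega>|M. (\<Sum>j\<le>N. z ^ j * (coeff (char_poly (Y \<omega>)) j * gauss_h N (YF \<omega>) k))) = (\<Sum>j\<le>N. z ^ j * e j)"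
      unfolding e_def by (intro integral_sum_mult poly_rv_integrable poly_rv_mult poly_rv_gauss_h poly_rv_coeff)
    then show ?thesis by (simp add: E_def poly_sum poly_monom poly_altdef_le[of "char_poly _" N] dg sum_distrib_left sum_distrib_right mult_ac)
  qed
  have P': "poly (pderiv P) z = (LINT \<omega>|M. poly (pderiv (char_poly (Y \<omega>))) z)" for z
  proof -
    have "(LINT \<omega>|M. (\<Sum>j\<le>N. (z ^ j * of_nat (Suc j)) * coeff (char_poly (Y \<omega>)) (Suc j))) = (\<Sum>j\<le>N. (z ^ j * of_nat (Suc j)) * c (Suc j))"
      unfolding c_def by (intro integral_sum_mult poly_rv_integrable poly_rv_coeff)
    moreover have "poly (pderiv p) z = (\<Sum>j\<le>N. (z ^ j * of_nat (Suc j)) * coeff p (Suc j))" if "degree p \<le> N" for p :: "complex poly"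
    proof -
      have "degree (pderiv p) \<le> N" using that by (simp add: degree_pderiv)
      then have "poly (pderiv p) z = (\<Sum>j\<le>N. coeff (pderiv p) j * z ^ j)"
        by (rule poly_altdef_le)
      then show ?thesis by (simp add: coeff_pderiv mult_ac del: of_nat_Suc)
    qed
    moreover have "degree P \<le> N" unfolding P_def by (intro degree_sum_le) (auto intro: order_trans[OF degree_monom_le])
    ultimately show ?thesis using dg by (simp add: cP del: of_nat_Suc)
  qed
  have "Polynomial.smult (fact k) E = Polynomial.smult (pochhammer (of_nat N) k) (Polynomial.smult (\<mu> k) P - Polynomial.smult (of_nat k * \<mu> (k - 1) / (of_nat N)\<^sup>2) (pderiv P))"
    unfolding poly_eq_poly_eq_iff[symmetric]
    by (rule ext) (simp add: P E P' expectation_det_gauss_h)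
  from arg_cong[OF this, of "\<lambda>p. coeff p j"] show ?thesis
    by (simp add: cP cE coeff_pderiv c_def e_def del: of_nat_Suc)
qed

end

section \<open>The series of mean traces\<close>

context gauss_hermitian begin

text \<open>Each mean is a combination of two products of a function of \<open>j\<close> and a
  function of \<open>k\<close>, so convolutions become products of series. The factors
  \<open>fps_X\<close> shift both indices by one, since the second term involves the derivative of
  the characteristic polynomial and a moment of order \<open>k - 1\<close>.\<close>

lemma expectation_rev_coeff_gauss_h:
  defines "a1 \<equiv> fps_const (of_nat N) * mean_char_fps - fps_euler mean_char_fps"
    and "b1 \<equiv> fps_const (of_nat N) * mean_h_fps + fps_euler mean_h_fps"
  shows "(LINT \<omega>|M. fps_nth (rev_char_poly N (Y \<omega>)) j * fps_nth (gauss_h_fps N (Y \<omega>)) k) =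
    fps_nth mean_char_fps j * fps_nth mean_h_fps k
    - 1 / (of_nat N)\<^sup>2 * (fps_nth (fps_X * a1) j * fps_nth (fps_X * b1) k)"
proof (cases "j \<le> N")
  case False
  then have "fps_nth (fps_X * a1) j = 0"
    by (cases j) (auto simp: a1_def mean_char_fps_def)
  then show ?thesis using False by (simp add: rev_char_poly_def mean_char_fps_def)
next
  case True
  define c where "c j = (LINT \<omega>|M. coeff (char_poly (Y \<omega>)) j)" for j
  have dg: "degree (char_poly (Y \<omega>)) = N" for \<omega> using degree_monic_char_poly[OF Y_carrier] by blast
  have A: "of_nat (Suc (N - j)) * c (Suc (N - j)) = fps_nth (fps_X * a1) j"
  proof (cases j)
    case 0
    then show ?thesis using dg by (simp add: c_def coeff_eq_0)
  next
    case (Suc i)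
    then have "Suc (N - j) = N - i" "i \<le> N" using True by auto
    then show ?thesis using Suc by (simp add: a1_def mean_char_fps_def c_def of_nat_diff algebra_simps)
  qed
  have B: "pochhammer (of_nat N) k * (of_nat k * \<mu> (k - 1)) / fact k = fps_nth (fps_X * b1) k"
  proof (cases k)
    case (Suc i)
    have "pochhammer (of_nat N) (Suc i) * (of_nat (Suc i) * \<mu> i) / fact (Suc i) =
      (of_nat N + of_nat i) * (pochhammer (of_nat N) i * \<mu> i / fact i)"
      by (simp add: pochhammer_Suc divide_simps del: gauss_moment.simps of_nat_Suc)
    moreover have "fps_nth (fps_X * b1) k = (of_nat N + of_nat i) * fps_nth mean_h_fps i"
      using Suc by (simp add: b1_def distrib_right)
    ultimately show ?thesis unfolding Suc mean_h_fps_def fps_nth_Abs_fps diff_Suc_1 by (simp only:)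
  qed simp
  have "(LINT \<omega>|M. fps_nth (rev_char_poly N (Y \<omega>)) j * fps_nth (gauss_h_fps N (Y \<omega>)) k) =
    (LINT \<omega>|M. coeff (char_poly (Y \<omega>)) (N - j) * gauss_h N (YF \<omega>) k)"
    using True by (simp add: rev_char_poly_def gauss_h_fps_def)
  also have "\<dots> = (pochhammer (of_nat N) k * \<mu> k / fact k) * c (N - j)
      - 1 / (of_nat N)\<^sup>2 * ((of_nat (Suc (N - j)) * c (Suc (N - j))) * (pochhammer (of_nat N) k * (of_nat k * \<mu> (k - 1)) / fact k))"
  proof -
    have alg: "f * x = p * (m * y - k * m' / n * z) \<Longrightarrow> f \<noteq> 0 \<Longrightarrow> x = (p * m / f) * y - 1 / n * (z * (p * (k * m') / f))"
      for f x p m y k m' n z :: complex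
      by (simp add: field_simps)
    show ?thesis
      by (rule alg[OF expectation_coeff_gauss_h[of k "N - j", folded c_def]]) simp
  qed
  also have "\<dots> = fps_nth mean_char_fps j * fps_nth mean_h_fps k
    - 1 / (of_nat N)\<^sup>2 * (fps_nth (fps_X * a1) j * fps_nth (fps_X * b1) k)"
    unfolding A B using True by (simp add: mean_char_fps_def mean_h_fps_def c_def)
  finally show ?thesis .
qed

lemma expectation_fps_mult:
  defines "a1 \<equiv> fps_const (of_nat N) * mean_char_fps - fps_euler mean_char_fps"
    and "b1 \<equiv> fps_const (of_nat N) * mean_h_fps + fps_euler mean_h_fps"
  shows "(LINT \<omega>|M. fps_nth (rev_char_poly N (Y \<omega>) * gauss_h_fps N (Y \<omega>)) m) =
     fps_nth (mean_char_fps * mean_h_fps - fps_const (1 / (of_nat N)\<^sup>2) * (fps_X * a1) * (fps_X * b1)) m"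
    and "(LINT \<omega>|M. fps_nth (fps_euler (rev_char_poly N (Y \<omega>)) * gauss_h_fps N (Y \<omega>)) m) =
     fps_nth (fps_euler mean_char_fps * mean_h_fps - fps_const (1 / (of_nat N)\<^sup>2) * fps_euler (fps_X * a1) * (fps_X * b1)) m"
proof -
  have i: "integrable M (\<lambda>\<omega>. fps_nth (rev_char_poly N (Y \<omega>)) j * fps_nth (gauss_h_fps N (Y \<omega>)) k)" for j k
  proof (cases "j \<le> N")
    case True
    have "integrable M (\<lambda>\<omega>. coeff (char_poly (Y \<omega>)) (N - j) * gauss_h N (YF \<omega>) k)"
      by (intro poly_rv_integrable poly_rv_mult poly_rv_coeff poly_rv_gauss_h)
    then show ?thesis using True by (simp add: rev_char_poly_def gauss_h_fps_def)
  qed (simp add: rev_char_poly_def)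
  have gen: "(LINT \<omega>|M. (\<Sum>j=0..m. r j * (fps_nth (rev_char_poly N (Y \<omega>)) j * fps_nth (gauss_h_fps N (Y \<omega>)) (m - j)))) =
    (\<Sum>j=0..m. r j * (fps_nth mean_char_fps j * fps_nth mean_h_fps (m - j)
    - 1 / (of_nat N)\<^sup>2 * (fps_nth (fps_X * a1) j * fps_nth (fps_X * b1) (m - j))))" for r :: "nat \<Rightarrow> complex"
    unfolding a1_def b1_def expectation_rev_coeff_gauss_h[symmetric]
    by (intro integral_sum_mult i)
  have F: "fps_nth (f * g - fps_const c * h * k) m = (\<Sum>j=0..m. fps_nth f j * fps_nth g (m - j) - c * (fps_nth h j * fps_nth k (m - j)))"
    for f g h k and c :: complex
    by (simp add: fps_mult_nth[of f g] fps_mult_nth[of h k] mult.assoc sum_subtractf sum_distrib_left)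
  show "(LINT \<omega>|M. fps_nth (rev_char_poly N (Y \<omega>) * gauss_h_fps N (Y \<omega>)) m) =
     fps_nth (mean_char_fps * mean_h_fps - fps_const (1 / (of_nat N)\<^sup>2) * (fps_X * a1) * (fps_X * b1)) m"
    using gen[of "\<lambda>_. 1"] unfolding F by (simp only: fps_mult_nth mult_1)
  show "(LINT \<omega>|M. fps_nth (fps_euler (rev_char_poly N (Y \<omega>)) * gauss_h_fps N (Y \<omega>)) m) =
     fps_nth (fps_euler mean_char_fps * mean_h_fps - fps_const (1 / (of_nat N)\<^sup>2) * fps_euler (fps_X * a1) * (fps_X * b1)) m"
    using gen[of of_nat] unfolding F fps_mult_nth[of "fps_euler _"] fps_euler_nth
    by (simp only: mult.assoc right_diff_distrib mult.left_commute[of _ "1 / _"])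
qed

lemma poly_rv_trace: "poly_rv (\<lambda>\<omega>. fps_nth (trace_fps N (Y \<omega>)) n)"
  unfolding trace_fps_def fps_nth_Abs_fps by (intro poly_rv_trace_pow poly_rv_Y) auto

lemma total_mass: "(LINT \<omega>|M. 1) = (1::complex)"
  using has_bochner_integral_mon[of "\<lambda>_. 0"] by (simp add: mon_0 has_bochner_integral_iff)

text \<open>Taking means in the two identities of \<open>rev_char_poly_mult_gauss_h\<close> gives
  the hypotheses \<open>one\<close> and \<open>w\<close> of \<open>third_order_recurrence\<close>
  with \<sigma>2 = 1/N; \<open>ode_b\<close> is read off the explicit coefficients.\<close>

lemma mean_trace_recurrence:
  fixes k :: nat
  defines "w \<equiv> \<lambda>n. LINT \<omega>|M. fps_nth (trace_fps N (Y \<omega>)) n"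
  shows "of_nat k * of_nat (k + 2) * w k =
    4 * (if k \<ge> 2 then of_nat k * of_nat (k - 1) * w (k - 2) else 0)
    + 1 / (of_nat N)\<^sup>2 * (if k \<ge> 4 then of_nat k * of_nat (k - 1) * of_nat (k - 2) * of_nat (k - 3) * w (k - 4) else 0)"
proof -
  let ?a = mean_char_fps and ?b = mean_h_fps and ?n = "fps_const (of_nat N :: complex)"
  let ?Y = "fps_const (1 / of_nat N) * fps_X\<^sup>2 :: complex fps"
  define a1 where "a1 = ?n * ?a - fps_euler ?a"
  define b1 where "b1 = ?n * ?b + fps_euler ?b"
  have N0: "(of_nat N :: complex) \<noteq> 0" using N by simp
  have c: "?n * fps_const (1 / (of_nat N)\<^sup>2) = fps_const (1 / of_nat N)"
    using N0 by (simp add: power2_eq_square)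
  have one: "?a * ?b - fps_const (1 / (of_nat N)\<^sup>2) * (fps_X * a1) * (fps_X * b1) = 1"
  proof (rule fps_ext)
    fix m
    have "fps_nth (?a * ?b - fps_const (1 / (of_nat N)\<^sup>2) * (fps_X * a1) * (fps_X * b1)) m =
      (LINT \<omega>|M. fps_nth (1 :: complex fps) m)"
      unfolding a1_def b1_def expectation_fps_mult(1)[symmetric] rev_char_poly_mult_gauss_h(1)[OF Y_carrier] ..
    then show "fps_nth (?a * ?b - fps_const (1 / (of_nat N)\<^sup>2) * (fps_X * a1) * (fps_X * b1)) m = fps_nth 1 m"
      using total_mass by (cases m) simp_all
  qed
  have w: "mean_trace_fps = ?n - (fps_euler ?a * ?b - fps_const (1 / (of_nat N)\<^sup>2) * fps_euler (fps_X * a1) * (fps_X * b1))"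
  proof (rule fps_ext)
    fix m
    have "fps_nth (fps_euler ?a * ?b - fps_const (1 / (of_nat N)\<^sup>2) * fps_euler (fps_X * a1) * (fps_X * b1)) m
      = (LINT \<omega>|M. fps_nth (fps_euler (rev_char_poly N (Y \<omega>)) * gauss_h_fps N (Y \<omega>)) m)"
      unfolding a1_def b1_def expectation_fps_mult(2) ..
    also have "\<dots> = (LINT \<omega>|M. fps_nth ?n m * 1 - fps_nth (trace_fps N (Y \<omega>)) m)"
    proof (intro Bochner_Integration.integral_cong refl)
      fix \<omega>
      have "fps_euler (rev_char_poly N (Y \<omega>)) * gauss_h_fps N (Y \<omega>) = ?n - trace_fps N (Y \<omega>)"
        using rev_char_poly_mult_gauss_h(2)[OF Y_carrier, of \<omega>] by (simp add: algebra_simps)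
      then show "fps_nth (fps_euler (rev_char_poly N (Y \<omega>)) * gauss_h_fps N (Y \<omega>)) m = fps_nth ?n m * 1 - fps_nth (trace_fps N (Y \<omega>)) m"
        by simp
    qed
    also have "\<dots> = fps_nth ?n m * (LINT \<omega>|M. 1) - (LINT \<omega>|M. fps_nth (trace_fps N (Y \<omega>)) m)"
      by (subst Bochner_Integration.integral_diff)
        (intro poly_rv_integrable poly_rv_trace poly_rv_const integral_mult_right_zero arg_cong2[of _ _ _ _ "(-)"] refl)+
    finally show "fps_nth mean_trace_fps m = fps_nth (?n - (fps_euler ?a * ?b - fps_const (1 / (of_nat N)\<^sup>2) * fps_euler (fps_X * a1) * (fps_X * b1))) m"
      unfolding total_mass by (simp add: mean_trace_fps_def)
  qed
  have X: "fps_euler (fps_X * a1) = fps_X * (a1 + fps_euler a1)"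
    by (simp add: fps_euler_def algebra_simps)
  have ode_b: "?Y * (?n * b1 + fps_euler b1 + b1) = fps_euler ?b"
  proof (rule fps_ext)
    fix k
    show "fps_nth (?Y * (?n * b1 + fps_euler b1 + b1)) k = fps_nth (fps_euler ?b) k"
    proof (cases "k \<ge> 2")
      case False
      then consider "k = 0" | "k = 1" by linarith
      then show ?thesis by cases (auto simp: mult.assoc fps_X_power_mult_nth mean_h_fps_def)
    next
      case True
      then obtain i where k: "k = Suc (Suc i)" by (metis add_2_eq_Suc le_Suc_ex)
      have "of_nat k * (pochhammer (of_nat N) k * \<mu> k / fact k) =
        1 / of_nat N * ((of_nat N + of_nat i + 1) * (of_nat N + of_nat i) * (pochhammer (of_nat N) i * \<mu> i / fact i))"
      proof -
        have "\<mu> k = of_nat (Suc i) / of_nat N * \<mu> i" unfolding k by (simp add: gauss_moment_Suc del: of_nat_Suc)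
        moreover have "fact k = (of_nat k * (of_nat (Suc i) * fact i) :: complex)" unfolding k by simp
        moreover have "pochhammer (of_nat N) k = pochhammer (of_nat N) i * (of_nat N + of_nat i) * (of_nat N + of_nat i + 1 :: complex)"
          unfolding k by (simp add: pochhammer_Suc algebra_simps)
        moreover have "(of_nat k :: complex) \<noteq> 0" "(of_nat (Suc i) :: complex) \<noteq> 0" unfolding k by (simp_all del: of_nat_Suc)
        ultimately show ?thesis using N0 by (simp add: divide_simps del: of_nat_Suc)
      qed
      moreover have "fps_nth (?n * b1 + fps_euler b1 + b1) i = (of_nat N + of_nat i + 1) * (of_nat N + of_nat i) * fps_nth ?b i"
        by (simp add: b1_def algebra_simps)
      moreover have "fps_nth (?Y * f) k = 1 / of_nat N * fps_nth f i" for f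
        by (simp add: k mult.assoc fps_X_power_mult_nth)
      ultimately show ?thesis unfolding mean_h_fps_def fps_nth_Abs_fps fps_euler_nth by (simp only:)
    qed
  qed
  have one': "?n * ?a * ?b - ?Y * a1 * b1 = ?n"
    using arg_cong[OF one, of "\<lambda>f. ?n * f"] by (simp add: right_diff_distrib c[symmetric] power2_eq_square mult_ac)
  have w': "?n * mean_trace_fps = ?n * a1 * ?b - ?Y * (?n * a1 - fps_euler a1 - a1) * b1"
  proof -
    have "mean_trace_fps = ?n * (?a * ?b - fps_const (1 / (of_nat N)\<^sup>2) * (fps_X * a1) * (fps_X * b1)) -
      (fps_euler ?a * ?b - fps_const (1 / (of_nat N)\<^sup>2) * (fps_X * (a1 + fps_euler a1)) * (fps_X * b1))"
      unfolding one w X by simp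
    also have "\<dots> = (?n * ?a - fps_euler ?a) * ?b - fps_const (1 / (of_nat N)\<^sup>2) * fps_X\<^sup>2 * (?n * a1 - fps_euler a1 - a1) * b1"
      by (simp add: algebra_simps power2_eq_square)
    finally have m: "mean_trace_fps = a1 * ?b - fps_const (1 / (of_nat N)\<^sup>2) * fps_X\<^sup>2 * (?n * a1 - fps_euler a1 - a1) * b1"
      unfolding a1_def[symmetric] .
    have "?n * mean_trace_fps = ?n * (a1 * ?b) - (?n * fps_const (1 / (of_nat N)\<^sup>2)) * fps_X\<^sup>2 * (?n * a1 - fps_euler a1 - a1) * b1"
      unfolding m by (simp only: right_diff_distrib[of ?n "a1 * ?b"] mult.assoc)
    then show ?thesis unfolding c by (simp only: mult.assoc)
  qed
  have b0: "fps_nth ?b 0 = 1" by (simp add: mean_h_fps_def)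
  have "(1 / of_nat N :: complex) \<noteq> 0" using N0 by simp
  from third_order_recurrence[OF N this b0 ode_b[unfolded b1_def] one'[unfolded a1_def b1_def] w'[unfolded a1_def b1_def], of k]
  show ?thesis using N0 by (simp add: w_def mean_trace_fps_def power_one_over)
qed

end

section \<open>The GUE and its mean eigenvalue density\<close>

lemma (in prob_space) has_bochner_integral_indep_vars_prod:
  fixes X :: "'i \<Rightarrow> 'a \<Rightarrow> real"
  assumes "finite I" "indep_vars (\<lambda>_. borel) X I"
    and "\<And>i. i \<in> I \<Longrightarrow> has_bochner_integral M (X i) (c i)"
  shows "has_bochner_integral M (\<lambda>\<omega>. \<Prod>i\<in>I. X i \<omega>) (\<Prod>i\<in>I. c i)"
  using assms indep_vars_lebesgue_integral[of I X] indep_vars_integrable[of I X]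
  by (auto simp: has_bochner_integral_iff)

lemma distributed_normal_moment:
  assumes "distributed M lborel X (\<lambda>x. ennreal (normal_density 0 (sqrt s) x))" "s > 0"
  shows "has_bochner_integral M (\<lambda>\<omega>. X \<omega> ^ n) (gauss_moment s n)"
proof -
  have "has_bochner_integral lborel (\<lambda>x. normal_density 0 (sqrt s) x * x ^ n) (gauss_moment s n)"
    using normal_density_moment[of "sqrt s" n] assms(2) by simp
  then show ?thesis
    using distributed_integrable[OF assms(1), of "\<lambda>x. x ^ n"] distributed_integral[OF assms(1), of "\<lambda>x. x ^ n"]
    by (simp add: has_bochner_integral_iff)
qed

definition gue_index :: "nat \<Rightarrow> ((nat \<times> nat) \<times> bool) set" where
  "gue_index N = {(j, k). j \<le> k \<and> k < N} \<times> UNIV"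

definition gue_coord :: "('a \<Rightarrow> complex mat) \<Rightarrow> (nat \<times> nat) \<times> bool \<Rightarrow> 'a \<Rightarrow> real" where
  "gue_coord X x \<omega> = (if snd x then Im (X \<omega> $$ fst x) else Re (X \<omega> $$ fst x))"

text \<open>The imaginary part of a diagonal entry is treated as a Gaussian variable of variance 0.\<close>

definition gue_var :: "nat \<Rightarrow> (nat \<times> nat) \<times> bool \<Rightarrow> real" where
  "gue_var N x = (if fst (fst x) = snd (fst x) then if snd x then 0 else 1 / real N else 1 / (2 * real N))"

text \<open>Coordinates are stored only for the upper triangle. A lower entry is the conjugate of an
  upper one, hence the sign of the imaginary part; a diagonal entry is real, hence the coefficient
  0.\<close>

definition gue_co :: "nat \<Rightarrow> nat \<Rightarrow> (nat \<times> nat) \<times> bool \<Rightarrow> complex" where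
  "gue_co a b x = (if fst x = (min a b, max a b)
     then if snd x then if a < b then \<i> else if b < a then - \<i> else 0 else 1 else 0)"

lemma gauss_moment_0: "gauss_moment 0 n = (if n = 0 then 1 else 0)"
  by (cases n) (simp_all add: gauss_moment_Suc)

lemma sum_gue_index: "(\<Sum>x\<in>gue_index N. f x) = (\<Sum>p\<in>{(j, k). j \<le> k \<and> k < N}. f (p, True) + f (p, False) :: 'b :: comm_monoid_add)"
  unfolding gue_index_def sum.cartesian_product' by (simp add: UNIV_bool add.commute)

lemma finite_pairs: "finite {(j, k). j \<le> k \<and> k < (N :: nat)}"
  by (rule finite_subset[of _ "{..<N} \<times> {..<N}"]) auto

lemma sum_pairs_delta:
  fixes a b N :: nat
  assumes "a < N" "b < N"
  shows "(\<Sum>p\<in>{(j, k). j \<le> k \<and> k < N}. if p = (min a b, max a b) then c else 0 :: 'b :: comm_monoid_add) = c"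
  using assms finite_pairs[of N] by (subst sum.delta) auto

lemma GUE_D:
  assumes "GUE M N X"
  shows "prob_space M"
    and "\<omega> \<in> space M \<Longrightarrow> X \<omega> \<in> carrier_mat N N"
    and "\<omega> \<in> space M \<Longrightarrow> j < N \<Longrightarrow> k < N \<Longrightarrow> X \<omega> $$ (j, k) = cnj (X \<omega> $$ (k, j))"
    and "prob_space.indep_vars M (\<lambda>_. borel) (\<lambda>p \<omega>. X \<omega> $$ p) {(j, k). j \<le> k \<and> k < N}"
    and "j < N \<Longrightarrow> distributed M lborel (\<lambda>\<omega>. Re (X \<omega> $$ (j, j))) (\<lambda>x. ennreal (normal_density 0 (sqrt (1 / real N)) x))"
    and "k < N \<Longrightarrow> j < k \<Longrightarrow> prob_space.indep_var M borel (\<lambda>\<omega>. Re (X \<omega> $$ (j, k))) borel (\<lambda>\<omega>. Im (X \<omega> $$ (j, k)))"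
    and "k < N \<Longrightarrow> j < k \<Longrightarrow> distributed M lborel (\<lambda>\<omega>. Re (X \<omega> $$ (j, k))) (\<lambda>x. ennreal (normal_density 0 (sqrt (1 / (2 * real N))) x))"
    and "k < N \<Longrightarrow> j < k \<Longrightarrow> distributed M lborel (\<lambda>\<omega>. Im (X \<omega> $$ (j, k))) (\<lambda>x. ennreal (normal_density 0 (sqrt (1 / (2 * real N))) x))"
proof -
  note g = assms[unfolded GUE_def]
  show "prob_space M" using g by (elim conjE)
  have h: "\<forall>\<omega>\<in>space M. X \<omega> \<in> carrier_mat N N \<and> (\<forall>j<N. \<forall>k<N. X \<omega> $$ (j, k) = cnj (X \<omega> $$ (k, j)))"
    using g by (elim conjE)
  show "\<omega> \<in> space M \<Longrightarrow> X \<omega> \<in> carrier_mat N N" by (rule h[rule_format, THEN conjunct1])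
  show "\<omega> \<in> space M \<Longrightarrow> j < N \<Longrightarrow> k < N \<Longrightarrow> X \<omega> $$ (j, k) = cnj (X \<omega> $$ (k, j))"
    by (rule h[THEN bspec, THEN conjunct2, rule_format])
  have "prob_space.indep_vars M (\<lambda>_. borel) (\<lambda>(j, k) \<omega>. X \<omega> $$ (j, k)) {(j, k). j \<le> k \<and> k < N}"
    using g by (elim conjE)
  moreover have "(\<lambda>(j, k) \<omega>. X \<omega> $$ (j, k)) = (\<lambda>p \<omega>. X \<omega> $$ p)" by auto
  ultimately show "prob_space.indep_vars M (\<lambda>_. borel) (\<lambda>p \<omega>. X \<omega> $$ p) {(j, k). j \<le> k \<and> k < N}"
    by (simp only:)
  have d: "\<forall>j<N. distributed M lborel (\<lambda>\<omega>. Re (X \<omega> $$ (j, j))) (\<lambda>x. ennreal (normal_density 0 (sqrt (1 / real N)) x))"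
    using g by (elim conjE)
  show "j < N \<Longrightarrow> distributed M lborel (\<lambda>\<omega>. Re (X \<omega> $$ (j, j))) (\<lambda>x. ennreal (normal_density 0 (sqrt (1 / real N)) x))"
    by (rule d[rule_format])
  have o: "\<forall>k<N. \<forall>j<k.
        prob_space.indep_var M
          borel (\<lambda>\<omega>. Re (X \<omega> $$ (j, k))) borel (\<lambda>\<omega>. Im (X \<omega> $$ (j, k))) \<and>
        distributed M lborel (\<lambda>\<omega>. Re (X \<omega> $$ (j, k)))
          (\<lambda>x. ennreal (normal_density 0 (sqrt (1 / (2 * real N))) x)) \<and>
        distributed M lborel (\<lambda>\<omega>. Im (X \<omega> $$ (j, k)))
          (\<lambda>x. ennreal (normal_density 0 (sqrt (1 / (2 * real N))) x))"
    using g by (elim conjE)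
  show "k < N \<Longrightarrow> j < k \<Longrightarrow> prob_space.indep_var M borel (\<lambda>\<omega>. Re (X \<omega> $$ (j, k))) borel (\<lambda>\<omega>. Im (X \<omega> $$ (j, k)))"
    by (rule o[rule_format, THEN conjunct1])
  show "k < N \<Longrightarrow> j < k \<Longrightarrow> distributed M lborel (\<lambda>\<omega>. Re (X \<omega> $$ (j, k))) (\<lambda>x. ennreal (normal_density 0 (sqrt (1 / (2 * real N))) x))"
    by (rule o[rule_format, THEN conjunct2, THEN conjunct1])
  show "k < N \<Longrightarrow> j < k \<Longrightarrow> distributed M lborel (\<lambda>\<omega>. Im (X \<omega> $$ (j, k))) (\<lambda>x. ennreal (normal_density 0 (sqrt (1 / (2 * real N))) x))"
    by (rule o[rule_format, THEN conjunct2, THEN conjunct2])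
qed

text \<open>Joint moments factor over the independent upper-triangular entries, and within an
  off-diagonal entry over its real and imaginary parts.\<close>

lemma GUE_gauss_family:
  assumes N: "N \<ge> 1" and gue: "GUE M N X"
  shows "gauss_family M (gue_index N) (gue_coord X) (gue_var N)"
proof
  interpret prob_space M by (rule GUE_D(1)[OF gue])
  let ?P = "{(j, k). j \<le> k \<and> k < N}"
  note indep = GUE_D(4)[OF gue]
  show "finite (gue_index N)" unfolding gue_index_def by (intro finite_cartesian_product finite_pairs) simp
  fix e :: "(nat \<times> nat) \<times> bool \<Rightarrow> nat"
  have "has_bochner_integral M (\<lambda>\<omega>. \<Prod>p\<in>?P. Im (X \<omega> $$ p) ^ e (p, True) * Re (X \<omega> $$ p) ^ e (p, False))
      (\<Prod>p\<in>?P. gauss_moment (gue_var N (p, True)) (e (p, True)) * gauss_moment (gue_var N (p, False)) (e (p, False)))"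
  proof (intro has_bochner_integral_indep_vars_prod finite_pairs)
    show "indep_vars (\<lambda>_. borel) (\<lambda>p \<omega>. Im (X \<omega> $$ p) ^ e (p, True) * Re (X \<omega> $$ p) ^ e (p, False)) ?P"
      using indep_vars_compose2[OF indep, of "\<lambda>p x. Im x ^ e (p, True) * Re x ^ e (p, False)" "\<lambda>_. borel"] by simp
    fix p assume p: "p \<in> ?P"
    obtain j k where jk: "p = (j, k)" "j \<le> k" "k < N" using p by auto
    show "has_bochner_integral M (\<lambda>\<omega>. Im (X \<omega> $$ p) ^ e (p, True) * Re (X \<omega> $$ p) ^ e (p, False))
      (gauss_moment (gue_var N (p, True)) (e (p, True)) * gauss_moment (gue_var N (p, False)) (e (p, False)))"
    proof (cases "j = k")
      case True
      have d: "distributed M lborel (\<lambda>\<omega>. Re (X \<omega> $$ (j, j))) (\<lambda>x. ennreal (normal_density 0 (sqrt (1 / real N)) x))"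
        using GUE_D(5)[OF gue] jk by simp
      \<comment> \<open>The imaginary part vanishes on the diagonal; 0^0 = 1 keeps the formula right
        for exponent zero and matches \<open>gauss_moment_0\<close>.\<close>
      have "has_bochner_integral M (\<lambda>\<omega>. 0 ^ e (p, True) * Re (X \<omega> $$ p) ^ e (p, False))
        (0 ^ e (p, True) * gauss_moment (1 / real N) (e (p, False)))"
        using distributed_normal_moment[OF d] N jk True by (intro has_bochner_integral_mult_right) auto
      moreover have "Im (X \<omega> $$ p) = 0" if "\<omega> \<in> space M" for \<omega>
        using arg_cong[OF GUE_D(3)[OF gue that, of j j], of Im] jk True by simp
      ultimately show ?thesis using jk True
        by (subst has_bochner_integral_cong[OF refl _ refl, where g = "\<lambda>\<omega>. 0 ^ e (p, True) * Re (X \<omega> $$ p) ^ e (p, False)"])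
          (auto simp: gue_var_def gauss_moment_0 power_0_left split: if_splits)
    next
      case False
      then have lt: "j < k" using jk by simp
      have d: "distributed M lborel (\<lambda>\<omega>. Re (X \<omega> $$ p)) (\<lambda>x. ennreal (normal_density 0 (sqrt (1 / (2 * real N))) x))"
        "distributed M lborel (\<lambda>\<omega>. Im (X \<omega> $$ p)) (\<lambda>x. ennreal (normal_density 0 (sqrt (1 / (2 * real N))) x))"
        "indep_var borel (\<lambda>\<omega>. Re (X \<omega> $$ p)) borel (\<lambda>\<omega>. Im (X \<omega> $$ p))"
        unfolding jk(1) by (rule GUE_D(7)[OF gue jk(3) lt] GUE_D(8)[OF gue jk(3) lt] GUE_D(6)[OF gue jk(3) lt])+
      have m: "has_bochner_integral M (\<lambda>\<omega>. Re (X \<omega> $$ p) ^ n) (gauss_moment (1 / (2 * real N)) n)"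
        "has_bochner_integral M (\<lambda>\<omega>. Im (X \<omega> $$ p) ^ n) (gauss_moment (1 / (2 * real N)) n)" for n
        using distributed_normal_moment[OF d(1), of n] distributed_normal_moment[OF d(2), of n] N by auto
      have iv: "indep_var borel (\<lambda>\<omega>. Re (X \<omega> $$ p) ^ n) borel (\<lambda>\<omega>. Im (X \<omega> $$ p) ^ m)" for n m
        using indep_var_compose[OF d(3), of "\<lambda>x. x ^ n" borel "\<lambda>x. x ^ m" borel] by (simp add: comp_def)
      have "has_bochner_integral M (\<lambda>\<omega>. Re (X \<omega> $$ p) ^ e (p, False) * Im (X \<omega> $$ p) ^ e (p, True))
        (gauss_moment (1 / (2 * real N)) (e (p, False)) * gauss_moment (1 / (2 * real N)) (e (p, True)))"
        using indep_var_integrable[OF iv] indep_var_lebesgue_integral[OF iv] m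
        by (simp add: has_bochner_integral_iff)
      then show ?thesis using jk False by (simp add: gue_var_def mult.commute)
    qed
  qed
  moreover have "(\<Prod>x\<in>gue_index N. f x) = (\<Prod>p\<in>?P. f (p, True) * f (p, False) :: real)" for f
    unfolding gue_index_def prod.cartesian_product' by (simp add: UNIV_bool mult.commute)
  ultimately show "has_bochner_integral M (\<lambda>\<omega>. \<Prod>j\<in>gue_index N. gue_coord X j \<omega> ^ e j)
      (\<Prod>j\<in>gue_index N. gauss_moment (gue_var N j) (e j))"
    by (simp add: gue_coord_def)
qed

lemma GUE_gauss_hermitian:
  assumes N: "N \<ge> 1" and gue: "GUE M N X"
  shows "gauss_hermitian M (gue_index N) (gue_coord X) (gue_var N) N gue_co"
    and "\<omega> \<in> space M \<Longrightarrow> gauss_hermitian.Y (gue_index N) (gue_coord X) N gue_co \<omega> = X \<omega>"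
proof -
  interpret gauss_family M "gue_index N" "gue_coord X" "gue_var N"
    by (rule GUE_gauss_family[OF assms])
  show gh: "gauss_hermitian M (gue_index N) (gue_coord X) (gue_var N) N gue_co"
  proof
    show "N > 0" using N by simp
    fix a b c d assume abcd: "a < N" "b < N" "c < N" "d < N"
    have "cov (gue_co a b) (gue_co c d) =
      (\<Sum>p\<in>{(j, k). j \<le> k \<and> k < N}. if p = (min a b, max a b) then (if a = d \<and> b = c then 1 / of_nat N else 0) else 0)"
      unfolding cov_def sum_gue_index
    proof (intro sum.cong refl)
      fix p :: "nat \<times> nat" assume "p \<in> {(j, k). j \<le> k \<and> k < N}"
      show "complex_of_real (gue_var N (p, True)) * gue_co a b (p, True) * gue_co c d (p, True) +
          complex_of_real (gue_var N (p, False)) * gue_co a b (p, False) * gue_co c d (p, False) =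
        (if p = (min a b, max a b) then (if a = d \<and> b = c then 1 / of_nat N else 0) else 0)"
      proof (cases "p = (min a b, max a b)")
        case True
        show ?thesis
          unfolding True
          by (cases a b rule: linorder_cases; cases c d rule: linorder_cases)
            (auto simp: gue_co_def gue_var_def)
      qed (simp add: gue_co_def)
    qed
    then show "cov (gue_co a b) (gue_co c d) = (if a = d \<and> b = c then 1 / of_nat N else 0)"
      unfolding sum_pairs_delta[OF abcd(1,2)] .
  qed
  interpret gauss_hermitian M "gue_index N" "gue_coord X" "gue_var N" N gue_co by (rule gh)
  assume \<omega>: "\<omega> \<in> space M"
  show "Y \<omega> = X \<omega>"
  proof (rule eq_matI)
    have c: "X \<omega> \<in> carrier_mat N N" by (rule GUE_D(2)[OF gue \<omega>])
    then show "dim_row (Y \<omega>) = dim_row (X \<omega>)" "dim_col (Y \<omega>) = dim_col (X \<omega>)" by (auto simp: Y_def)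
    fix a b assume "a < dim_row (X \<omega>)" "b < dim_col (X \<omega>)"
    then have ab: "a < N" "b < N" using c by auto
    note herm = GUE_D(3)[OF gue \<omega>]
    have "lin (gue_co a b) \<omega> = (\<Sum>p\<in>{(j, k). j \<le> k \<and> k < N}. if p = (min a b, max a b) then X \<omega> $$ (a, b) else 0)"
      unfolding lin_def sum_gue_index
    proof (intro sum.cong refl)
      fix p assume "p \<in> {(j, k). j \<le> k \<and> k < N}"
      show "gue_co a b (p, True) * complex_of_real (gue_coord X (p, True) \<omega>) + gue_co a b (p, False) * complex_of_real (gue_coord X (p, False) \<omega>)
        = (if p = (min a b, max a b) then X \<omega> $$ (a, b) else 0)"
      proof (cases "p = (min a b, max a b)")
        case True
        consider "a < b" | "a = b" | "b < a" by linarith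
        then show ?thesis
        proof cases
          case 3
          then show ?thesis using True arg_cong[OF herm[OF ab], of Re] arg_cong[OF herm[OF ab], of Im]
            by (simp add: gue_co_def gue_coord_def complex_eq_iff min_def max_def)
        next
          case 2
          then show ?thesis using True arg_cong[OF herm[OF ab], of Im] by (simp add: gue_co_def gue_coord_def complex_eq_iff)
        qed (use True in \<open>simp add: gue_co_def gue_coord_def complex_eq_iff min_def max_def\<close>)
      qed (simp add: gue_co_def)
    qed
    then show "Y \<omega> $$ (a, b) = X \<omega> $$ (a, b)"
      unfolding sum_pairs_delta[OF ab] using ab by (simp add: Y_def)
  qed
qed

section \<open>Densities determined by their integrals over intervals\<close>

lemma sets_borel_intervals: "sets borel = sigma_sets UNIV (range (\<lambda>(a, b). {a<..<b :: real}))"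
proof -
  have "sets (borel :: real measure) = sets (sigma UNIV (range (\<lambda>(a, b). box a b :: real set)))"
    using borel_eq_box[where 'a = real] by simp
  then show ?thesis by (simp add: box_real)
qed

lemma Int_stable_intervals: "Int_stable (range (\<lambda>(a, b). {a<..<b :: real}))"
proof (rule Int_stableI)
  fix A B assume "A \<in> range (\<lambda>(a, b). {a<..<b :: real})" "B \<in> range (\<lambda>(a, b). {a<..<b :: real})"
  then obtain a b c d where "A = {a<..<b}" "B = {c<..<d}" by auto
  then have "A \<inter> B = (\<lambda>(a, b). {a<..<b}) (max a c, min b d)" by auto
  then show "A \<inter> B \<in> range (\<lambda>(a, b). {a<..<b :: real})" by blast
qed

text \<open>\<open>p\<close> is controlled only on bounded intervals. On each window
  \<open>I m\<close> it is integrable, and Dynkin's argument extends the identity with the measure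
  to Borel subsets. On the part of the window where \<open>p\<close> is negative the integral of
  \<open>- p\<close> is nonnegative and equals minus a measure, so that part is a null set.\<close>

lemma interval_density_AE_nonneg:
  fixes p :: "real \<Rightarrow> real"
  assumes fin: "finite_measure \<nu>" and sets: "sets \<nu> = sets borel"
    and int: "\<And>a b. a < b \<Longrightarrow> set_integrable lborel {a<..<b} p"
    and eq: "\<And>a b. a < b \<Longrightarrow> measure \<nu> {a<..<b} = (LINT x:{a<..<b}|lborel. p x)"
  shows "p \<in> borel_measurable borel" and "AE x in lborel. 0 \<le> p x" and "\<nu> = density lborel (\<lambda>x. ennreal (p x))"
proof -
  interpret finite_measure \<nu> by (rule fin)
  have sp: "space \<nu> = UNIV" using sets_eq_imp_space_eq[OF sets] by simp
  define I where "I m = {- (real m + 1)<..<real m + 1}" for m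
  have I_int: "set_integrable lborel (I m) p" for m unfolding I_def by (rule int) simp
  have I_ev: "\<forall>\<^sub>F m in sequentially. x \<in> I m" for x
  proof -
    obtain n where "\<bar>x\<bar> < real n" using reals_Archimedean2 by blast
    then show ?thesis by (intro eventually_sequentiallyI[of n]) (auto simp: I_def)
  qed
  show p: "p \<in> borel_measurable borel"
  proof (rule borel_measurable_LIMSEQ_real)
    show "(\<lambda>m. indicator (I m) x * p x) \<longlonglongrightarrow> p x" for x
      by (rule tendsto_eventually) (use I_ev[of x] in \<open>eventually_elim, simp\<close>)
    show "(\<lambda>x. indicator (I m) x * p x) \<in> borel_measurable borel" for m
      using borel_measurable_integrable[OF I_int[of m, unfolded set_integrable_def]] by simp
  qed
  have key: "(LINT x:A \<inter> I m|lborel. p x) = measure \<nu> (A \<inter> I m)" if "A \<in> sets borel" for A m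
  proof -
    have sub: "set_integrable lborel (B \<inter> I m) p" if "B \<in> sets borel" for B
      by (rule set_integrable_subset[OF I_int]) (use that in \<open>auto simp: I_def\<close>)
    have Im: "(LINT x:I m|lborel. p x) = measure \<nu> (I m)"
      unfolding I_def by (rule eq[symmetric]) simp
    have bor: "sets borel = sigma_sets UNIV (range (\<lambda>(a, b). {a<..<b :: real}))"
      by (rule sets_borel_intervals)
    have "Int_stable (range (\<lambda>(a, b). {a<..<b :: real}))" by (rule Int_stable_intervals)
    moreover have "range (\<lambda>(a, b). {a<..<b :: real}) \<subseteq> Pow UNIV" by simp
    moreover have "A \<in> sigma_sets UNIV (range (\<lambda>(a, b). {a<..<b :: real}))" using that bor by simp
    ultimately show ?thesis
    proof (induction rule: sigma_sets_induct_disjoint)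
      case (basic A)
      then obtain a b where A: "A = {a<..<b}" by auto
      have AI: "A \<inter> I m = {max a (- (real m + 1))<..<min b (real m + 1)}" unfolding A I_def by auto
      show ?case
      proof (cases "max a (- (real m + 1)) < min b (real m + 1)")
        case True
        then show ?thesis unfolding AI by (rule eq[symmetric])
      next
        case False
        then have "A \<inter> I m = {}" unfolding AI by (auto simp del: max_less_iff_conj min_less_iff_conj)
        then show ?thesis by (simp add: set_lebesgue_integral_def)
      qed
    next
      case empty
      show ?case by (simp add: set_lebesgue_integral_def)
    next
      case (compl A)
      have Ab: "A \<in> sets borel" using compl bor by simp
      have d: "(UNIV - A) \<inter> I m = I m - A \<inter> I m" by auto
      have "(LINT x:I m|lborel. p x) = (LINT x:A \<inter> I m|lborel. p x) + (LINT x:(UNIV - A) \<inter> I m|lborel. p x)"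
        by (subst set_integral_Un[symmetric, OF _ sub sub]) (use Ab in \<open>auto simp: Int_Un_distrib2[symmetric]\<close>)
      moreover have "measure \<nu> ((UNIV - A) \<inter> I m) = measure \<nu> (I m) - measure \<nu> (A \<inter> I m)"
        unfolding d by (rule finite_measure_Diff) (use Ab sets in \<open>auto simp: I_def\<close>)
      ultimately show ?case using compl Im by simp
    next
      case (union A)
      have Ab: "A i \<in> sets borel" for i using union bor by auto
      have disj: "disjoint_family (\<lambda>i. A i \<inter> I m)" using union by (auto simp: disjoint_family_on_def)
      have U: "(\<Union>i. A i) \<inter> I m = (\<Union>i. A i \<inter> I m)" by auto
      have "(LINT x:(\<Union>i. A i \<inter> I m)|lborel. p x) = (\<Sum>i. LINT x:A i \<inter> I m|lborel. p x)"
        by (rule lebesgue_integral_countable_add)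
          (use Ab disj sub[of "\<Union>i. A i"] U in \<open>auto simp: disjoint_family_on_def I_def\<close>)
      also have "\<dots> = (\<Sum>i. measure \<nu> (A i \<inter> I m))" using union by simp
      also have "\<dots> = measure \<nu> (\<Union>i. A i \<inter> I m)"
        by (rule sums_unique[symmetric, OF finite_measure_UNION]) (use Ab disj sets in \<open>auto simp: I_def\<close>)
      finally show ?case unfolding U .
    qed
  qed
  have "AE x in lborel. x \<in> I m \<longrightarrow> 0 \<le> p x" for m
  proof -
    let ?A = "{x. p x < 0}"
    have A: "?A \<in> sets borel" using p by measurable
    have i: "integrable lborel (\<lambda>x. indicator (?A \<inter> I m) x * - p x)"
      using set_integrable_subset[OF I_int, of "?A \<inter> I m"] A by (auto simp: set_integrable_def I_def)
    have "(LINT x|lborel. indicator (?A \<inter> I m) x * - p x) = - measure \<nu> (?A \<inter> I m)"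
      using key[OF A, of m] by (simp add: set_lebesgue_integral_def)
    moreover have "(LINT x|lborel. indicator (?A \<inter> I m) x * - p x) \<ge> 0"
      by (intro integral_nonneg_AE AE_I2) (auto simp: indicator_def)
    ultimately have "(LINT x|lborel. indicator (?A \<inter> I m) x * - p x) = 0"
      using measure_nonneg[of \<nu> "?A \<inter> I m"] by linarith
    then have "AE x in lborel. indicator (?A \<inter> I m) x * - p x = 0"
      by (subst (asm) integral_nonneg_eq_0_iff_AE[OF i]) (auto simp: indicator_def)
    then show ?thesis by eventually_elim (auto simp: indicator_def split: if_splits)
  qed
  then have "AE x in lborel. \<forall>m. x \<in> I m \<longrightarrow> 0 \<le> p x" unfolding AE_all_countable by blast
  then show nn: "AE x in lborel. 0 \<le> p x"
  proof eventually_elim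
    case (elim x)
    then show ?case using I_ev[of x] by (metis eventually_sequentially order_refl)
  qed
  show "\<nu> = density lborel (\<lambda>x. ennreal (p x))"
  proof (rule measure_eqI_generator_eq[where \<Omega> = UNIV and E = "range (\<lambda>(a, b). {a<..<b :: real})" and A = I])
    show "Int_stable (range (\<lambda>(a, b). {a<..<b :: real}))" by (rule Int_stable_intervals)
    fix X assume "X \<in> range (\<lambda>(a, b). {a<..<b :: real})"
    then obtain a b where X: "X = {a<..<b}" by auto
    show "emeasure \<nu> X = emeasure (density lborel (\<lambda>x. ennreal (p x))) X"
    proof (cases "a < b")
      case True
      have "emeasure (density lborel (\<lambda>x. ennreal (p x))) X = (\<integral>\<^sup>+x. ennreal (indicator X x * p x) \<partial>lborel)"
        using p by (subst emeasure_density) (auto simp: X indicator_def intro!: nn_integral_cong)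
      also have "\<dots> = ennreal (LINT x|lborel. indicator X x * p x)"
        by (rule nn_integral_eq_integral)
          (use int[OF True] nn in \<open>auto simp: X set_integrable_def indicator_def elim!: eventually_mono\<close>)
      also have "\<dots> = ennreal (measure \<nu> X)" using eq[OF True] by (simp add: X set_lebesgue_integral_def)
      finally show ?thesis by (simp add: emeasure_eq_measure)
    next
      case False
      then have "X = {}" by (auto simp: X)
      then show ?thesis by simp
    qed
  next
    show "range I \<subseteq> range (\<lambda>(a, b). {a<..<b :: real})" by (auto simp: I_def)
    show "(\<Union>i. I i) = UNIV"
      using eventually_happens'[OF sequentially_bot I_ev] by auto
    show "emeasure \<nu> (I i) \<noteq> \<infinity>" for i by simp
  qed (auto simp: sets sets_borel_intervals[symmetric])
qed

text \<open>Meant for eigenvalues, whose power sums are traces. Polynomials approximate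
  \<open>f\<close> on growing intervals, and every point lies in all but finitely many of them, so
  the approximation converges pointwise.\<close>

lemma borel_measurable_sum_of_continuous:
  fixes eig :: "nat \<Rightarrow> 'a \<Rightarrow> real"
  assumes pw: "\<And>n. (\<lambda>\<omega>. \<Sum>j<N. eig j \<omega> ^ n) \<in> borel_measurable M"
    and f: "continuous_on UNIV f"
  shows "(\<lambda>\<omega>. \<Sum>j<N. f (eig j \<omega>) :: real) \<in> borel_measurable M"
proof -
  have "\<exists>g. real_polynomial_function g \<and> (\<forall>x\<in>{- real m..real m}. \<bar>f x - g x\<bar> < 1 / real (Suc m))" for m
  proof -
    have "continuous_on {- real m..real m} f" using continuous_on_subset[OF f] by blast
    then obtain g where "real_polynomial_function g" "\<And>x. x \<in> {- real m..real m} \<Longrightarrow> \<bar>f x - g x\<bar> < 1 / real (Suc m)"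
      using Stone_Weierstrass_real_polynomial_function[of "{- real m..real m}" f "1 / real (Suc m)"]
      by (metis compact_Icc of_nat_0_less_iff zero_less_Suc zero_less_divide_1_iff)
    then show ?thesis by blast
  qed
  then obtain g where g: "\<And>m. real_polynomial_function (g m)"
    "\<And>m x. x \<in> {- real m..real m} \<Longrightarrow> \<bar>f x - g m x\<bar> < 1 / real (Suc m)"
    by metis
  have lim: "(\<lambda>m. g m x) \<longlonglongrightarrow> f x" for x
  proof -
    obtain n where n: "\<bar>x\<bar> < real n" using reals_Archimedean2 by blast
    have "\<forall>\<^sub>F m in sequentially. norm (g m x - f x) \<le> 1 / real (Suc m)"
    proof (intro eventually_sequentiallyI[of n])
      fix m assume "n \<le> m"
      then have "x \<in> {- real m..real m}" using n by auto
      then show "norm (g m x - f x) \<le> 1 / real (Suc m)" using g(2)[of x m] by (simp add: abs_minus_commute)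
    qed
    moreover have "(\<lambda>m. 1 / real (Suc m)) \<longlonglongrightarrow> 0" by (rule LIMSEQ_Suc[OF lim_1_over_n])
    ultimately have "(\<lambda>m. g m x - f x) \<longlonglongrightarrow> 0" by (rule Lim_null_comparison)
    then show ?thesis by (simp add: LIM_zero_iff)
  qed
  have meas: "(\<lambda>\<omega>. \<Sum>j<N. g m (eig j \<omega>)) \<in> borel_measurable M" for m
  proof -
    obtain a n where "g m = (\<lambda>x. \<Sum>i\<le>n. a i * x ^ i)"
      using g(1)[of m] unfolding real_polynomial_function_iff_sum by blast
    then have "(\<Sum>j<N. g m (eig j \<omega>)) = (\<Sum>i\<le>n. a i * (\<Sum>j<N. eig j \<omega> ^ i))" for \<omega>
      by (simp add: sum_distrib_left sum.swap[of _ "{..n}"])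
    then show ?thesis using pw by simp
  qed
  show ?thesis
    by (rule borel_measurable_LIMSEQ_real[where u = "\<lambda>m \<omega>. \<Sum>j<N. g m (eig j \<omega>)", OF _ meas]) (intro tendsto_sum lim)
qed

text \<open>The number of values at most \<open>x\<close> is a limit of sums of the continuous
  cutoffs \<open>f m\<close>; in a sorted list the entry with index \<open>k\<close>, counted from
  0, is at most \<open>x\<close> iff at least \<open>k + 1\<close> entries are.\<close>

lemma borel_measurable_order_statistic:
  fixes eig :: "nat \<Rightarrow> 'a \<Rightarrow> real"
  assumes pw: "\<And>n. (\<lambda>\<omega>. \<Sum>j<N. eig j \<omega> ^ n) \<in> borel_measurable M"
    and sorted: "\<And>i j \<omega>. \<omega> \<in> space M \<Longrightarrow> i \<le> j \<Longrightarrow> j < N \<Longrightarrow> eig i \<omega> \<le> eig j \<omega>"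
    and k: "k < N"
  shows "eig k \<in> borel_measurable M"
proof (rule borel_measurable_iff_le[THEN iffD2], intro allI)
  fix x :: real
  define f where "f m t = max 0 (min 1 (1 - real m * (t - x)))" for m t
  have lim: "(\<lambda>m. f m t) \<longlonglongrightarrow> (if t \<le> x then 1 else 0)" for t
  proof (cases "t \<le> x")
    case True
    then have "f m t = 1" for m by (simp add: f_def min_def mult_nonneg_nonpos)
    then show ?thesis using True by simp
  next
    case False
    obtain n where n: "1 / (t - x) < real n" using reals_Archimedean2 by blast
    have "f m t = 0" if "m \<ge> n" for m
    proof -
      have "1 / (t - x) < real m" using n that by linarith
      then have "1 < real m * (t - x)" using False by (simp add: field_simps)
      then show ?thesis by (simp add: f_def)
    qed
    then have "(\<lambda>m. f m t) \<longlonglongrightarrow> 0"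
      by (intro tendsto_eventually eventually_sequentiallyI[of n]) auto
    then show ?thesis using False by simp
  qed
  have "(\<lambda>\<omega>. \<Sum>j<N. f m (eig j \<omega>)) \<in> borel_measurable M" for m
    unfolding f_def by (intro borel_measurable_sum_of_continuous[OF pw] continuous_intros)
  then have c: "(\<lambda>\<omega>. \<Sum>j<N. if eig j \<omega> \<le> x then 1 else 0 :: real) \<in> borel_measurable M"
    by (rule borel_measurable_LIMSEQ_real[where u = "\<lambda>m \<omega>. \<Sum>j<N. f m (eig j \<omega>)", rotated]) (intro tendsto_sum lim)
  have iff: "eig k \<omega> \<le> x \<longleftrightarrow> real (Suc k) \<le> (\<Sum>j<N. if eig j \<omega> \<le> x then 1 else 0)" if \<omega>: "\<omega> \<in> space M" for \<omega>
  proof -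
    have s: "(\<Sum>j<N. if eig j \<omega> \<le> x then 1 else 0 :: real) = real (card {j\<in>{..<N}. eig j \<omega> \<le> x})"
      by (simp add: sum.If_cases Int_def)
    show ?thesis
    proof
      assume "eig k \<omega> \<le> x"
      then have "{..k} \<subseteq> {j\<in>{..<N}. eig j \<omega> \<le> x}" using sorted[OF \<omega>, of _ k] k by fastforce
      from card_mono[OF _ this] show "real (Suc k) \<le> (\<Sum>j<N. if eig j \<omega> \<le> x then 1 else 0)"
        unfolding s by simp
    next
      assume le: "real (Suc k) \<le> (\<Sum>j<N. if eig j \<omega> \<le> x then 1 else 0)"
      show "eig k \<omega> \<le> x"
      proof (rule ccontr)
        assume "\<not> eig k \<omega> \<le> x"
        then have "j < k" if "j < N" "eig j \<omega> \<le> x" for j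
          using sorted[OF \<omega>, of k j] that by linarith
        then have "{j\<in>{..<N}. eig j \<omega> \<le> x} \<subseteq> {..<k}" by auto
        from card_mono[OF _ this] show False using le unfolding s by simp
      qed
    qed
  qed
  have "{\<omega> \<in> space M. eig k \<omega> \<le> x} = {\<omega> \<in> space M. real (Suc k) \<le> (\<Sum>j<N. if eig j \<omega> \<le> x then 1 else 0)}"
    using iff by blast
  also have "\<dots> \<in> sets M" using c by measurable
  finally show "{\<omega> \<in> space M. eig k \<omega> \<le> x} \<in> sets M" .
qed

lemma hermitian_eigenvalues_props:
  fixes A :: "complex mat"
  assumes A: "A \<in> carrier_mat N N" and h: "\<And>j k. j < N \<Longrightarrow> k < N \<Longrightarrow> A $$ (j, k) = cnj (A $$ (k, j))"
  shows "length (hermitian_eigenvalues A) = N" "sorted (hermitian_eigenvalues A)"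
    and "complex_of_real (\<Sum>j<N. (hermitian_eigenvalues A ! j) ^ n) = fps_nth (trace_fps N A) n"
proof -
  let ?L = "hermitian_eigenvalues A"
  have m: "mset ?L = image_mset Re (proots (char_poly A))" by (simp add: hermitian_eigenvalues_def)
  show len: "length ?L = N"
    using arg_cong[OF m, of size] degree_monic_char_poly[OF A] by (simp add: size_proots_complex)
  show "sorted ?L" by (simp add: hermitian_eigenvalues_def)
  have "(\<Sum>j<N. (?L ! j) ^ n) = (\<Sum>x\<in>#mset ?L. x ^ n)"
    by (simp add: len sum_mset_sum_list sum_list_sum_nth atLeast0LessThan flip: mset_map)
  then have "complex_of_real (\<Sum>j<N. (?L ! j) ^ n) = (\<Sum>x\<in>#proots (char_poly A). of_real (Re x ^ n))"
    unfolding m by (simp add: image_mset.compositionality comp_def)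
  also have "\<dots> = (\<Sum>x\<in>#proots (char_poly A). x ^ n)"
  proof -
    have "of_real (Re x ^ n) = x ^ n" if "x \<in># proots (char_poly A)" for x
    proof -
      have "of_real (Re x) = x" using hermitian_eigenvalue_real[OF A h that] by (simp add: complex_eq_iff)
      then show ?thesis by (metis of_real_power)
    qed
    then have "image_mset (\<lambda>x. of_real (Re x ^ n)) (proots (char_poly A)) = image_mset (\<lambda>x. x ^ n) (proots (char_poly A))"
      by (intro image_mset_cong)
    then show ?thesis by simp
  qed
  also have "\<dots> = fps_nth (trace_fps N A) n"
    unfolding trace_fps_def sum_diag_pow_eq_power_sum[OF A] by simp
  finally show "complex_of_real (\<Sum>j<N. (?L ! j) ^ n) = fps_nth (trace_fps N A) n" .
qed

text \<open>The averaged spectral measure: the law of \<open>eig J\<close> for a uniformly distributed index \<open>J\<close>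
  independent of the eigenvalues.\<close>

definition mixture :: "'a measure \<Rightarrow> nat \<Rightarrow> (nat \<Rightarrow> 'a \<Rightarrow> real) \<Rightarrow> real measure" where
  "mixture M N eig = distr (measure_pmf (pmf_of_set {..<N}) \<Otimes>\<^sub>M M) borel
     (\<lambda>(j, \<omega>). if j < N then eig j \<omega> else 0)"

lemma mixture:
  fixes f :: "real \<Rightarrow> real"
  assumes M: "prob_space M" and N: "N > 0" and eig: "\<And>j. j < N \<Longrightarrow> eig j \<in> borel_measurable M"
  shows "prob_space (mixture M N eig)" "sets (mixture M N eig) = sets borel"
    and "f \<in> borel_measurable borel \<Longrightarrow> (\<And>j. j < N \<Longrightarrow> integrable M (\<lambda>\<omega>. f (eig j \<omega>))) \<Longrightarrow>
      integrable (mixture M N eig) f \<and> (LINT t|mixture M N eig. f t) = 1 / real N * (\<Sum>j<N. LINT \<omega>|M. f (eig j \<omega>))"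
proof -
  interpret prob_space M by (rule M)
  let ?K = "measure_pmf (pmf_of_set {..<N})"
  interpret K: pair_prob_space ?K M by standard
  let ?e = "\<lambda>(j, \<omega>). if j < N then eig j \<omega> else 0"
  have fin: "finite {..<N}" "{..<N} \<noteq> {}" using N by auto
  have "(\<lambda>\<omega>. if j < N then eig j \<omega> else 0) \<in> borel_measurable M" for j using eig[of j] by (cases "j < N") auto
  then have me: "?e \<in> borel_measurable (?K \<Otimes>\<^sub>M M)"
    unfolding measurable_cong_sets[OF sets_pair_measure_cong[OF sets_measure_pmf_count_space refl] refl]
    by (intro measurable_pair_measure_countable1) auto
  show "prob_space (mixture M N eig)" unfolding mixture_def by (rule K.prob_space_distr[OF me])
  show "sets (mixture M N eig) = sets borel" by (simp add: mixture_def)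
  assume f: "f \<in> borel_measurable borel" and fi: "\<And>j. j < N \<Longrightarrow> integrable M (\<lambda>\<omega>. f (eig j \<omega>))"
  have fi': "integrable M (\<lambda>\<omega>. f (?e (j, \<omega>)))" for j
    using fi[of j] by (cases "j < N") auto
  have int: "integrable (?K \<Otimes>\<^sub>M M) (\<lambda>x. f (?e x))"
  proof (rule K.Fubini_integrable)
    show "(\<lambda>x. f (?e x)) \<in> borel_measurable (?K \<Otimes>\<^sub>M M)" using measurable_compose[OF me f] .
    show "integrable ?K (\<lambda>x. LINT y|M. norm (f (?e (x, y))))"
      by (rule integrable_measure_pmf_finite) (simp add: fin)
    show "AE x in ?K. integrable M (\<lambda>y. f (?e (x, y)))" using fi' by simp
  qed
  have "(LINT t|mixture M N eig. f t) = (LINT x|(?K \<Otimes>\<^sub>M M). f (?e x))"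
    unfolding mixture_def by (rule integral_distr[OF me f])
  also have "\<dots> = (LINT j|?K. LINT \<omega>|M. f (?e (j, \<omega>)))"
    using K.integral_fst'[OF int] by simp
  also have "\<dots> = (\<Sum>j<N. LINT \<omega>|M. f (?e (j, \<omega>))) / real N"
    by (subst integral_pmf_of_set[OF fin(2,1)]) simp
  finally show "integrable (mixture M N eig) f \<and> (LINT t|mixture M N eig. f t) = 1 / real N * (\<Sum>j<N. LINT \<omega>|M. f (eig j \<omega>))"
    using int integrable_distr_eq[OF me f] unfolding mixture_def by simp
qed

text \<open>Ordered eigenvalues are not polynomials in the entries, but they are needed to form the
  averaged spectral measure. Once that measure is identified as the one with density
  \<open>p\<close>, the recurrence for mean traces becomes one for its moments.\<close>

lemma GUE_density_moments:
  assumes N: "N \<ge> 1" and gue: "GUE M N X" and dens: "mean_eigenvalue_density M N X p"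
  shows "p \<in> borel_measurable borel" "AE x in lborel. 0 \<le> p x"
    and "prob_space (density lborel (\<lambda>x. ennreal (p x)))"
    and "integrable (density lborel (\<lambda>x. ennreal (p x))) (\<lambda>t. t ^ n)"
    and "\<And>k. real k * real (k + 2) * (LINT t|density lborel (\<lambda>x. ennreal (p x)). t ^ k) =
    4 * (if k \<ge> 2 then real k * real (k - 1) * (LINT t|density lborel (\<lambda>x. ennreal (p x)). t ^ (k - 2)) else 0)
    + 1 / (real N)\<^sup>2 * (if k \<ge> 4 then real k * real (k - 1) * real (k - 2) * real (k - 3) *
        (LINT t|density lborel (\<lambda>x. ennreal (p x)). t ^ (k - 4)) else 0)"
proof -
  have Np: "N > 0" using N by simp
  interpret prob_space M by (rule GUE_D(1)[OF gue])
  interpret gauss_hermitian M "gue_index N" "gue_coord X" "gue_var N" N gue_co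
    by (rule GUE_gauss_hermitian(1)[OF assms(1) gue])
  define eig where "eig j \<omega> = hermitian_eigenvalues (X \<omega>) ! j" for j \<omega>
  note Xc = GUE_D(2)[OF gue] and Xh = GUE_D(3)[OF gue]
  note evp = hermitian_eigenvalues_props[OF Xc Xh]
  have tr: "complex_of_real (\<Sum>j<N. eig j \<omega> ^ n) = fps_nth (trace_fps N (Y \<omega>)) n" if "\<omega> \<in> space M" for \<omega> n
    using evp(3)[OF that that] GUE_gauss_hermitian(2)[OF assms(1) gue that] by (simp add: eig_def)
  have psum: "integrable M (\<lambda>\<omega>. \<Sum>j<N. eig j \<omega> ^ n)"
    "complex_of_real (LINT \<omega>|M. (\<Sum>j<N. eig j \<omega> ^ n)) = (LINT \<omega>|M. fps_nth (trace_fps N (Y \<omega>)) n)" for n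
  proof -
    have "integrable M (\<lambda>\<omega>. complex_of_real (\<Sum>j<N. eig j \<omega> ^ n))"
      using poly_rv_integrable[OF poly_rv_trace[of n]] tr by (simp cong: Bochner_Integration.integrable_cong)
    then have "integrable M (\<lambda>\<omega>. Re (complex_of_real (\<Sum>j<N. eig j \<omega> ^ n)))" by (rule integrable_Re)
    then show "integrable M (\<lambda>\<omega>. \<Sum>j<N. eig j \<omega> ^ n)" by simp
    have "complex_of_real (LINT \<omega>|M. (\<Sum>j<N. eig j \<omega> ^ n)) = (LINT \<omega>|M. complex_of_real (\<Sum>j<N. eig j \<omega> ^ n))"
      by (rule integral_complex_of_real[symmetric])
    also have "\<dots> = (LINT \<omega>|M. fps_nth (trace_fps N (Y \<omega>)) n)"
      by (intro Bochner_Integration.integral_cong refl tr)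
    finally show "complex_of_real (LINT \<omega>|M. (\<Sum>j<N. eig j \<omega> ^ n)) = (LINT \<omega>|M. fps_nth (trace_fps N (Y \<omega>)) n)" .
  qed
  have mev: "eig k \<in> borel_measurable M" if "k < N" for k
  proof (rule borel_measurable_order_statistic[OF _ _ that])
    show "(\<lambda>\<omega>. \<Sum>j<N. eig j \<omega> ^ n) \<in> borel_measurable M" for n using psum(1) by (rule borel_measurable_integrable)
    show "eig i \<omega> \<le> eig j \<omega>" if "\<omega> \<in> space M" "i \<le> j" "j < N" for i j \<omega>
      unfolding eig_def by (rule sorted_nth_mono) (use evp(1,2)[OF that(1) that(1)] that in auto)
  qed
  let ?\<nu> = "mixture M N eig"
  note mix = mixture[of M N eig, OF prob_space_axioms Np mev]
  have ev_int: "integrable M (\<lambda>\<omega>. eig j \<omega> ^ n)" if "j < N" for j n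
  proof (rule Bochner_Integration.integrable_bound)
    show "integrable M (\<lambda>\<omega>. 1 + (\<Sum>j<N. eig j \<omega> ^ (2 * n)))" using psum(1) by simp
    show "(\<lambda>\<omega>. eig j \<omega> ^ n) \<in> borel_measurable M" using mev[OF that] by measurable
    \<comment> \<open>A single power is dominated by an even power sum, by |x| \<le> 1 +
      x^2.\<close>
    show "AE \<omega> in M. norm (eig j \<omega> ^ n) \<le> norm (1 + (\<Sum>j<N. eig j \<omega> ^ (2 * n)))"
    proof (rule AE_I2)
      fix \<omega>
      have "\<bar>x\<bar> \<le> 1 + x\<^sup>2" for x :: real
        using sum_squares_bound[of "\<bar>x\<bar>" 1] by simp
      then have "\<bar>eig j \<omega> ^ n\<bar> \<le> 1 + (eig j \<omega> ^ n)\<^sup>2" .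
      also have "(eig j \<omega> ^ n)\<^sup>2 = eig j \<omega> ^ (2 * n)" by (simp add: power_mult[symmetric] mult.commute)
      also have "\<dots> \<le> (\<Sum>j<N. eig j \<omega> ^ (2 * n))"
        using that by (intro member_le_sum) (auto simp: zero_le_even_power)
      finally show "norm (eig j \<omega> ^ n) \<le> norm (1 + (\<Sum>j<N. eig j \<omega> ^ (2 * n)))" by simp
    qed
  qed
  interpret \<nu>: prob_space ?\<nu> by (rule mix(1))
  have ivl: "measure ?\<nu> {a<..<b} = (LINT x:{a<..<b}|lborel. p x)" if "a < b" for a b
  proof -
    have i: "integrable M (\<lambda>\<omega>. indicator {a<..<b} (eig j \<omega>) :: real)" if "j < N" for j
    proof -
      have "(\<lambda>\<omega>. indicator {a<..<b} (eig j \<omega>) :: real) \<in> borel_measurable M"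
        using mev[OF that] by measurable
      then show ?thesis by (intro integrable_const_bound[of _ 1]) auto
    qed
    have "measure ?\<nu> {a<..<b} = (LINT t|?\<nu>. indicator {a<..<b} t)"
      using mix(2) by simp
    also have "\<dots> = 1 / real N * (\<Sum>j<N. LINT \<omega>|M. indicator {a<..<b} (eig j \<omega>))"
      using mix(3)[of "indicator {a<..<b}"] i by simp
    also have "(\<Sum>j<N. LINT \<omega>|M. indicator {a<..<b} (eig j \<omega>)) = (LINT \<omega>|M. (\<Sum>j<N. indicator {a<..<b} (eig j \<omega>) :: real))"
      using i by (subst Bochner_Integration.integral_sum) auto
    also have "1 / real N * (LINT \<omega>|M. (\<Sum>j<N. indicator {a<..<b} (eig j \<omega>) :: real)) = (LINT x:{a<..<b}|lborel. p x)"
      unfolding eig_def using dens that unfolding mean_eigenvalue_density_def by blast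
    finally show ?thesis .
  qed
  have fm: "finite_measure ?\<nu>" by standard simp
  have si: "set_integrable lborel {a<..<b} p" if "a < b" for a b
    using dens that by (simp add: mean_eigenvalue_density_def)
  have dd: "p \<in> borel_measurable borel" "AE x in lborel. 0 \<le> p x" and eq: "?\<nu> = density lborel (\<lambda>x. ennreal (p x))"
    using interval_density_AE_nonneg[of ?\<nu> p] fm mix(2) si ivl by blast+
  show "p \<in> borel_measurable borel" "AE x in lborel. 0 \<le> p x" by (fact dd)+
  show "prob_space (density lborel (\<lambda>x. ennreal (p x)))" using mix(1) unfolding eq .
  have mom: "integrable ?\<nu> (\<lambda>t. t ^ n)" "real N * (LINT t|?\<nu>. t ^ n) = (LINT \<omega>|M. (\<Sum>j<N. eig j \<omega> ^ n))" for n
    using mix(3)[of "\<lambda>t. t ^ n"] ev_int N by simp_all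
  show "integrable (density lborel (\<lambda>x. ennreal (p x))) (\<lambda>t. t ^ n)" using mom(1) unfolding eq .
  fix k
  let ?m = "\<lambda>n. LINT t|?\<nu>. t ^ n"
  have w: "(LINT \<omega>|M. fps_nth (trace_fps N (Y \<omega>)) n) = complex_of_real (real N * ?m n)" for n
    unfolding mom(2) psum(2) ..
  have "complex_of_real (real k * real (k + 2) * (real N * ?m k)) =
    complex_of_real (4 * (if k \<ge> 2 then real k * real (k - 1) * (real N * ?m (k - 2)) else 0)
    + 1 / (real N)\<^sup>2 * (if k \<ge> 4 then real k * real (k - 1) * real (k - 2) * real (k - 3) * (real N * ?m (k - 4)) else 0))"
    using mean_trace_recurrence[of k] unfolding w by (simp del: of_nat_add)
  then have "real k * real (k + 2) * (real N * ?m k) =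
    4 * (if k \<ge> 2 then real k * real (k - 1) * (real N * ?m (k - 2)) else 0)
    + 1 / (real N)\<^sup>2 * (if k \<ge> 4 then real k * real (k - 1) * real (k - 2) * real (k - 3) * (real N * ?m (k - 4)) else 0)"
    unfolding of_real_eq_iff .
  then have "real N * (real k * real (k + 2) * ?m k) = real N * (
    4 * (if k \<ge> 2 then real k * real (k - 1) * ?m (k - 2) else 0)
    + 1 / (real N)\<^sup>2 * (if k \<ge> 4 then real k * real (k - 1) * real (k - 2) * real (k - 3) * ?m (k - 4) else 0))"
    by (simp add: algebra_simps split del: if_split) (simp split: if_splits)
  then have "real k * real (k + 2) * ?m k =
    4 * (if k \<ge> 2 then real k * real (k - 1) * ?m (k - 2) else 0)
    + 1 / (real N)\<^sup>2 * (if k \<ge> 4 then real k * real (k - 1) * real (k - 2) * real (k - 3) * ?m (k - 4) else 0)"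
    using Np by (simp only: mult_cancel_left) simp
  then show "real k * real (k + 2) * (LINT t|density lborel (\<lambda>x. ennreal (p x)). t ^ k) =
    4 * (if k \<ge> 2 then real k * real (k - 1) * (LINT t|density lborel (\<lambda>x. ennreal (p x)). t ^ (k - 2)) else 0)
    + 1 / (real N)\<^sup>2 * (if k \<ge> 4 then real k * real (k - 1) * real (k - 2) * real (k - 3) *
        (LINT t|density lborel (\<lambda>x. ennreal (p x)). t ^ (k - 4)) else 0)" unfolding eq .
qed

section \<open>The semicircle law and the operator \<open>S\<close>\<close>

lemma set_integrable_semicircle:
  fixes f :: "complex \<Rightarrow> complex"
  assumes "continuous_on UNIV f"
  shows "set_integrable lborel {-2..2} (\<lambda>x. f (of_real x) * of_real (sqrt (4 - x\<^sup>2)))"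
  unfolding set_integrable_def
  by (rule borel_integrable_compact) (auto intro!: continuous_intros continuous_on_compose2[OF assms])

lemma semicircle_add:
  assumes "continuous_on UNIV f" "continuous_on UNIV g"
  shows "semicircle (\<lambda>x. f x + g x) = semicircle f + semicircle g"
  unfolding semicircle_def distrib_right
  using set_integral_add(2)[OF set_integrable_semicircle[OF assms(1)] set_integrable_semicircle[OF assms(2)]]
  by (simp add: distrib_left)

lemma semicircle_cmult: "semicircle (\<lambda>x. c * f x) = c * semicircle f"
  unfolding semicircle_def by (simp add: mult.assoc)

abbreviation sc :: "complex poly \<Rightarrow> complex" where "sc p \<equiv> semicircle (poly p)"

lemma continuous_on_poly': "continuous_on A (poly (p :: complex poly))"
  by (intro continuous_intros)

lemma sc_add: "sc (p + q) = sc p + sc q"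
proof -
  have "poly (p + q) = (\<lambda>x. poly p x + poly q x)" by (simp add: fun_eq_iff)
  then show ?thesis using semicircle_add[OF continuous_on_poly' continuous_on_poly', of p q] by (simp only:)
qed

lemma sc_smult: "sc (Polynomial.smult c p) = c * sc p"
proof -
  have "poly (Polynomial.smult c p) = (\<lambda>x. c * poly p x)" by (simp add: fun_eq_iff)
  then show ?thesis using semicircle_cmult[of c "poly p"] by (simp only:)
qed

lemma sc_0: "sc 0 = 0"
  using sc_smult[of 0 0] by simp

lemma sc_diff: "sc (p - q) = sc p - sc q"
  using sc_add[of p "Polynomial.smult (-1) q"] sc_smult[of "-1" q] by simp

lemma sc_sum: "sc (\<Sum>i\<in>I. p i) = (\<Sum>i\<in>I. sc (p i))"
  by (induction I rule: infinite_finite_induct)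
    (simp_all only: sum.infinite sum.empty sum.insert sc_0 sc_add not_False_eq_True)

definition S_op :: "complex poly \<Rightarrow> complex poly" where
  "S_op h = [:-4, 0, 1:] * pderiv h + [:0, 3:] * h"

lemma sqrt_semicircle_deriv:
  assumes "-2 < x" "x < (2 :: real)"
  shows "((\<lambda>x. sqrt (4 - x\<^sup>2)) has_real_derivative - x / sqrt (4 - x\<^sup>2)) (at x)"
proof -
  have "0 < (2 - x) * (2 + x)" using assms by (intro mult_pos_pos) auto
  then have "4 - x\<^sup>2 > 0" by (simp add: algebra_simps power2_eq_square)
  then show ?thesis by (auto intro!: derivative_eq_intros simp: divide_simps)
qed

lemma pos_semicircle: "-2 < x \<Longrightarrow> x < (2 :: real) \<Longrightarrow> 4 - x\<^sup>2 > 0"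
proof -
  assume "-2 < x" "x < 2"
  then have "0 < (2 - x) * (2 + x)" by (intro mult_pos_pos) auto
  then show ?thesis by (simp add: algebra_simps power2_eq_square)
qed

lemma set_lebesgue_integral_FTC:
  fixes F f :: "real \<Rightarrow> complex"
  assumes "a \<le> b" "continuous_on {a..b} F" "continuous_on {a..b} f"
    and "\<And>x. a < x \<Longrightarrow> x < b \<Longrightarrow> (F has_vector_derivative f x) (at x)"
  shows "(LINT x:{a..b}|lborel. f x) = F b - F a"
proof -
  have "(f has_integral (F b - F a)) {a..b}"
    using assms by (intro fundamental_theorem_of_calculus_interior) auto
  moreover have "set_integrable lborel {a..b} f"
    unfolding set_integrable_def using assms(3) by (intro borel_integrable_compact) auto
  ultimately show ?thesis using set_borel_integral_eq_integral(2) by (metis integral_unique)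
qed

text \<open>Times the weight, \<open>S_op h\<close> is the derivative of - (4 - x^2)^(3/2) h, which
  vanishes at both endpoints.\<close>

lemma sc_S_op: "sc (S_op h) = 0"
proof -
  define F where "F x = - (poly h (of_real x) * of_real ((4 - x\<^sup>2) * sqrt (4 - x\<^sup>2)))" for x :: real
  define f where "f x = poly (S_op h) (of_real x) * of_real (sqrt (4 - x\<^sup>2))" for x :: real
  have "(LINT x:{-2..2}|lborel. f x) = F 2 - F (-2)"
  proof (rule set_lebesgue_integral_FTC)
    show "continuous_on {-2..2} F" unfolding F_def by (intro continuous_intros)
    show "continuous_on {-2..2} f" unfolding f_def by (intro continuous_intros)
    fix x :: real assume x: "-2 < x" "x < 2"
    have pos: "4 - x\<^sup>2 > 0" using pos_semicircle[OF x] .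
    have 1: "((\<lambda>x. poly h (of_real x)) has_vector_derivative poly (pderiv h) (of_real x)) (at x)"
      using has_vector_derivative_real_field[OF poly_DERIV[of h "of_real x"]] .
    have "((\<lambda>x. (4 - x\<^sup>2) * sqrt (4 - x\<^sup>2)) has_real_derivative (- (2 * x) * sqrt (4 - x\<^sup>2) + (- x / sqrt (4 - x\<^sup>2)) * (4 - x\<^sup>2))) (at x)"
      by (rule DERIV_mult[OF _ sqrt_semicircle_deriv[OF x]]) (auto intro!: derivative_eq_intros)
    also have "(- x / sqrt (4 - x\<^sup>2)) * (4 - x\<^sup>2) = - x * ((4 - x\<^sup>2) / sqrt (4 - x\<^sup>2))" by simp
    also have "(4 - x\<^sup>2) / sqrt (4 - x\<^sup>2) = sqrt (4 - x\<^sup>2)" using pos by (simp add: real_div_sqrt)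
    also have "- (2 * x) * sqrt (4 - x\<^sup>2) + - x * sqrt (4 - x\<^sup>2) = - 3 * x * sqrt (4 - x\<^sup>2)" by simp
    finally have "((\<lambda>x. of_real ((4 - x\<^sup>2) * sqrt (4 - x\<^sup>2))) has_vector_derivative (of_real (- 3 * x * sqrt (4 - x\<^sup>2)) :: complex)) (at x)"
      by (intro has_vector_derivative_of_real) (simp add: has_real_derivative_iff_has_vector_derivative)
    from has_vector_derivative_minus[OF has_vector_derivative_mult[OF 1 this]]
    have "(F has_vector_derivative - (poly h (of_real x) * of_real (- 3 * x * sqrt (4 - x\<^sup>2)) + poly (pderiv h) (of_real x) * of_real ((4 - x\<^sup>2) * sqrt (4 - x\<^sup>2)))) (at x)"
      unfolding F_def .
    also have "- (poly h (of_real x) * of_real (- 3 * x * sqrt (4 - x\<^sup>2)) + poly (pderiv h) (of_real x) * of_real ((4 - x\<^sup>2) * sqrt (4 - x\<^sup>2))) = f x"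
      unfolding f_def S_op_def by (simp add: algebra_simps power2_eq_square)
    finally show "(F has_vector_derivative f x) (at x)" .
  qed simp
  also have "F 2 - F (-2) = 0" by (simp add: F_def)
  finally show ?thesis by (simp add: semicircle_def f_def)
qed

lemma sc_1: "sc 1 = 1"
proof -
  define F where "F x = complex_of_real (x * sqrt (4 - x\<^sup>2) / 2 + 2 * arcsin (x / 2))" for x :: real
  have "(LINT x:{-2..2}|lborel. of_real (sqrt (4 - x\<^sup>2))) = F 2 - F (-2)"
  proof (rule set_lebesgue_integral_FTC)
    show "continuous_on {-2..2} F" unfolding F_def by (intro continuous_intros) auto
    show "continuous_on {-2..2} (\<lambda>x. complex_of_real (sqrt (4 - x\<^sup>2)))" by (intro continuous_intros)
    fix x :: real assume x: "-2 < x" "x < 2"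
    have pos: "4 - x\<^sup>2 > 0" using pos_semicircle[OF x] .
    have sq: "sqrt (1 - (x / 2)\<^sup>2) = sqrt (4 - x\<^sup>2) / 2"
    proof -
      have "1 - (x / 2)\<^sup>2 = (4 - x\<^sup>2) / 4" by (simp add: power_divide field_simps)
      then show ?thesis by (simp only: real_sqrt_divide) simp
    qed
    have "((\<lambda>x. arcsin (x / 2)) has_real_derivative (1 / 2) * inverse (sqrt (1 - (x / 2)\<^sup>2))) (at x)"
      using x by (auto intro!: derivative_eq_intros)
    then have 2: "((\<lambda>x. arcsin (x / 2)) has_real_derivative 1 / sqrt (4 - x\<^sup>2)) (at x)"
      unfolding sq by (simp add: field_simps)
    have "((\<lambda>x. x * sqrt (4 - x\<^sup>2) / 2 + 2 * arcsin (x / 2)) has_real_derivative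
        (1 * sqrt (4 - x\<^sup>2) + (- x / sqrt (4 - x\<^sup>2)) * x) / 2 + 2 * (1 / sqrt (4 - x\<^sup>2))) (at x)"
      by (intro DERIV_add DERIV_cdivide DERIV_mult DERIV_ident DERIV_cmult sqrt_semicircle_deriv[OF x] 2)
    also have "(1 * sqrt (4 - x\<^sup>2) + (- x / sqrt (4 - x\<^sup>2)) * x) / 2 + 2 * (1 / sqrt (4 - x\<^sup>2)) = sqrt (4 - x\<^sup>2)"
    proof -
      define r where "r = sqrt (4 - x\<^sup>2)"
      have "r > 0" "x * x = 4 - r * r" using pos by (simp_all add: r_def power2_eq_square)
      then have "(1 * r + (- x / r) * x) / 2 + 2 * (1 / r) = r" by (simp add: divide_simps)
      then show ?thesis by (simp add: r_def)
    qed
    finally show "(F has_vector_derivative complex_of_real (sqrt (4 - x\<^sup>2))) (at x)"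
      unfolding F_def by (intro has_vector_derivative_of_real) (simp add: has_real_derivative_iff_has_vector_derivative)
  qed simp
  also have "F 2 - F (-2) = 2 * of_real pi" by (simp add: F_def arcsin_minus)
  finally show ?thesis by (simp add: semicircle_def)
qed

lemma S_op_diff: "S_op (p - q) = S_op p - S_op q"
proof -
  have "a * (p' - q') + b * (p - q) = (a * p' + b * p) - (a * q' + b * q)" for a b p' q' :: "complex poly"
    by (simp add: algebra_simps)
  then show ?thesis unfolding S_op_def pderiv_diff .
qed

lemma S_op_add: "S_op (p + q) = S_op p + S_op q"
proof -
  have "a * (p' + q') + b * (p + q) = (a * p' + b * p) + (a * q' + b * q)" for a b p' q' :: "complex poly"
    by (simp add: algebra_simps)
  then show ?thesis unfolding S_op_def pderiv_add .
qed

lemma S_op_smult: "S_op (Polynomial.smult c p) = Polynomial.smult c (S_op p)"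
  by (simp add: S_op_def pderiv_smult smult_add_right)

text \<open>The leading term c t^n of a polynomial produces the leading term (n + 3) c
  t^(n+1).\<close>

lemma S_op_eq_0_imp: "S_op h = 0 \<Longrightarrow> h = 0"
proof (rule ccontr)
  assume h: "S_op h = 0" "h \<noteq> 0"
  define n where "n = degree h"
  have "S_op h = pCons 0 (pCons 0 (pderiv h)) - Polynomial.smult 4 (pderiv h) + Polynomial.smult 3 (pCons 0 h)"
    by (simp add: S_op_def)
  then have "coeff (S_op h) (Suc n) = coeff (pCons 0 (pderiv h)) n - 4 * coeff (pderiv h) (Suc n) + 3 * coeff h n"
    by simp
  also have "coeff (pCons 0 (pderiv h)) n = of_nat n * coeff h n"
    by (cases n) (simp_all add: coeff_pderiv)
  also have "coeff (pderiv h) (Suc n) = 0"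
    by (simp add: coeff_pderiv n_def coeff_eq_0)
  finally have "(of_nat n + 3) * coeff h n = 0" using h(1) by (simp add: algebra_simps)
  moreover have "(of_nat n + 3 :: complex) \<noteq> 0" 
  proof -
    have "(of_nat (n + 3) :: complex) \<noteq> 0" by (simp only: of_nat_eq_0_iff)
    then show ?thesis by simp
  qed
  moreover have "coeff h n \<noteq> 0" using h(2) by (simp add: n_def)
  ultimately show False by simp
qed

text \<open>The constant is forced to be the semicircle mean by \<open>sc_S_op\<close>, and
  \<open>S_op\<close> is injective; so any decomposition of this form identifies
  \<open>S_poly g\<close>.\<close>

lemma S_poly_eqI:
  assumes "g = [:c:] + S_op h"
  shows "S_poly g = h"
proof -
  have "sc g = sc [:c:] + sc (S_op h)" using assms by (simp only: sc_add)
  then have scg: "sc g = c" using sc_smult[of c "[:1:]"] sc_1[unfolded one_pCons] by (simp add: sc_S_op)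
  have "g = [:sc g:] + [:-4, 0, 1:] * pderiv h + [:0, 3:] * h"
    unfolding scg using assms unfolding S_op_def by (simp only: add.assoc)
  moreover have "h' = h" if "g = [:sc g:] + [:-4, 0, 1:] * pderiv h' + [:0, 3:] * h'" for h'
  proof -
    have "S_op h' = S_op h" using that assms unfolding scg S_op_def by (simp only: add.assoc add_left_cancel)
    then have "S_op (h' - h) = 0" by (simp add: S_op_diff)
    then show ?thesis using S_op_eq_0_imp by force
  qed
  ultimately show ?thesis unfolding S_poly_def by (rule the_equality)
qed


section \<open>Gegenbauer polynomials\<close>

abbreviation gb :: "nat \<Rightarrow> complex poly" where "gb \<equiv> gegenbauer_basis"

definition gb_fps :: "complex poly fps" where "gb_fps = Abs_fps gb"

definition tP :: "complex poly fps" where "tP = 1 - fps_const [:0, 1:] * fps_X + fps_X\<^sup>2"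

text \<open>Substituting t/2 for the variable is a ring homomorphism on the coefficients, hence on
  power series.\<close>

lemma gb_fps_inverse: "tP * (tP * gb_fps) = 1"
proof -
  define \<phi> where "\<phi> F = Abs_fps (\<lambda>n. pcompose (fps_nth F n) [:0, 1/2 :: complex:])" for F
  have mult: "\<phi> (F * G) = \<phi> F * \<phi> G" for F G
    by (rule fps_ext) (simp add: \<phi>_def fps_mult_nth pcompose_sum pcompose_mult)
  have "\<phi> (1 - fps_const [:0, 2:] * fps_X + fps_X\<^sup>2) = tP"
    by (rule fps_ext) (auto simp: \<phi>_def tP_def pcompose_add pcompose_diff pcompose_pCons fps_X_power_iff)
  moreover have "\<phi> 1 = 1" by (rule fps_ext) (auto simp: \<phi>_def)
  moreover have "\<phi> gegenbauer2_gf = gb_fps"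
    by (rule fps_ext) (simp add: \<phi>_def gb_fps_def gegenbauer_basis_def gegenbauer2_def)
  ultimately show ?thesis using arg_cong[OF gegenbauer2_gf_inverse, of \<phi>]
    by (simp add: mult power2_eq_square mult.assoc)
qed

definition cheb_fps :: "complex poly fps" where "cheb_fps = tP * gb_fps"

text \<open>With \<open>U\<^sub>n\<close> the Chebyshev polynomials of the second kind, \<open>cheb n\<close> is \<open>U\<^sub>n(t/2)\<close>.\<close>

definition cheb :: "nat \<Rightarrow> complex poly" where "cheb n = fps_nth cheb_fps n"

definition pX :: "complex poly" where "pX = [:0, 1:]"

lemma cheb_fps: "tP * cheb_fps = 1" "gb_fps = cheb_fps * cheb_fps"
proof -
  show 1: "tP * cheb_fps = 1" using gb_fps_inverse by (simp add: cheb_fps_def)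
  have "cheb_fps * cheb_fps = (tP * cheb_fps) * gb_fps" by (simp add: cheb_fps_def mult_ac)
  then show "gb_fps = cheb_fps * cheb_fps" using 1 by simp
qed

lemma tP_nth: "fps_nth (tP * F) n = fps_nth F n - (if n \<ge> 1 then pX * fps_nth F (n - 1) else 0) + (if n \<ge> 2 then fps_nth F (n - 2) else 0)"
  by (auto simp: tP_def pX_def distrib_right left_diff_distrib mult.assoc fps_X_power_mult_nth)

lemma cheb_0: "cheb 0 = 1" and cheb_1: "cheb (Suc 0) = pX" and cheb_Suc_Suc: "cheb (Suc (Suc n)) = pX * cheb (Suc n) - cheb n"
proof -
  have *: "fps_nth (tP * cheb_fps) n = fps_nth 1 n" for n by (simp add: cheb_fps)
  show 0: "cheb 0 = 1" using *[of 0] unfolding tP_nth by (simp add: cheb_def)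
  show "cheb (Suc 0) = pX" using *[of 1] 0 unfolding tP_nth by (simp add: cheb_def)
  show "cheb (Suc (Suc n)) = pX * cheb (Suc n) - cheb n"
    using *[of "Suc (Suc n)"] unfolding tP_nth by (simp add: cheb_def algebra_simps)
qed

text \<open>Differentiating 1 / (1 - tu + u^2) in t gives u / (1 - tu + u^2)^2.\<close>

lemma pderiv_cheb: "pderiv (cheb (Suc n)) = gb n"
proof -
  define D where "D F = Abs_fps (\<lambda>n. pderiv (fps_nth F n))" for F :: "complex poly fps"
  have mult: "D (F * G) = D F * G + F * D G" for F G
  proof (rule fps_ext)
    fix n
    show "fps_nth (D (F * G)) n = fps_nth (D F * G + F * D G) n"
      unfolding D_def fps_nth_Abs_fps fps_add_nth fps_mult_nth pderiv_sum pderiv_mult sum.distrib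
      by (simp add: mult.commute add.commute)
  qed
  have DP: "D tP = - fps_X"
    by (rule fps_ext) (auto simp: D_def tP_def pderiv_diff pderiv_add pderiv_pCons fps_X_power_iff pderiv_1)
  have "D (tP * cheb_fps) = 0" unfolding cheb_fps by (rule fps_ext) (simp add: D_def pderiv_1)
  then have "cheb_fps * (tP * D cheb_fps - fps_X * cheb_fps) = 0" unfolding mult DP by (simp add: algebra_simps)
  moreover have "cheb_fps * (tP * D cheb_fps - fps_X * cheb_fps) = (tP * cheb_fps) * D cheb_fps - fps_X * gb_fps"
    unfolding cheb_fps(2) by (simp add: algebra_simps)
  ultimately have "D cheb_fps = fps_X * gb_fps" unfolding cheb_fps(1) by simp
  from arg_cong[OF this, of "\<lambda>F. fps_nth F (Suc n)"] show ?thesis by (simp add: D_def cheb_def gb_fps_def)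
qed

lemma deriv_tP: "fps_deriv tP = 2 * fps_X - fps_const pX"
  by (simp add: tP_def pX_def power2_eq_square algebra_simps)

lemma deriv_cheb_fps: "fps_deriv cheb_fps = (fps_const pX - 2 * fps_X) * gb_fps"
proof -
  have "fps_deriv (tP * cheb_fps) = 0" unfolding cheb_fps by simp
  then have a: "tP * fps_deriv cheb_fps + 2 * fps_X * cheb_fps = fps_const pX * cheb_fps"
    unfolding fps_deriv_mult deriv_tP by (simp add: algebra_simps)
  have "fps_deriv cheb_fps = (tP * cheb_fps) * fps_deriv cheb_fps" by (simp add: cheb_fps)
  also have "\<dots> = cheb_fps * (tP * fps_deriv cheb_fps + 2 * fps_X * cheb_fps) - 2 * fps_X * (cheb_fps * cheb_fps)"
    by (simp add: algebra_simps)
  also have "\<dots> = (fps_const pX - 2 * fps_X) * gb_fps"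
    unfolding a cheb_fps(2) by (simp add: algebra_simps)
  finally show ?thesis .
qed

text \<open>Encodes the convention that the Gegenbauer polynomial of index -1 is zero, so that the
  recurrences start at \<open>n = 0\<close>.\<close>

definition gbm :: "nat \<Rightarrow> complex poly" where "gbm n = (if n = 0 then 0 else gb (n - 1))"

text \<open>Applying u d/du + 1 to 1 / (1 - tu + u^2) gives (1 - u^2) / (1 - tu + u^2)^2.\<close>

lemma cheb_gb: "of_nat (n + 1) * cheb n = gb n - (if n \<ge> 2 then gb (n - 2) else 0)"
proof -
  have "fps_X * fps_deriv cheb_fps + cheb_fps = (1 - fps_X\<^sup>2) * gb_fps"
  proof -
    have "cheb_fps = tP * gb_fps" by (simp add: cheb_fps_def)
    then show ?thesis unfolding deriv_cheb_fps by (simp add: tP_def pX_def algebra_simps power2_eq_square)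
  qed
  from arg_cong[OF this, of "\<lambda>F. fps_nth F n"] show ?thesis
    by (cases n) (auto simp: cheb_def gb_fps_def left_diff_distrib fps_X_power_mult_nth fps_X_power_mult_right_nth algebra_simps)
qed

lemma t_mult_gb: "of_nat (n + 2) * (pX * gb n) = of_nat (n + 1) * gb (Suc n) + of_nat (n + 3) * gbm n"
proof -
  have "tP * fps_deriv gb_fps = 2 * (fps_const pX - 2 * fps_X) * gb_fps"
  proof -
    have "tP * fps_deriv gb_fps = 2 * (tP * cheb_fps) * fps_deriv cheb_fps"
      by (subst cheb_fps(2)) (simp add: algebra_simps)
    then show ?thesis unfolding cheb_fps(1) deriv_cheb_fps by (simp add: mult.assoc)
  qed
  from arg_cong[OF this, of "\<lambda>F. fps_nth F n"]
  have "fps_nth (fps_deriv gb_fps) n - (if n \<ge> 1 then pX * fps_nth (fps_deriv gb_fps) (n - 1) else 0)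
    + (if n \<ge> 2 then fps_nth (fps_deriv gb_fps) (n - 2) else 0) = 2 * pX * gb n - 4 * gbm n"
    unfolding tP_nth by (cases n) (simp_all add: gb_fps_def gbm_def algebra_simps numeral_fps_const)
  note * = this
  show ?thesis
  proof (cases n)
    case 0
    then show ?thesis using * by (simp add: gb_fps_def gbm_def)
  next
    case (Suc k)
    then show ?thesis using * by (cases k) (simp_all add: gb_fps_def gbm_def algebra_simps)
  qed
qed

text \<open>Rests on 4 - t^2 = 4 (1 - tu + u^2) - (t - 2u)^2, which turns the product into the
  Chebyshev series and its first derivative in u.\<close>

lemma weight_mult_gb: "(4 - pX\<^sup>2) * gb n = of_nat (n + 3) * cheb n - of_nat (n + 1) * cheb (n + 2)"
proof -
  let ?pX = "fps_const pX"
  have "(4 - ?pX\<^sup>2) * gb_fps = 4 * cheb_fps - (?pX - 2 * fps_X) * fps_deriv cheb_fps"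
  proof -
    have *: "(4 - ?pX\<^sup>2) = 4 * tP - (?pX - 2 * fps_X) * (?pX - 2 * fps_X)"
      by (simp add: tP_def pX_def algebra_simps power2_eq_square)
    show ?thesis unfolding * deriv_cheb_fps unfolding cheb_fps_def by (simp only: left_diff_distrib[of "4 * tP"] mult.assoc)
  qed
  moreover have "4 - ?pX\<^sup>2 = fps_const (4 - pX\<^sup>2)" by (simp add: numeral_fps_const)
  ultimately have "fps_const (4 - pX\<^sup>2) * gb_fps = 4 * cheb_fps - (?pX - 2 * fps_X) * fps_deriv cheb_fps" by (simp only:)
  from arg_cong[OF this, of "\<lambda>F. fps_nth F n"]
  have A: "(4 - pX\<^sup>2) * gb n = 4 * cheb n - (pX * (of_nat (n + 1) * cheb (Suc n)) - 2 * (of_nat n * cheb n))"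
    by (cases n) (simp_all add: gb_fps_def cheb_def left_diff_distrib[of ?pX] numeral_fps_const mult.assoc)
  have "pX * cheb (Suc n) = cheb (n + 2) + cheb n" using cheb_Suc_Suc[of n] by simp
  then have B: "pX * (of_nat (n + 1) * cheb (Suc n)) = of_nat (n + 1) * (cheb (n + 2) + cheb n)"
    by (simp add: mult.left_commute)
  show ?thesis unfolding A B by (simp add: algebra_simps)
qed

text \<open>The reason for using two bases: \<open>S_op\<close> takes each Gegenbauer polynomial to
  a multiple of a single Chebyshev polynomial. Differentiating \<open>weight_mult_gb\<close> and
  using \<open>t_mult_gb\<close> leaves a difference of two Gegenbauer polynomials, which
  \<open>cheb_gb\<close> recognises.\<close>

lemma S_op_gb: "S_op (gb n) = of_nat ((n + 1) * (n + 3)) * cheb (Suc n)"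
proof -
  have pd: "pderiv (cheb n) = gbm n" for n by (cases n) (simp_all add: cheb_0 gbm_def pderiv_cheb pderiv_1)
  have pn: "pderiv (of_nat k * p) = of_nat k * pderiv p" for k and p :: "complex poly"
    by (simp add: of_nat_poly pderiv_smult)
  have "pderiv ((4 - pX\<^sup>2) * gb n) = of_nat (n + 3) * gbm n - of_nat (n + 1) * gb (Suc n)"
    unfolding weight_mult_gb by (simp only: pderiv_diff pn pd) (simp add: gbm_def)
  moreover have "pderiv ((4 - pX\<^sup>2) * gb n) = (4 - pX\<^sup>2) * pderiv (gb n) - 2 * pX * gb n"
  proof -
    have "pderiv pX = 1" "pderiv (4 :: complex poly) = 0"
      by (simp_all add: pX_def pderiv_pCons one_pCons numeral_poly)
    then show ?thesis unfolding pderiv_mult pderiv_diff power2_eq_square by (simp add: algebra_simps)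
  qed
  ultimately have "(4 - pX\<^sup>2) * pderiv (gb n) - 2 * pX * gb n = of_nat (n + 3) * gbm n - of_nat (n + 1) * gb (Suc n)"
    by metis
  then have 1: "(pX\<^sup>2 - 4) * pderiv (gb n) = of_nat (n + 1) * gb (Suc n) - of_nat (n + 3) * gbm n - 2 * pX * gb n"
    by (simp add: algebra_simps)
  have "S_op (gb n) = (pX\<^sup>2 - 4) * pderiv (gb n) + 3 * pX * gb n"
    by (simp add: S_op_def pX_def power2_eq_square numeral_poly)
  also have "\<dots> = pX * gb n + of_nat (n + 1) * gb (Suc n) - of_nat (n + 3) * gbm n"
    unfolding 1 by (simp add: algebra_simps)
  finally have S: "S_op (gb n) = pX * gb n + of_nat (n + 1) * gb (Suc n) - of_nat (n + 3) * gbm n" .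
  have "of_nat (n + 2) * S_op (gb n) = of_nat (n + 2) * (pX * gb n) + of_nat (n + 2) * of_nat (n + 1) * gb (Suc n) - of_nat (n + 2) * of_nat (n + 3) * gbm n"
    unfolding S by (simp only: distrib_left right_diff_distrib mult.assoc)
  also have "\<dots> = of_nat ((n + 1) * (n + 3)) * (gb (Suc n) - gbm n)"
    unfolding t_mult_gb by (simp add: algebra_simps)
  also have "gb (Suc n) - gbm n = of_nat (n + 2) * cheb (Suc n)"
    using cheb_gb[of "Suc n"] by (cases n) (simp_all add: gbm_def)
  finally have "of_nat (n + 2) * S_op (gb n) = of_nat (n + 2) * (of_nat ((n + 1) * (n + 3)) * cheb (Suc n))"
    by (simp only: mult_ac)
  moreover have "(of_nat (n + 2) :: complex poly) \<noteq> 0" by (simp only: of_nat_eq_0_iff)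
  ultimately show ?thesis by (metis mult_cancel_left)
qed

section \<open>\<open>T\<close> on Gegenbauer polynomials\<close>

text \<open>Induction on the degree: up to the factor k + 3, \<open>S_op\<close> of t^k is t^(k+1)
  plus a multiple of t^(k-1).\<close>

lemma S_poly_image: "\<exists>c h. (g :: complex poly) = [:c:] + S_op h"
proof -
  define R where "R = {g. \<exists>c h. (g :: complex poly) = [:c:] + S_op h}"
  have add: "p + q \<in> R" if "p \<in> R" "q \<in> R" for p q
  proof -
    from that obtain c h c' h' where "p = [:c:] + S_op h" "q = [:c':] + S_op h'" by (auto simp: R_def)
    then have "p + q = [:c + c':] + S_op (h + h')" by (simp add: S_op_add)
    then show ?thesis unfolding R_def by blast
  qed
  have smult: "Polynomial.smult a p \<in> R" if "p \<in> R" for a p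
  proof -
    from that obtain c h where "p = [:c:] + S_op h" by (auto simp: R_def)
    then have "Polynomial.smult a p = [:a * c:] + S_op (Polynomial.smult a h)" by (simp add: S_op_smult smult_add_right)
    then show ?thesis unfolding R_def by blast
  qed
  have S: "S_op h \<in> R" for h unfolding R_def by (auto intro!: exI[of _ 0] exI[of _ h])
  have const: "[:c:] \<in> R" for c 
  proof -
    have "[:c:] = [:c:] + S_op 0" by (simp add: S_op_def)
    then show ?thesis unfolding R_def by blast
  qed
  have mon: "monom 1 n \<in> R" for n
  proof (induction n rule: less_induct)
    case (less n)
    show ?case
    proof (cases n)
      case 0
      then show ?thesis using const[of 1] by (simp add: monom_0)
    next
      case (Suc k)
      have "S_op (monom 1 k) = Polynomial.smult (of_nat (k + 3)) (monom 1 (Suc k)) + Polynomial.smult (- 4 * of_nat k) (monom 1 (k - 1))"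
        by (cases k) (simp_all add: S_op_def pderiv_monom poly_eq_iff coeff_pCons algebra_simps split: nat.split)
      moreover have "(of_nat (k + 3) :: complex) \<noteq> 0" by (simp only: of_nat_eq_0_iff)
      ultimately have "monom 1 (Suc k) = Polynomial.smult (1 / of_nat (k + 3)) (S_op (monom 1 k) + Polynomial.smult (4 * of_nat k) (monom 1 (k - 1)))"
        by (simp add: smult_add_right)
      moreover have "Polynomial.smult (4 * of_nat k) (monom 1 (k - 1)) \<in> R"
        using less[of "k - 1"] Suc by (intro smult) auto
      ultimately show ?thesis using add[OF S] smult Suc by metis
    qed
  qed
  have "(\<Sum>i\<in>I. monom (coeff g i) i) \<in> R" for I
  proof (induction I rule: infinite_finite_induct)
    case (insert i I)
    have "monom (coeff g i) i \<in> R" using smult[OF mon, of "coeff g i" i] by (simp add: smult_monom)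
    then show ?case using insert add by simp
  qed (use const[of 0] in simp_all)
  from this[of "{..degree g}"] show ?thesis by (simp add: poly_as_sum_of_monoms R_def)
qed

lemma S_poly_eq: "g = [:sc g:] + S_op (S_poly g)"
proof -
  obtain c h where g: "g = [:c:] + S_op h" using S_poly_image by blast
  have "sc g = sc [:c:] + sc (S_op h)" by (subst g) (simp only: sc_add)
  then have "sc g = c" using sc_smult[of c "[:1:]"] sc_1[unfolded one_pCons] by (simp add: sc_S_op)
  then show ?thesis using g S_poly_eqI[OF g] by simp
qed

lemma S_poly_add: "S_poly (p + q) = S_poly p + S_poly q"
proof (rule S_poly_eqI)
  have "p + q = ([:sc p:] + S_op (S_poly p)) + ([:sc q:] + S_op (S_poly q))" using S_poly_eq by metis
  then show "p + q = [:sc p + sc q:] + S_op (S_poly p + S_poly q)" by (simp add: S_op_add)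
qed

lemma S_poly_smult: "S_poly (Polynomial.smult a p) = Polynomial.smult a (S_poly p)"
proof (rule S_poly_eqI)
  have "Polynomial.smult a p = Polynomial.smult a ([:sc p:] + S_op (S_poly p))" using S_poly_eq by metis
  then show "Polynomial.smult a p = [:a * sc p:] + S_op (Polynomial.smult a (S_poly p))"
    by (simp add: S_op_smult smult_add_right)
qed

lemma T_poly_eq: "T_poly g = pderiv (pderiv (pderiv (S_poly g)))"
  by (simp add: T_poly_def numeral_3_eq_3)

lemma T_poly_add: "T_poly (p + q) = T_poly p + T_poly q"
  by (simp add: T_poly_eq S_poly_add pderiv_add)

lemma T_poly_smult: "T_poly (Polynomial.smult a p) = Polynomial.smult a (T_poly p)"
  by (simp add: T_poly_eq S_poly_smult pderiv_smult)

lemma T_poly_0: "T_poly 0 = 0"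
  using T_poly_smult[of 0 0] by simp

lemma T_poly_sum: "T_poly (\<Sum>i\<in>I. p i) = (\<Sum>i\<in>I. T_poly (p i))"
  by (induction I rule: infinite_finite_induct) (simp_all add: T_poly_0 T_poly_add)

text \<open>Tracks three properties at once: nonnegative Gegenbauer coefficients, indices below
  \<open>n\<close>, and coefficient sum at most \<open>B\<close>. The sum is the bound that
  multiplies under composition of linear maps, see \<open>gcone_linear\<close>.\<close>

definition gcone :: "real \<Rightarrow> nat \<Rightarrow> complex poly \<Rightarrow> bool" where
  "gcone B n p \<longleftrightarrow> (\<exists>c :: nat \<Rightarrow> real. (\<forall>l. 0 \<le> c l) \<and> (\<forall>l\<ge>n. c l = 0) \<and> (\<Sum>l<n. c l) \<le> B \<and>
     p = (\<Sum>l<n. Polynomial.smult (of_real (c l)) (gb l)))"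

lemma gconeE:
  assumes "gcone B n p"
  obtains c where "\<And>l. 0 \<le> c l" "\<And>l. l \<ge> n \<Longrightarrow> c l = 0" "(\<Sum>l<n. c l) \<le> B"
    "p = (\<Sum>l<n. Polynomial.smult (of_real (c l)) (gb l))"
  using assms unfolding gcone_def by blast

lemma gcone_mono:
  assumes "gcone B n p" "B \<le> B'" "n \<le> n'"
  shows "gcone B' n' p"
proof -
  obtain c where c: "\<And>l. 0 \<le> c l" "\<And>l. l \<ge> n \<Longrightarrow> c l = 0" "(\<Sum>l<n. c l) \<le> B"
    "p = (\<Sum>l<n. Polynomial.smult (of_real (c l)) (gb l))" using assms(1) by (rule gconeE) blast
  have "(\<Sum>l<n'. c l) = (\<Sum>l<n. c l)" using assms(3) c(2) by (intro sum.mono_neutral_right) auto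
  moreover have "(\<Sum>l<n'. Polynomial.smult (of_real (c l)) (gb l)) = (\<Sum>l<n. Polynomial.smult (of_real (c l)) (gb l))"
    using assms(3) c(2) by (intro sum.mono_neutral_right) auto
  ultimately show ?thesis unfolding gcone_def using c assms by (intro exI[of _ c]) auto
qed

lemma gcone_0: "0 \<le> B \<Longrightarrow> gcone B n 0"
  unfolding gcone_def by (intro exI[of _ "\<lambda>_. 0"]) auto

lemma gcone_gb: "l < n \<Longrightarrow> gcone 1 n (gb l)"
proof -
  assume l: "l < n"
  have "(\<Sum>i<n. Polynomial.smult (of_real (if i = l then 1 else 0)) (gb i)) = (\<Sum>i<n. if i = l then gb l else 0)"
    by (intro sum.cong) auto
  then show ?thesis using l unfolding gcone_def by (intro exI[of _ "\<lambda>i. if i = l then 1 else 0"]) auto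
qed

lemma gcone_smult:
  assumes "gcone B n p" "0 \<le> r"
  shows "gcone (r * B) n (Polynomial.smult (of_real r) p)"
proof -
  obtain c where c: "\<And>l. 0 \<le> c l" "\<And>l. l \<ge> n \<Longrightarrow> c l = 0" "(\<Sum>l<n. c l) \<le> B"
    "p = (\<Sum>l<n. Polynomial.smult (of_real (c l)) (gb l))" using assms(1) by (rule gconeE) blast
  have "Polynomial.smult (of_real r) p = (\<Sum>l<n. Polynomial.smult (of_real (r * c l)) (gb l))"
    unfolding c(4) by (simp add: smult_sum2)
  moreover have "(\<Sum>l<n. r * c l) \<le> r * B" unfolding sum_distrib_left[symmetric] using c(3) assms(2) by (rule mult_left_mono)
  ultimately show ?thesis using c assms(2) unfolding gcone_def by (intro exI[of _ "\<lambda>l. r * c l"]) auto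
qed

lemma gcone_add:
  assumes "gcone B n p" "gcone C n q"
  shows "gcone (B + C) n (p + q)"
proof -
  obtain c where c: "\<And>l. 0 \<le> c l" "\<And>l. l \<ge> n \<Longrightarrow> c l = 0" "(\<Sum>l<n. c l) \<le> B"
    "p = (\<Sum>l<n. Polynomial.smult (of_real (c l)) (gb l))" using assms(1) by (rule gconeE) blast
  obtain d where d: "\<And>l. 0 \<le> d l" "\<And>l. l \<ge> n \<Longrightarrow> d l = 0" "(\<Sum>l<n. d l) \<le> C"
    "q = (\<Sum>l<n. Polynomial.smult (of_real (d l)) (gb l))" using assms(2) by (rule gconeE) blast
  have "p + q = (\<Sum>l<n. Polynomial.smult (of_real (c l + d l)) (gb l))"
    unfolding c(4) d(4) by (simp add: sum.distrib smult_add_left)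
  then show ?thesis using c d unfolding gcone_def
    by (intro exI[of _ "\<lambda>l. c l + d l"]) (auto simp: sum.distrib intro!: add_mono)
qed

lemma gcone_sum:
  "finite I \<Longrightarrow> (\<And>i. i \<in> I \<Longrightarrow> gcone (b i) n (p i)) \<Longrightarrow> gcone (\<Sum>i\<in>I. b i) n (\<Sum>i\<in>I. p i)"
  by (induction I rule: finite_induct) (auto intro: gcone_0 gcone_add)

lemma gcone_linear:
  assumes add: "\<And>p q. F (p + q) = F p + F q" and smult: "\<And>a p. F (Polynomial.smult a p) = Polynomial.smult a (F p)"
    and F: "\<And>l. l < n \<Longrightarrow> gcone D m (F (gb l))" and p: "gcone B n p" and D: "0 \<le> D"
  shows "gcone (D * B) m (F p)"
proof -
  obtain c where c: "\<And>l. 0 \<le> c l" "\<And>l. l \<ge> n \<Longrightarrow> c l = 0" "(\<Sum>l<n. c l) \<le> B"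
    "p = (\<Sum>l<n. Polynomial.smult (of_real (c l)) (gb l))" using p by (rule gconeE) blast
  have F0: "F 0 = 0" using smult[of 0 0] by simp
  have Fs: "F (\<Sum>i\<in>I. q i) = (\<Sum>i\<in>I. F (q i))" for I :: "nat set" and q
    by (induction I rule: infinite_finite_induct) (simp_all add: F0 add)
  have "F p = (\<Sum>l<n. Polynomial.smult (of_real (c l)) (F (gb l)))" unfolding c(4) Fs smult ..
  moreover have "gcone (\<Sum>l<n. c l * D) m (\<Sum>l<n. Polynomial.smult (of_real (c l)) (F (gb l)))"
    by (intro gcone_sum gcone_smult F c(1)) auto
  moreover have "(\<Sum>l<n. c l * D) \<le> D * B"
    unfolding sum_distrib_right[symmetric] using mult_left_mono[OF c(3) D] by (simp add: mult.commute)
  ultimately show ?thesis using gcone_mono by (metis order_refl)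
qed

lemma of_nat_mult_poly: "of_nat k * (p :: complex poly) = Polynomial.smult (of_real (real k)) p"
  by (simp add: of_nat_poly)

lemma gb_0: "gb 0 = 1"
  using cheb_gb[of 0] by (simp add: cheb_0)

lemma pderiv_gb_Suc: "pderiv (gb (Suc n)) = Polynomial.smult (of_real (real (n + 2))) (gb n) + pderiv (gbm n)"
proof -
  have "gb (Suc n) = of_nat (n + 2) * cheb (Suc n) + gbm n"
    using cheb_gb[of "Suc n"] by (cases n) (simp_all add: gbm_def)
  then have "pderiv (gb (Suc n)) = pderiv (Polynomial.smult (of_real (real (n + 2))) (cheb (Suc n))) + pderiv (gbm n)"
    by (simp only: of_nat_mult_poly pderiv_add)
  then show ?thesis by (simp only: pderiv_smult pderiv_cheb)
qed

text \<open>With n = k + 1, the derivative adds (k + 2) \<open>gb k\<close> to the derivative of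
  index k - 1, and (k + 2) + k^2 \<le> (k + 2)^2.\<close>

lemma gcone_pderiv_gb: "gcone (real ((n + 1)\<^sup>2)) n (pderiv (gb n))"
proof (induction n rule: less_induct)
  case (less n)
  show ?case
  proof (cases n)
    case 0
    then show ?thesis by (simp add: gb_0 pderiv_1 gcone_0)
  next
    case (Suc k)
    have 1: "gcone (real (k + 2) * 1) n (Polynomial.smult (of_real (real (k + 2))) (gb k))"
      by (intro gcone_smult gcone_gb) (auto simp: Suc)
    have 2: "gcone (real (k\<^sup>2)) n (pderiv (gbm k))"
    proof (cases k)
      case 0 then show ?thesis by (simp add: gbm_def gcone_0)
    next
      case (Suc j)
      have "gcone (real ((j + 1)\<^sup>2)) j (pderiv (gb j))" using less Suc \<open>n = Suc k\<close> by auto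
      then show ?thesis using Suc \<open>n = Suc k\<close> by (auto simp: gbm_def elim: gcone_mono)
    qed
    have "real (k + 2) * 1 + real (k\<^sup>2) \<le> real ((n + 1)\<^sup>2)"
      by (simp add: Suc power2_eq_square algebra_simps)
    then show ?thesis using gcone_mono[OF gcone_add[OF 1 2]] by (simp add: Suc pderiv_gb_Suc)
  qed
qed

lemma gcone_pderiv:
  assumes "gcone B n p" "0 \<le> B"
  shows "gcone (real ((n + 1)\<^sup>2) * B) n (pderiv p)"
proof (rule gcone_linear[OF pderiv_add pderiv_smult _ assms(1)])
  fix l assume l: "l < n"
  then have "(l + 1)\<^sup>2 \<le> (n + 1)\<^sup>2" by (intro power_mono) auto
  then have "real ((l + 1)\<^sup>2) \<le> real ((n + 1)\<^sup>2)" by (simp only: of_nat_le_iff)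
  then show "gcone (real ((n + 1)\<^sup>2)) n (pderiv (gb l))"
    using gcone_mono[OF gcone_pderiv_gb[of l]] l by simp
qed simp

lemma S_poly_cheb: "S_poly (cheb (Suc n)) = Polynomial.smult (of_real (1 / real ((n + 1) * (n + 3)))) (gb n)"
proof (rule S_poly_eqI[where c = 0])
  have "(n + 1) * (n + 3) \<noteq> 0" by simp
  then have "real ((n + 1) * (n + 3)) \<noteq> 0" by (simp only: of_nat_eq_0_iff not_False_eq_True)
  then have "complex_of_real (1 / real ((n + 1) * (n + 3))) * of_real (real ((n + 1) * (n + 3))) = 1"
    by (simp only: of_real_mult[symmetric]) simp
  then show "cheb (Suc n) = [:0:] + S_op (Polynomial.smult (of_real (1 / real ((n + 1) * (n + 3)))) (gb n))"
    unfolding S_op_smult S_op_gb of_nat_mult_poly smult_smult by simp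
qed

lemma S_poly_gb_0: "S_poly (gb 0) = 0"
  by (rule S_poly_eqI[where c = 1]) (simp add: gb_0 S_op_def one_pCons)

text \<open>The Chebyshev component of index k + 1 has coefficient k + 2, and \<open>S_poly\<close>
  divides it by (k + 1)(k + 3); so each step adds at most 1.\<close>

lemma gcone_S_poly_gb: "gcone (real (n + 1)) n (S_poly (gb n))"
proof (induction n rule: less_induct)
  case (less n)
  show ?case
  proof (cases n)
    case 0
    then show ?thesis by (simp add: S_poly_gb_0 gcone_0)
  next
    case (Suc k)
    have "gb (Suc k) = Polynomial.smult (of_real (real (k + 2))) (cheb (Suc k)) + gbm k"
      using cheb_gb[of "Suc k"] unfolding of_nat_mult_poly by (cases k) (simp_all add: gbm_def)
    then have S: "S_poly (gb (Suc k)) = Polynomial.smult (of_real (real (k + 2) * (1 / real ((k + 1) * (k + 3))))) (gb k) + S_poly (gbm k)"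
      by (simp only: S_poly_add S_poly_smult S_poly_cheb smult_smult of_real_mult)
    have 1: "gcone (real (k + 2) * (1 / real ((k + 1) * (k + 3))) * 1) n (Polynomial.smult (of_real (real (k + 2) * (1 / real ((k + 1) * (k + 3))))) (gb k))"
      by (intro gcone_smult gcone_gb) (auto simp: Suc)
    have 2: "gcone (real k) n (S_poly (gbm k))"
    proof (cases k)
      case 0 
      have "S_poly 0 = 0" using S_poly_smult[of 0 0] by simp
      with 0 show ?thesis by (simp add: gbm_def gcone_0)
    next
      case (Suc j)
      have "gcone (real (j + 1)) j (S_poly (gb j))" using less Suc \<open>n = Suc k\<close> by auto
      then show ?thesis using Suc \<open>n = Suc k\<close> by (auto simp: gbm_def elim: gcone_mono)
    qed
    have "real (k + 2) * (1 / real ((k + 1) * (k + 3))) \<le> 1" by (simp add: divide_simps algebra_simps)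
    then have "real (k + 2) * (1 / real ((k + 1) * (k + 3))) * 1 + real k \<le> real (n + 1)"
      by (simp add: Suc)
    then show ?thesis using gcone_mono[OF gcone_add[OF 1 2]] S by (simp add: Suc)
  qed
qed

text \<open>\<open>S_poly\<close> costs n + 1 and each of three derivatives (n + 1)^2, in total (n +
  1)^7; by n + 1 \<le> 2^n this is at most 2^(7n), whence 128. The exponential form is kept because
  it is stable under iteration of triangular kernels.\<close>

lemma gcone_T_poly_gb: "gcone (128 ^ n) n (T_poly (gb n))"
proof -
  have "gcone (real ((n + 1)\<^sup>2) * (real ((n + 1)\<^sup>2) * (real ((n + 1)\<^sup>2) * real (n + 1)))) n (T_poly (gb n))"
    unfolding T_poly_eq by (intro gcone_pderiv gcone_S_poly_gb) auto
  moreover have "real ((n + 1)\<^sup>2) * (real ((n + 1)\<^sup>2) * (real ((n + 1)\<^sup>2) * real (n + 1))) = real (n + 1) ^ 7"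
  proof -
    have "x\<^sup>2 * (x\<^sup>2 * (x\<^sup>2 * x)) = x ^ 7" for x :: real by (simp add: eval_nat_numeral)
    then show ?thesis by (simp only: of_nat_power)
  qed
  moreover have "real (n + 1) ^ 7 \<le> 128 ^ n"
  proof -
    have "n + 1 \<le> 2 ^ n" by (simp add: Suc_leI)
    then have "real (n + 1) \<le> 2 ^ n" by (metis of_nat_le_iff of_nat_numeral of_nat_power)
    then have "real (n + 1) ^ 7 \<le> (2 ^ n) ^ 7" by (intro power_mono) auto
    also have "\<dots> = 128 ^ n" by (simp flip: power_mult add: mult.commute[of n]) (simp add: power_mult)
    finally show ?thesis .
  qed
  ultimately show ?thesis using gcone_mono by (metis order_refl)
qed

text \<open>The matrix of \<open>T\<close> in the Gegenbauer basis, strictly triangular; it is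
  chosen from the cone representation so that its sign and row sums come with it.\<close>

definition tau :: "nat \<Rightarrow> nat \<Rightarrow> real" where
  "tau n = (SOME c. (\<forall>l. 0 \<le> c l) \<and> (\<forall>l\<ge>n. c l = 0) \<and> (\<Sum>l<n. c l) \<le> 128 ^ n \<and>
     T_poly (gb n) = (\<Sum>l<n. Polynomial.smult (of_real (c l)) (gb l)))"

lemma tau_nonneg: "0 \<le> tau n l"
  and tau_eq_0: "l \<ge> n \<Longrightarrow> tau n l = 0"
  and sum_tau: "(\<Sum>l<n. tau n l) \<le> 128 ^ n"
  and T_poly_gb: "T_poly (gb n) = (\<Sum>l<n. Polynomial.smult (of_real (tau n l)) (gb l))"
  using someI_ex[OF gcone_T_poly_gb[of n, unfolded gcone_def]] unfolding tau_def by blast+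

section \<open>The functionals on the Gegenbauer basis\<close>

lemma sc_cheb: "sc (cheb n) = (if n = 0 then 1 else 0)"
proof (cases n)
  case 0 then show ?thesis unfolding 0 cheb_0 sc_1 by simp
next
  case (Suc k)
  have "of_real (real ((k + 1) * (k + 3))) * sc (cheb (Suc k)) = 0"
    using sc_S_op[of "gb k"] unfolding S_op_gb of_nat_mult_poly sc_smult .
  moreover have "complex_of_real (real ((k + 1) * (k + 3))) \<noteq> 0"
  proof -
    have "(k + 1) * (k + 3) \<noteq> 0" by simp
    then show ?thesis by (simp only: of_real_eq_0_iff of_nat_eq_0_iff not_False_eq_True)
  qed
  ultimately have "sc (cheb (Suc k)) = 0" by (metis mult_eq_0_iff)
  then show ?thesis using Suc by (simp only: nat.distinct if_False)
qed

text \<open>The number \<open>cT k n\<close> is \<open>\<alpha>\<^sub>k\<close> evaluated at \<open>gb n\<close>.\<close>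

primrec cT :: "nat \<Rightarrow> nat \<Rightarrow> real" where
  "cT 0 n = (if even n then 1 else 0)"
| "cT (Suc k) n = (\<Sum>l<n. tau n l * cT k l)"

lemma sc_gb: "sc (gb n) = of_real (cT 0 n)"
proof (induction n rule: less_induct)
  case (less n)
  have *: "gb n = Polynomial.smult (of_real (real (n + 1))) (cheb n) + (if n \<ge> 2 then gb (n - 2) else 0)"
    using cheb_gb[of n] unfolding of_nat_mult_poly by (simp add: algebra_simps)
  show ?case
  proof (cases "n \<ge> 2")
    case True
    then show ?thesis using less[of "n - 2"] unfolding *[unfolded if_P[OF True]] sc_add sc_smult sc_cheb by simp
  next
    case False
    have "gb n = Polynomial.smult (of_real (real (n + 1))) (cheb n)" using * False by simp
    then have "sc (gb n) = of_real (real (n + 1)) * (if n = 0 then 1 else 0)" by (simp only: sc_smult sc_cheb)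
    moreover have "n = 0 \<or> n = 1" using False by linarith
    ultimately show ?thesis by auto
  qed
qed

lemma cT_nonneg: "0 \<le> cT k n"
  by (induction k arbitrary: n) (auto intro!: sum_nonneg mult_nonneg_nonneg tau_nonneg)

lemma cT_le: "cT k n \<le> (128 ^ k) ^ n"
proof (induction k arbitrary: n)
  case (Suc k)
  have "cT (Suc k) n \<le> (\<Sum>l<n. tau n l * (128 ^ k) ^ n)"
  proof (simp only: cT.simps, intro sum_mono mult_left_mono tau_nonneg)
    fix l assume "l \<in> {..<n}"
    then have "((128 :: real) ^ k) ^ l \<le> (128 ^ k) ^ n" by (intro power_increasing) auto
    then show "cT k l \<le> (128 ^ k) ^ n" using Suc[of l] by linarith
  qed
  also have "\<dots> \<le> 128 ^ n * (128 ^ k) ^ n"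
    unfolding sum_distrib_right[symmetric] by (intro mult_right_mono sum_tau) auto
  finally show ?case by (simp add: power_mult_distrib)
qed simp

text \<open>Each application of \<open>T\<close> lowers the index strictly, so more than
  \<open>n\<close> of them annihilate \<open>gb n\<close>.\<close>

lemma cT_eq_0: "k > n \<Longrightarrow> cT k n = 0"
proof (induction k arbitrary: n)
  case (Suc k)
  then have "cT k l = 0" if "l < n" for l using that by auto
  then show ?case by simp
qed simp

section \<open>Uniqueness of Gegenbauer expansions\<close>

text \<open>Orthonormality by algebra alone: a factor t may be attached to either polynomial, so the
  three-term recurrence moves degree from the first factor to the second until
  \<open>sc_cheb\<close> applies.\<close>

lemma sc_cheb_mult: "sc (cheb m * cheb n) = (if m = n then 1 else 0)"
proof -
  define A where "A m n = sc (cheb m * cheb n)" for m n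
  have "A m n = (if m = n then 1 else 0)"
  proof (induction m arbitrary: n rule: less_induct)
  case (less m)
  show ?case
  proof (cases m)
    case 0
    then show ?thesis using sc_cheb[of n] unfolding A_def 0 cheb_0 by simp
  next
    case m: (Suc k)
    have pc: "pX * cheb n = cheb (Suc n) + (if n = 0 then 0 else cheb (n - 1))" for n
      by (cases n) (simp_all add: cheb_0 cheb_1 cheb_Suc_Suc)
    have cS: "cheb (Suc k) = pX * cheb k - (if k = 0 then 0 else cheb (k - 1))"
      using pc[of k] by simp
    have "cheb (Suc k) * cheb n = cheb k * (pX * cheb n) - (if k = 0 then 0 else cheb (k - 1)) * cheb n"
      by (simp only: cS left_diff_distrib mult.assoc mult.left_commute[of pX])
    also have "\<dots> = cheb k * cheb (Suc n) + (if n = 0 then 0 else cheb k * cheb (n - 1)) - (if k = 0 then 0 else cheb (k - 1) * cheb n)"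
      unfolding pc by (simp add: algebra_simps)
    finally have "sc (cheb (Suc k) * cheb n) = sc (cheb k * cheb (Suc n)) + (if n = 0 then 0 else sc (cheb k * cheb (n - 1))) - (if k = 0 then 0 else sc (cheb (k - 1) * cheb n))"
      by (simp only: sc_diff sc_add sc_0 if_distrib[of sc])
    then have "A (Suc k) n = A k (Suc n) + (if n = 0 then 0 else A k (n - 1)) - (if k = 0 then 0 else A (k - 1) n)"
      by (simp only: A_def)
    moreover have "A k i = (if k = i then 1 else 0)" "A (k - 1) i = (if k - 1 = i then 1 else 0)" for i
      using less[of k i] less[of "k - 1" i] m by simp_all
    ultimately have "A (Suc k) n = (if Suc k = n then 1 else 0)" by (cases n; cases k) auto
    then show ?thesis by (simp only: m)
  qed
qed
  then show ?thesis by (simp only: A_def)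
qed

lemma sc_weight_gb_cheb:
  "sc ((4 - pX\<^sup>2) * gb n * cheb m) = (if n = m then of_nat (m + 3) else 0) - (if n + 2 = m then of_nat (m - 1) else 0)"
proof -
  have "sc ((4 - pX\<^sup>2) * gb n * cheb m) = sc (Polynomial.smult (of_nat (n + 3)) (cheb n * cheb m) - Polynomial.smult (of_nat (n + 1)) (cheb (n + 2) * cheb m))"
    unfolding weight_mult_gb of_nat_poly by (simp add: left_diff_distrib)
  then show ?thesis unfolding sc_diff sc_smult sc_cheb_mult by auto
qed

lemma semicircle_bound:
  assumes f: "continuous_on UNIV f"
  assumes "\<And>x. -2 \<le> x \<Longrightarrow> x \<le> 2 \<Longrightarrow> cmod (f (of_real x)) \<le> e"
  shows "cmod (semicircle f) \<le> 4 * e"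
proof -
  have e: "0 \<le> e" using order_trans[OF norm_ge_zero assms(2)[of 0]] by simp
  have "cmod (LINT x:{-2..2}|lborel. f (of_real x) * of_real (sqrt (4 - x\<^sup>2))) \<le>
      (LINT x|lborel. indicat_real {-2..2 :: real} x * (2 * e))"
    unfolding set_lebesgue_integral_def
  proof (rule Bochner_Integration.integral_norm_bound_integral)
    show "integrable lborel (\<lambda>x. indicat_real {-2..2 :: real} x * (2 * e))"
      by (intro integrable_mult_left) (auto intro!: integrable_real_indicator)
    show "integrable lborel (\<lambda>x. indicat_real {-2..2} x *\<^sub>R (f (of_real x) * of_real (sqrt (4 - x\<^sup>2))))"
      using set_integrable_semicircle[OF f] unfolding set_integrable_def .
    fix x :: real
    show "cmod (indicat_real {-2..2} x *\<^sub>R (f (of_real x) * of_real (sqrt (4 - x\<^sup>2)))) \<le> indicat_real {-2..2} x * (2 * e)"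
    proof (cases "x \<in> {-2..2}")
      case True
      then have "x\<^sup>2 \<le> 4" using abs_le_square_iff[of x 2] by (simp add: abs_le_iff)
      then have "sqrt (4 - x\<^sup>2) \<le> 2" "0 \<le> sqrt (4 - x\<^sup>2)" by (auto intro!: real_le_lsqrt)
      then have "cmod (f (of_real x)) * sqrt (4 - x\<^sup>2) \<le> e * 2"
        using assms(2)[of x] True e by (intro mult_mono) auto
      then show ?thesis using True \<open>0 \<le> sqrt (4 - x\<^sup>2)\<close> by (simp add: norm_mult)
    qed simp
  qed
  also have "\<dots> = 8 * e" by simp
  finally have "cmod (semicircle f) \<le> 1 / (2 * pi) * (8 * e)"
    unfolding semicircle_def norm_mult by (intro mult_mono) (auto simp: norm_divide norm_mult)
  also have "\<dots> \<le> 4 * e"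
  proof -
    have "1 \<le> pi" using pi_gt3 by simp
    then show ?thesis using mult_right_mono[OF _ e, of 1 pi] by (simp add: field_simps)
  qed
  finally show ?thesis .
qed

text \<open>Multiplied by 4 - t^2, a basis polynomial is a combination of two Chebyshev polynomials.
  Testing the difference of two expansions on [-2, 2] against the orthonormal \<open>cheb m\<close>
  therefore couples only \<open>d m\<close> and \<open>d (m - 2)\<close>, and this recursion starts
  from zero.\<close>

lemma has_gegenbauer_expansion_unique:
  assumes "has_gegenbauer_expansion a f" "has_gegenbauer_expansion b f"
  shows "a = b"
proof -
  define d where "d n = a n - b n" for n
  define q where "q M = (\<Sum>n\<le>M. Polynomial.smult (d n) (gb n))" for M
  let ?I = "complex_of_real ` {-2..2}"
  have comp: "compact ?I" by (intro compact_continuous_image continuous_intros) auto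
  have "uniform_limit ?I (\<lambda>m t. (\<Sum>n\<le>m. a n * poly (gb n) t) - (\<Sum>n\<le>m. b n * poly (gb n) t)) (\<lambda>t. f t - f t) sequentially"
    using assms comp unfolding has_gegenbauer_expansion_def by (intro uniform_limit_intros) auto
  moreover have "(\<Sum>n\<le>m. a n * poly (gb n) t) - (\<Sum>n\<le>m. b n * poly (gb n) t) = poly (q m) t" for m t
    by (simp add: q_def d_def poly_sum left_diff_distrib sum_subtractf)
  ultimately have lim: "uniform_limit ?I (\<lambda>m. poly (q m)) (\<lambda>t. 0) sequentially"
    by simp
  have rec: "of_nat (m + 3) * d m = (if m \<ge> 2 then of_nat (m - 1) * d (m - 2) else 0)" for m
  proof -
    let ?w = "(4 - pX\<^sup>2) * cheb m"
    define L where "L = of_nat (m + 3) * d m - (if m \<ge> 2 then of_nat (m - 1) * d (m - 2) else 0)"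
    have Lq: "sc (?w * q M) = L" if "M \<ge> m" for M
    proof -
      have "sc (?w * q M) = (\<Sum>n\<le>M. d n * sc ((4 - pX\<^sup>2) * gb n * cheb m))"
      proof -
        have "?w * q M = (\<Sum>n\<le>M. Polynomial.smult (d n) ((4 - pX\<^sup>2) * gb n * cheb m))"
          by (simp only: q_def sum_distrib_left) (simp add: mult_ac)
        then show ?thesis by (simp only: sc_sum sc_smult)
      qed
      also have "\<dots> = (\<Sum>n\<le>M. if n = m then of_nat (m + 3) * d m else 0) - (\<Sum>n\<le>M. if n + 2 = m then of_nat (m - 1) * d n else 0)"
        unfolding sc_weight_gb_cheb sum_subtractf[symmetric] by (intro sum.cong) (auto simp: algebra_simps)
      also have "(\<Sum>n\<le>M. if n = m then of_nat (m + 3) * d m else 0) = of_nat (m + 3) * d m"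
        using that by simp
      also have "(\<Sum>n\<le>M. if n + 2 = m then of_nat (m - 1) * d n else 0) = (if m \<ge> 2 then of_nat (m - 1) * d (m - 2) else 0)"
      proof (cases "m \<ge> 2")
        case True
        have "(\<Sum>n\<le>M. if n + 2 = m then of_nat (m - 1) * d n else 0) = (\<Sum>n\<le>M. if n = m - 2 then of_nat (m - 1) * d (m - 2) else 0)"
          using True by (intro sum.cong) auto
        then show ?thesis using True that by simp
      qed (auto intro!: sum.neutral)
      finally show ?thesis unfolding L_def .
    qed
    obtain C where C: "\<And>t. t \<in> ?I \<Longrightarrow> cmod (poly ?w t) \<le> C" "C > 0"
    proof -
      have "bounded (poly ?w ` ?I)" by (intro compact_imp_bounded compact_continuous_image comp continuous_intros)
      then show ?thesis using that unfolding bounded_pos by auto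
    qed
    have "L = 0"
    proof (rule ccontr)
      assume "L \<noteq> 0"
      \<comment> \<open>With the factor 4 of \<open>semicircle_bound\<close>, this choice bounds |L|
        by |L| / 2.\<close>
      define e where "e = cmod L / (8 * C)"
      have e: "e > 0" using \<open>L \<noteq> 0\<close> C(2) by (simp add: e_def)
      from lim[unfolded uniform_limit_iff, rule_format, OF e] obtain M0 where
        M0: "\<And>M t. M \<ge> M0 \<Longrightarrow> t \<in> ?I \<Longrightarrow> cmod (poly (q M) t) < e"
        unfolding eventually_sequentially by auto
      let ?M = "max m M0"
      have "cmod (sc (?w * q ?M)) \<le> 4 * (C * e)"
      proof (rule semicircle_bound)
        fix x :: real assume "-2 \<le> x" "x \<le> 2"
        then have x: "complex_of_real x \<in> ?I" by auto
        show "cmod (poly (?w * q ?M) (of_real x)) \<le> C * e"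
          unfolding poly_mult[of ?w] norm_mult using C(1)[OF x] M0[OF _ x, of ?M] C(2)
          by (intro mult_mono) auto
      qed (rule continuous_on_poly')
      then have "cmod L \<le> 4 * (C * e)" using Lq[of ?M] by simp
      also have "\<dots> = cmod L / 2" using C(2) by (simp add: e_def)
      finally show False using \<open>L \<noteq> 0\<close> by simp
    qed
    then show ?thesis by (simp add: L_def)
  qed
  have "d m = 0" for m
  proof (induction m rule: less_induct)
    case (less m)
    have "(of_nat (m + 3) :: complex) * d m = 0" using rec[of m] less[of "m - 2"] by (cases "m \<ge> 2") auto
    moreover have "(of_nat (m + 3) :: complex) \<noteq> 0" by (simp only: of_nat_eq_0_iff)
    ultimately show ?case by (metis mult_eq_0_iff)
  qed
  then show ?thesis by (auto simp: d_def)
qed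

section \<open>Rules for expansions and growth of the basis\<close>

lemma gegenbauer_coeff_eqI: "has_gegenbauer_expansion a f \<Longrightarrow> gegenbauer_coeff f = a"
  unfolding gegenbauer_coeff_def using has_gegenbauer_expansion_unique by blast

lemma has_gegenbauer_expansion_diff:
  assumes "has_gegenbauer_expansion a f" "has_gegenbauer_expansion b g"
  shows "has_gegenbauer_expansion (\<lambda>n. a n - b n) (\<lambda>z. f z - g z)"
  using assms unfolding has_gegenbauer_expansion_def left_diff_distrib sum_subtractf
  by (auto intro!: uniform_limit_intros)

lemma has_gegenbauer_expansion_poly:
  "has_gegenbauer_expansion (\<lambda>n. if n \<le> m then b n else 0) (poly (\<Sum>n\<le>m. Polynomial.smult (b n) (gb n)))"
  unfolding has_gegenbauer_expansion_def
proof (intro allI impI)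
  fix C :: "complex set"
  have "(\<Sum>n\<le>k. (if n \<le> m then b n else 0) * poly (gb n) t) = poly (\<Sum>n\<le>m. Polynomial.smult (b n) (gb n)) t" if "k \<ge> m" for k t
  proof -
    have "(\<Sum>n\<le>k. (if n \<le> m then b n else 0) * poly (gb n) t) = (\<Sum>n\<le>m. (if n \<le> m then b n else 0) * poly (gb n) t)"
      using that by (intro sum.mono_neutral_right) auto
    then show ?thesis by (simp add: poly_sum)
  qed
  then show "uniform_limit C (\<lambda>k t. \<Sum>n\<le>k. (if n \<le> m then b n else 0) * poly (gb n) t) (poly (\<Sum>n\<le>m. Polynomial.smult (b n) (gb n))) sequentially"
    by (intro uniform_limitI) (auto simp: eventually_sequentially intro!: exI[of _ m])
qed

lemma has_gegenbauer_expansion_sums: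
  assumes "has_gegenbauer_expansion a f"
  shows "(\<lambda>n. a n * poly (gb n) z) sums f z"
proof -
  have "(\<lambda>m. \<Sum>n\<le>m. a n * poly (gb n) z) \<longlonglongrightarrow> f z"
    using assms[unfolded has_gegenbauer_expansion_def, rule_format, of "{z}"] by simp
  then show ?thesis unfolding sums_def_le .
qed

text \<open>In the three-term recurrence the ratio (k + 2)/(k + 1) and, for k \<ge> 1, the ratio (k
  + 3)/(k + 1) are at most 2; the base 3 + 3|z| leaves room to spare.\<close>

lemma cmod_poly_gb_le: "cmod (poly (gb n) z) \<le> (3 + 3 * cmod z) ^ n"
proof (induction n rule: less_induct)
  case (less n)
  let ?b = "3 + 3 * cmod z"
  have b1: "1 \<le> ?b" by simp
  show ?case
  proof (cases n)
    case 0
    then show ?thesis by (simp add: gb_0)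
  next
    case (Suc k)
    have "of_nat (k + 1) * gb (Suc k) = of_nat (k + 2) * (pX * gb k) - of_nat (k + 3) * gbm k"
      using t_mult_gb[of k] by (simp only: add_diff_cancel)
    then have "poly (of_nat (k + 1) * gb (Suc k)) z = poly (of_nat (k + 2) * (pX * gb k) - of_nat (k + 3) * gbm k) z"
      by (simp only:)
    then have "of_nat (k + 1) * poly (gb (Suc k)) z = of_nat (k + 2) * (z * poly (gb k) z) - of_nat (k + 3) * poly (gbm k) z"
      unfolding poly_mult poly_diff by (simp add: pX_def)
    then have "real (k + 1) * cmod (poly (gb (Suc k)) z) = cmod (of_nat (k + 2) * (z * poly (gb k) z) - of_nat (k + 3) * poly (gbm k) z)"
      by (metis norm_mult norm_of_nat)
    also have "\<dots> \<le> real (k + 2) * (cmod z * cmod (poly (gb k) z)) + real (k + 3) * cmod (poly (gbm k) z)"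
      by (rule order_trans[OF norm_triangle_ineq4]) (simp only: norm_mult norm_of_nat order_refl)
    also have "\<dots> \<le> real (k + 2) * (cmod z * ?b ^ k) + real (k + 3) * (if k = 0 then 0 else ?b ^ k)"
    proof (intro add_mono mult_left_mono)
      show "cmod (poly (gb k) z) \<le> ?b ^ k" using less Suc by simp
      show "cmod (poly (gbm k) z) \<le> (if k = 0 then 0 else ?b ^ k)"
      proof (cases k)
        case (Suc j)
        have "cmod (poly (gb j) z) \<le> ?b ^ j" using less[of j] Suc \<open>n = Suc k\<close> by simp
        also have "\<dots> \<le> ?b ^ k" using b1 Suc by (intro power_increasing) auto
        finally show ?thesis using Suc by (simp add: gbm_def)
      qed (simp add: gbm_def)
    qed auto
    also have "\<dots> \<le> real (k + 1) * ?b ^ Suc k"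
    proof -
      define y where "y = ?b ^ k"
      have y: "0 \<le> y" using b1 by (simp add: y_def)
      have "real (k + 2) * (cmod z * y) \<le> (2 * real (k + 1)) * (cmod z * y)"
        using y by (intro mult_right_mono) auto
      moreover have "real (k + 3) * (if k = 0 then 0 else y) \<le> (2 * real (k + 1)) * y"
      proof (cases k)
        case (Suc j) then show ?thesis using y by (auto intro!: mult_right_mono)
      qed (use y in simp)
      moreover have "(2 * real (k + 1)) * (cmod z * y) + (2 * real (k + 1)) * y \<le> real (k + 1) * (?b * y)"
      proof -
        have "real (k + 1) * (?b * y) - ((2 * real (k + 1)) * (cmod z * y) + (2 * real (k + 1)) * y) = real (k + 1) * (y * (1 + cmod z))"
          by (simp only: of_nat_add) (simp add: algebra_simps)
        moreover have "0 \<le> real (k + 1) * (y * (1 + cmod z))" using y by (intro mult_nonneg_nonneg) auto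
        ultimately show ?thesis by linarith
      qed
      ultimately show ?thesis unfolding power_Suc y_def[symmetric] by linarith
    qed
    finally have "real (k + 1) * cmod (poly (gb (Suc k)) z) \<le> real (k + 1) * ?b ^ Suc k" .
    then show ?thesis using Suc by (simp only: mult_le_cancel_left_pos of_nat_0_less_iff)
  qed
qed

section \<open>Coefficient sequences of exponential type\<close>

text \<open>After multiplication by the weight of the norm the decay 1/n! still leaves a factor
  1/sqrt (n!), up to exponentials; this gives convergence for every \<open>K > 0\<close>.\<close>

definition expo :: "(nat \<Rightarrow> complex) \<Rightarrow> bool" where
  "expo a \<longleftrightarrow> (\<exists>A\<ge>0. \<exists>B\<ge>0. \<forall>n. cmod (a n) \<le> A * B ^ n / fact n)"

lemma expoE:
  assumes "expo a"
  obtains A B where "A \<ge> 0" "B \<ge> 0" "\<And>n. cmod (a n) \<le> A * B ^ n / fact n"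
  using assms unfolding expo_def by blast

lemma summable_power_div_fact: "summable (\<lambda>n. (x :: real) ^ n / fact n)"
  using summable_exp[of x] by (simp add: field_simps)

lemma suminf_power_div_fact: "(\<Sum>n. (x :: real) ^ n / fact n) = exp x"
  by (simp add: exp_def divide_inverse mult.commute)

lemma expo_summable:
  assumes "expo a" "\<And>n. \<bar>v n\<bar> \<le> C ^ n" "0 \<le> C"
  shows "summable (\<lambda>n. cmod (a n) * (v n :: real))"
proof -
  obtain A B where AB: "A \<ge> 0" "B \<ge> 0" "\<And>n. cmod (a n) \<le> A * B ^ n / fact n" using assms(1) by (rule expoE) blast
  have "summable (\<lambda>n. A * ((B * C) ^ n / fact n))" by (intro summable_mult summable_power_div_fact)
  then show ?thesis
  proof (rule summable_comparison_test')
    fix n :: nat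
    have "cmod (a n) * \<bar>v n\<bar> \<le> (A * B ^ n / fact n) * C ^ n" using AB assms by (intro mult_mono) auto
    then show "norm (cmod (a n) * v n) \<le> A * ((B * C) ^ n / fact n)"
      by (simp add: abs_mult power_mult_distrib)
  qed
qed

lemma exp_tail_le:
  fixes x :: real
  assumes "0 \<le> x"
  shows "summable (\<lambda>n. if l \<le> n then x ^ n / fact n else 0)"
    and "(\<Sum>n. if l \<le> n then x ^ n / fact n else 0) \<le> x ^ l / fact l * exp x"
proof -
  show *: "summable (\<lambda>n. if l \<le> n then x ^ n / fact n else 0)"
    by (rule summable_comparison_test'[OF summable_power_div_fact[of x]]) (use assms in auto)
  have "(\<Sum>n. if l \<le> n then x ^ n / fact n else 0) = (\<Sum>n. if l \<le> n + l then x ^ (n + l) / fact (n + l) else 0)"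
    using suminf_split_initial_segment[OF *, of l] by simp
  also have "\<dots> \<le> (\<Sum>n. x ^ l / fact l * (x ^ n / fact n))"
  proof (rule suminf_le)
    fix n
    have "(fact l * fact n :: real) \<le> fact (n + l)"
    proof -
      have "fact l * fact n dvd (fact (n + l) :: nat)" using fact_fact_dvd_fact[of l n] by (simp add: add.commute)
      then have "fact l * fact n \<le> (fact (n + l) :: nat)" by (rule dvd_imp_le) simp
      then show ?thesis by (metis of_nat_fact of_nat_le_iff of_nat_mult)
    qed
    then have "x ^ (n + l) / fact (n + l) \<le> x ^ (n + l) / (fact l * fact n)"
      using assms by (intro divide_left_mono) auto
    then show "(if l \<le> n + l then x ^ (n + l) / fact (n + l) else 0) \<le> x ^ l / fact l * (x ^ n / fact n)"
      by (simp add: power_add mult.commute)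
    show "summable (\<lambda>n. x ^ l / fact l * (x ^ n / fact n))" for n :: nat by (intro summable_mult summable_power_div_fact)
  qed (use summable_ignore_initial_segment[OF *, of l] in auto)
  also have "\<dots> = x ^ l / fact l * exp x"
    using suminf_mult[OF summable_power_div_fact[of x], of "x ^ l / fact l"] suminf_power_div_fact[of x] by simp
  finally show "(\<Sum>n. if l \<le> n then x ^ n / fact n else 0) \<le> x ^ l / fact l * exp x" .
qed

lemma summable_expo_kernel:
  assumes "expo a" "\<And>n. 0 \<le> w n" "\<And>n. w n \<le> C ^ n" "0 \<le> C"
  shows "summable (\<lambda>n. norm (a n * of_real (w n)))"
proof -
  have "\<bar>w n\<bar> \<le> C ^ n" for n using assms(2,3) by simp
  from expo_summable[OF assms(1) this assms(4)] show ?thesis using assms(2) by (simp add: norm_mult)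
qed

text \<open>By triangularity only n \<ge> l contributes, and the tail of an exponential series from
  l on has again a factor x^l / l!.\<close>

lemma expo_kernel:
  assumes a: "expo a" and w: "\<And>n l. 0 \<le> w n l" "\<And>n l. w n l \<le> C ^ n" "\<And>n l. n < l \<Longrightarrow> w n l = 0" and C: "0 \<le> C"
  shows "expo (\<lambda>l. \<Sum>n. a n * of_real (w n l))"
proof -
  obtain A B where AB: "A \<ge> 0" "B \<ge> 0" "\<And>n. cmod (a n) \<le> A * B ^ n / fact n" using a by (rule expoE) blast
  have BC: "0 \<le> B * C" using AB C by simp
  have "cmod (\<Sum>n. a n * of_real (w n l)) \<le> (A * exp (B * C)) * (B * C) ^ l / fact l" for l
  proof -
    have s: "summable (\<lambda>n. norm (a n * of_real (w n l)))" using a w(1,2) C by (rule summable_expo_kernel)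
    have "cmod (\<Sum>n. a n * of_real (w n l)) \<le> (\<Sum>n. norm (a n * of_real (w n l)))"
      by (rule summable_norm[OF s])
    also have "\<dots> \<le> (\<Sum>n. A * (if l \<le> n then (B * C) ^ n / fact n else 0))"
    proof (rule suminf_le[OF _ s])
      show "summable (\<lambda>n. A * (if l \<le> n then (B * C) ^ n / fact n else 0))"
        by (intro summable_mult exp_tail_le BC)
      fix n
      show "norm (a n * of_real (w n l)) \<le> A * (if l \<le> n then (B * C) ^ n / fact n else 0)"
      proof (cases "l \<le> n")
        case True
        have "cmod (a n) * w n l \<le> (A * B ^ n / fact n) * C ^ n" using AB w C by (intro mult_mono) auto
        then show ?thesis using True w(1) by (simp add: norm_mult power_mult_distrib)
      qed (simp add: w(3))
    qed
    also have "\<dots> = A * (\<Sum>n. if l \<le> n then (B * C) ^ n / fact n else 0)"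
      by (rule suminf_mult[OF exp_tail_le(1)[OF BC]])
    also have "\<dots> \<le> A * ((B * C) ^ l / fact l * exp (B * C))" by (intro mult_left_mono exp_tail_le BC AB)
    finally show ?thesis by (simp add: mult_ac)
  qed
  moreover have "0 \<le> A * exp (B * C)" using AB by simp
  ultimately show ?thesis unfolding expo_def using BC by blast
qed

text \<open>Dominated convergence for series: \<open>S n\<close> bounds the absolute partial sums of
  row \<open>n\<close>, so Tannery's theorem applies to the partial sums in
  \<open>k\<close>.\<close>

lemma sums_swap:
  fixes a :: "nat \<Rightarrow> complex" and w :: "nat \<Rightarrow> nat \<Rightarrow> complex"
  assumes w: "\<And>n. (\<lambda>k. w n k) sums s n" "\<And>n k. (\<Sum>i<k. norm (w n i)) \<le> S n" and S: "summable (\<lambda>n. norm (a n) * S n)"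
  shows "(\<lambda>k. \<Sum>n. a n * w n k) sums (\<Sum>n. a n * s n)"
proof -
  have b: "norm (a n * w n k) \<le> norm (a n) * S n" for n k
  proof -
    have "norm (w n k) \<le> (\<Sum>i<Suc k. norm (w n i))" by (simp add: sum_nonneg)
    then show ?thesis using w(2)[of n "Suc k"] by (auto simp: norm_mult intro!: mult_left_mono)
  qed
  have sm: "summable (\<lambda>n. a n * w n k)" for k
    by (rule summable_comparison_test'[OF S]) (use b in auto)
  have part: "(\<Sum>i<k. \<Sum>n. a n * w n i) = (\<Sum>n. a n * (\<Sum>i<k. w n i))" for k
    using suminf_sum[of "{..<k}" "\<lambda>i n. a n * w n i"] sm by (simp add: sum_distrib_left)
  have "(\<lambda>k. \<Sum>n. a n * (\<Sum>i<k. w n i)) \<longlonglongrightarrow> (\<Sum>n. a n * s n)"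
  proof (rule tannerys_theorem[THEN conjunct2, THEN conjunct2])
    show "(\<lambda>k. a n * (\<Sum>i<k. w n i)) \<longlonglongrightarrow> a n * s n" for n
      using w(1)[of n] by (intro tendsto_mult tendsto_const) (simp add: sums_def)
    show "\<forall>\<^sub>F (n, k) in at_top \<times>\<^sub>F sequentially. norm (a n * (\<Sum>i<k. w n i)) \<le> norm (a n) * S n"
    proof (intro always_eventually allI, clarify)
      fix n k
      have "norm (\<Sum>i<k. w n i) \<le> S n" using order_trans[OF norm_sum w(2)] .
      then show "norm (a n * (\<Sum>i<k. w n i)) \<le> norm (a n) * S n" by (simp add: norm_mult mult_left_mono)
    qed
  qed (use S in auto)
  then show ?thesis unfolding sums_def part .
qed

text \<open>Row \<open>n\<close> ends at index \<open>n\<close>, where |v l| is at most D^n because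
  1 \<le> D. The resulting row bound (C D)^n is absorbed by the factorials of an \<open>expo\<close>
  sequence.\<close>

lemma kernel_sums_swap:
  assumes a: "expo a" and w: "\<And>n l. 0 \<le> w n l" "\<And>n. (\<Sum>l<Suc n. w n l) \<le> C ^ n" "\<And>n l. n < l \<Longrightarrow> w n l = 0" and C: "0 \<le> C"
    and v: "\<And>l. norm (v l) \<le> D ^ l" "1 \<le> D"
  shows "(\<lambda>l. (\<Sum>n. a n * of_real (w n l)) * v l) sums (\<Sum>n. a n * (\<Sum>l<Suc n. of_real (w n l) * v l))"
proof -
  have "(\<lambda>l. \<Sum>n. a n * (of_real (w n l) * v l)) sums (\<Sum>n. a n * (\<Sum>l<Suc n. of_real (w n l) * v l))"
  proof (rule sums_swap)
    show "(\<lambda>l. of_real (w n l) * v l) sums (\<Sum>l<Suc n. of_real (w n l) * v l)" for n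
      by (rule sums_finite) (auto simp: w(3))
    show "(\<Sum>i<k. norm (of_real (w n i) * v i)) \<le> (C * D) ^ n" for n k
    proof -
      have "(\<Sum>i<k. norm (of_real (w n i) * v i)) \<le> (\<Sum>i<k. w n i * D ^ n)"
      proof (rule sum_mono)
        fix i
        show "norm (of_real (w n i) * v i) \<le> w n i * D ^ n"
        proof (cases "i \<le> n")
          case True
          have "norm (v i) \<le> D ^ n" using v(1)[of i] power_increasing[OF True v(2)] by linarith
          then show ?thesis using w(1)[of n i] by (simp add: norm_mult mult_left_mono)
        qed (simp add: w(3))
      qed
      also have "\<dots> = (\<Sum>i<k. w n i) * D ^ n" by (simp add: sum_distrib_right)
      also have "(\<Sum>i<k. w n i) \<le> (\<Sum>i<max k (Suc n). w n i)" by (intro sum_mono2) (auto simp: w(1))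
      also have "\<dots> = (\<Sum>i<Suc n. w n i)" by (intro sum.mono_neutral_right) (auto simp: w(3))
      also have "\<dots> \<le> C ^ n" by (rule w(2))
      finally show ?thesis using v(2) by (simp add: power_mult_distrib mult_right_mono)
    qed
    show "summable (\<lambda>n. norm (a n) * (C * D) ^ n)"
      by (rule expo_summable[OF a, of _ "C * D"]) (use C v(2) in auto)
  qed
  moreover have "(\<Sum>n. a n * (of_real (w n l) * v l)) = (\<Sum>n. a n * of_real (w n l)) * v l" for l
  proof -
    have "w n l \<le> C ^ n" for n
    proof (cases "l \<le> n")
      case True
      then have "w n l \<le> (\<Sum>l<Suc n. w n l)" by (intro member_le_sum) (auto simp: w(1))
      then show ?thesis using w(2)[of n] by linarith
    qed (use w(3) C in simp)
    then have "summable (\<lambda>n. a n * of_real (w n l))"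
      using summable_norm_cancel[OF summable_expo_kernel[of a "\<lambda>n. w n l" C]] a w(1) C by blast
    from suminf_mult2[OF this, of "v l"] show ?thesis by (simp add: mult.assoc)
  qed
  ultimately show ?thesis by simp
qed

section \<open>Functions given by Gegenbauer series\<close>

definition gsum :: "(nat \<Rightarrow> complex) \<Rightarrow> complex \<Rightarrow> complex" where
  "gsum a z = (\<Sum>n. a n * poly (gb n) z)"

lemma gsum_expansion:
  assumes "expo a"
  shows "has_gegenbauer_expansion a (gsum a)"
  unfolding has_gegenbauer_expansion_def
proof (intro allI impI)
  fix K :: "complex set" assume "compact K"
  then obtain R where R: "R > 0" "\<And>z. z \<in> K \<Longrightarrow> cmod z \<le> R"
    using compact_imp_bounded bounded_pos by metis
  have "uniform_limit K (\<lambda>m z. \<Sum>n<m. a n * poly (gb n) z) (gsum a) sequentially"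
    unfolding gsum_def
  proof (rule Weierstrass_m_test)
    fix n z assume "z \<in> K"
    then have "(3 + 3 * cmod z) ^ n \<le> (3 + 3 * R) ^ n" using R by (intro power_mono) auto
    then have "cmod (poly (gb n) z) \<le> (3 + 3 * R) ^ n" using cmod_poly_gb_le[of n z] by linarith
    then show "norm (a n * poly (gb n) z) \<le> cmod (a n) * (3 + 3 * R) ^ n" by (simp add: norm_mult mult_left_mono)
  next
    show "summable (\<lambda>n. cmod (a n) * (3 + 3 * R) ^ n)"
      by (rule expo_summable[OF assms, of _ "3 + 3 * R"]) (use R in auto)
  qed
  then have "uniform_limit K (\<lambda>m z. \<Sum>n<Suc m. a n * poly (gb n) z) (gsum a) sequentially"
    unfolding uniform_limit_iff by (subst (asm) eventually_sequentially_Suc[symmetric])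
  then show "uniform_limit K (\<lambda>m z. \<Sum>n\<le>m. a n * poly (gb n) z) (gsum a) sequentially"
    by (simp only: lessThan_Suc_atMost)
qed

lemma continuous_gsum: 
  assumes "expo a" shows "continuous_on UNIV (gsum a)"
proof -
  have "continuous_on (cball 0 r) (gsum a)" for r
    using gsum_expansion[OF assms, unfolded has_gegenbauer_expansion_def, rule_format, OF compact_cball[of 0 r]]
    by (rule uniform_limit_theorem[rotated]) (auto intro!: always_eventually continuous_intros)
  then have "continuous_on (ball 0 r) (gsum a)" for r using continuous_on_subset ball_subset_cball by blast
  then have "isCont (gsum a) z" for z
    using continuous_on_interior[of "ball 0 (cmod z + 1)" "gsum a" z] by simp
  then show ?thesis by (simp add: continuous_on_eq_continuous_at)
qed

text \<open>Uniform convergence on [-2, 2] passes through the integral by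
  \<open>semicircle_bound\<close>.\<close>

lemma semicircle_gsum:
  assumes "expo a"
  shows "semicircle (gsum a) = (\<Sum>n. a n * of_real (cT 0 n))"
proof -
  define q where "q m = (\<Sum>n\<le>m. Polynomial.smult (a n) (gb n))" for m
  have "(\<lambda>m. sc (q m)) \<longlonglongrightarrow> semicircle (gsum a)"
  proof (rule LIMSEQ_I)
    fix e :: real assume e: "0 < e"
    define I where "I = complex_of_real ` {-2..2}"
    have "compact I" unfolding I_def by (intro compact_continuous_image continuous_intros) auto
    moreover have "0 < e / 8" using e by simp
    ultimately have "\<forall>\<^sub>F m in sequentially. \<forall>x\<in>I. dist (\<Sum>n\<le>m. a n * poly (gb n) x) (gsum a x) < e / 8"
      using gsum_expansion[OF assms] unfolding has_gegenbauer_expansion_def uniform_limit_iff by blast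
    then obtain M where M: "\<And>m x. m \<ge> M \<Longrightarrow> x \<in> I \<Longrightarrow> dist (\<Sum>n\<le>m. a n * poly (gb n) x) (gsum a x) < e / 8"
      unfolding eventually_sequentially by blast
    show "\<exists>M. \<forall>m\<ge>M. norm (sc (q m) - semicircle (gsum a)) < e"
    proof (intro exI[of _ M] allI impI)
      fix m assume m: "m \<ge> M"
      have "semicircle (\<lambda>x. poly (q m) x + (-1) * gsum a x) = sc (q m) + (-1) * semicircle (gsum a)"
        by (subst semicircle_add) (auto simp: semicircle_cmult[of "-1", simplified] intro!: continuous_intros continuous_gsum assms)
      moreover have "cmod (semicircle (\<lambda>x. poly (q m) x + (-1) * gsum a x)) \<le> 4 * (e / 8)"
      proof (rule semicircle_bound)
        show "continuous_on UNIV (\<lambda>x. poly (q m) x + (-1) * gsum a x)" by (intro continuous_intros continuous_gsum assms)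
        fix x :: real assume "-2 \<le> x" "x \<le> 2"
        then have "complex_of_real x \<in> I" unfolding I_def by auto
        then show "cmod (poly (q m) (of_real x) + (-1) * gsum a (of_real x)) \<le> e / 8"
          using M[OF m, of "of_real x"] by (simp add: q_def poly_sum dist_norm)
      qed
      ultimately show "norm (sc (q m) - semicircle (gsum a)) < e" using e by simp
    qed
  qed
  moreover have "sc (q m) = (\<Sum>n\<le>m. a n * of_real (cT 0 n))" for m
    unfolding q_def sc_sum sc_smult sc_gb ..
  ultimately have "(\<lambda>m. \<Sum>n\<le>m. a n * of_real (cT 0 n)) \<longlonglongrightarrow> semicircle (gsum a)" by (simp only:)
  then show ?thesis using sums_unique unfolding sums_def_le[symmetric] by blast
qed

section \<open>The extension of \<open>T\<close>\<close>

text \<open>The transpose of \<open>tau\<close>, which is how \<open>T\<close> acts on coefficient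
  sequences.\<close>

definition tauT :: "(nat \<Rightarrow> complex) \<Rightarrow> nat \<Rightarrow> complex" where
  "tauT a l = (\<Sum>n. a n * of_real (tau n l))"

lemma tau_le: "tau n l \<le> 128 ^ n"
proof (cases "l < n")
  case True
  then have "tau n l \<le> (\<Sum>l<n. tau n l)" by (intro member_le_sum) (auto simp: tau_nonneg)
  then show ?thesis using sum_tau[of n] by linarith
qed (simp add: tau_eq_0)

lemma expo_tauT: "expo a \<Longrightarrow> expo (tauT a)"
  unfolding tauT_def by (rule expo_kernel[where C = 128]) (auto simp: tau_nonneg tau_le tau_eq_0)

lemma summable_tauT: "expo a \<Longrightarrow> summable (\<lambda>n. norm (a n * of_real (tau n l)))"
  by (rule summable_expo_kernel[where C = 128]) (auto simp: tau_nonneg tau_le)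

definition gweight :: "real \<Rightarrow> nat \<Rightarrow> real" where
  "gweight K l = (if l = 0 then 1 else (real l / K) powr (1 / 2 * real l))"

lemma gweight_pos: "K > 0 \<Longrightarrow> gweight K l > 0"
  by (simp add: gweight_def)

text \<open>Take square roots in x^l / l! \<le> exp x at x = l/K.\<close>

lemma gweight_le:
  assumes K: "K > 0" and l: "l \<le> n"
  shows "gweight K l \<le> sqrt (fact n) * exp (1 / (2 * K)) ^ n"
proof -
  define E where "E = exp (1 / (2 * K))"
  have E1: "1 \<le> E" using K by (simp add: E_def)
  have "gweight K l \<le> sqrt (fact l) * E ^ l"
  proof (cases "l = 0")
    case False
    define x where "x = real l / K"
    have x: "x > 0" using False K by (simp add: x_def)
    have "x ^ l / fact l \<le> exp x"
      using sum_le_suminf[OF summable_power_div_fact[of x], of "{l}"] x suminf_power_div_fact[of x] by simp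
    then have 1: "x ^ l \<le> fact l * exp x" by (simp add: field_simps)
    have "exp x = (E ^ l)\<^sup>2"
    proof -
      have "(E ^ l)\<^sup>2 = exp (1 / (2 * K)) ^ (2 * l)" by (simp add: E_def power_mult[symmetric] mult.commute)
      also have "\<dots> = exp (real (2 * l) * (1 / (2 * K)))" by (rule exp_of_nat_mult[symmetric])
      also have "real (2 * l) * (1 / (2 * K)) = x" using K by (simp add: x_def field_simps)
      finally show ?thesis by simp
    qed
    then have "sqrt (x ^ l) \<le> sqrt (fact l) * E ^ l"
      using real_sqrt_le_mono[OF 1] E1 by (simp add: real_sqrt_mult)
    moreover have "gweight K l = sqrt (x ^ l)"
    proof -
      have "gweight K l = x powr (real l * (1 / 2))" using False by (simp add: gweight_def x_def)
      also have "\<dots> = (x powr real l) powr (1 / 2)" by (simp only: powr_powr)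
      also have "\<dots> = sqrt (x ^ l)" using x by (simp add: powr_realpow powr_half_sqrt)
      finally show ?thesis .
    qed
    ultimately show ?thesis by simp
  qed (simp add: gweight_def)
  also have "\<dots> \<le> sqrt (fact n) * E ^ n"
    using l E1 by (intro mult_mono power_increasing) (auto intro: fact_mono)
  finally show ?thesis by (simp add: E_def)
qed

lemma summable_power_div_sqrt_fact:
  fixes Q :: real assumes "0 \<le> Q"
  shows "summable (\<lambda>n. Q ^ n / sqrt (fact n))"
\<comment> \<open>Successive terms have ratio Q / sqrt (n + 1), at most 1/2 once 4 Q^2 \<le> n +
  1.\<close>
proof (rule summable_ratio_test[where c = "1/2" and N = "nat \<lceil>4 * Q\<^sup>2\<rceil>"])
  fix n assume n: "nat \<lceil>4 * Q\<^sup>2\<rceil> \<le> n"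
  have "4 * Q\<^sup>2 \<le> real (Suc n)" using n by linarith
  then have "sqrt (4 * Q\<^sup>2) \<le> sqrt (real (Suc n))" by (rule real_sqrt_le_mono)
  then have 1: "2 * Q \<le> sqrt (real (Suc n))" using assms by (simp add: real_sqrt_mult)
  have 2: "sqrt (fact (Suc n)) = sqrt (real (Suc n)) * sqrt (fact n)"
    by (simp only: fact_Suc real_sqrt_mult)
  have "Q * (Q ^ n / (sqrt (real (Suc n)) * sqrt (fact n))) \<le> 1 / 2 * (Q ^ n / sqrt (fact n))"
  proof -
    have "Q / sqrt (real (Suc n)) \<le> 1 / 2" using 1 by (simp add: divide_le_eq)
    then have "Q / sqrt (real (Suc n)) * (Q ^ n / sqrt (fact n)) \<le> 1 / 2 * (Q ^ n / sqrt (fact n))"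
      using assms by (intro mult_right_mono) auto
    then show ?thesis by simp
  qed
  then show "norm (Q ^ Suc n / sqrt (fact (Suc n))) \<le> 1 / 2 * norm (Q ^ n / sqrt (fact n))"
    unfolding 2 using assms by simp
qed simp

lemma gegenbauer_norm_diff:
  assumes "has_gegenbauer_expansion b g" "has_gegenbauer_expansion c h"
  shows "gegenbauer_norm (1/2) K (\<lambda>t. g t - h t) = (SUP l. ennreal (gweight K l * cmod (b l - c l)))"
  unfolding gegenbauer_norm_def gegenbauer_coeff_eqI[OF has_gegenbauer_expansion_diff[OF assms]] gweight_def ..

lemma T_poly_gegenbauer_sum:
  "has_gegenbauer_expansion (\<lambda>l. \<Sum>n\<le>m. a n * of_real (tau n l))
     (poly (T_poly (\<Sum>n\<le>m. Polynomial.smult (a n) (gb n))))"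
proof -
  let ?c = "\<lambda>l. \<Sum>n\<le>m. a n * complex_of_real (tau n l)"
  have "T_poly (\<Sum>n\<le>m. Polynomial.smult (a n) (gb n)) = (\<Sum>n\<le>m. \<Sum>l<n. Polynomial.smult (a n * of_real (tau n l)) (gb l))"
    by (simp only: T_poly_sum T_poly_smult T_poly_gb smult_sum2 smult_smult)
  also have "\<dots> = (\<Sum>n\<le>m. \<Sum>l\<le>m. Polynomial.smult (a n * of_real (tau n l)) (gb l))"
    by (intro sum.cong refl sum.mono_neutral_left) (auto simp: tau_eq_0)
  also have "\<dots> = (\<Sum>l\<le>m. Polynomial.smult (?c l) (gb l))"
    by (subst sum.swap) (simp add: smult_sum)
  finally have "T_poly (\<Sum>n\<le>m. Polynomial.smult (a n) (gb n)) = (\<Sum>l\<le>m. Polynomial.smult (?c l) (gb l))" .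
  moreover have "(\<lambda>l. if l \<le> m then ?c l else 0) = ?c"
    by (auto simp: fun_eq_iff tau_eq_0 intro!: sum.neutral)
  ultimately show ?thesis using has_gegenbauer_expansion_poly[of m ?c] by simp
qed

text \<open>The function grows at most exponentially in |z|. The crude value 1 suffices, as its
  purpose is to exhibit one admissible \<open>K\<close>.\<close>

lemma quadratic_growth_gsum_le:
  assumes "expo a"
  shows "quadratic_growth (gsum a) \<le> 1"
proof -
  obtain A B where AB: "A \<ge> 0" "B \<ge> 0" "\<And>n. cmod (a n) \<le> A * B ^ n / fact n" using assms by (rule expoE) blast
  have bound: "cmod (gsum a z) \<le> A * exp (B * (3 + 3 * cmod z))" for z
  proof -
    let ?b = "3 + 3 * cmod z"
    have "summable (\<lambda>n. A * ((B * ?b) ^ n / fact n))" by (intro summable_mult summable_power_div_fact)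
    moreover have "norm (a n * poly (gb n) z) \<le> A * ((B * ?b) ^ n / fact n)" for n
    proof -
      have "cmod (a n) * cmod (poly (gb n) z) \<le> (A * B ^ n / fact n) * ?b ^ n"
        using AB by (intro mult_mono cmod_poly_gb_le) auto
      then show ?thesis by (simp add: norm_mult power_mult_distrib)
    qed
    ultimately have "cmod (gsum a z) \<le> (\<Sum>n. A * ((B * ?b) ^ n / fact n))"
      unfolding gsum_def by (intro norm_suminf_le)
    also have "\<dots> = A * exp (B * ?b)"
      by (simp only: suminf_mult[OF summable_power_div_fact] suminf_power_div_fact)
    finally show ?thesis .
  qed
  define c where "c = ln (A + 1)"
  have c: "0 \<le> c" using AB by (simp add: c_def)
  show ?thesis unfolding quadratic_growth_def
  proof (rule Limsup_bounded)
    show "\<forall>\<^sub>F z in at_infinity. (if gsum a z = 0 then - \<infinity> else ereal (ln (cmod (gsum a z)) / (cmod z)\<^sup>2)) \<le> 1"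
      unfolding eventually_at_infinity
    \<comment> \<open>Beyond this radius c + B (3 + 3|z|) \<le> (c + 6B)|z| \<le> |z|^2.\<close>
    proof (intro exI[of _ "1 + c + 6 * B"] allI impI)
      fix z :: complex assume z: "1 + c + 6 * B \<le> cmod z"
      then have z1: "1 \<le> cmod z" using c AB by linarith
      show "(if gsum a z = 0 then - \<infinity> else ereal (ln (cmod (gsum a z)) / (cmod z)\<^sup>2)) \<le> 1"
      proof (cases "gsum a z = 0")
        case False
        have "cmod (gsum a z) \<le> (A + 1) * exp (B * (3 + 3 * cmod z))"
          using bound[of z] by (simp add: distrib_right) (smt (verit) exp_gt_zero)
        then have "ln (cmod (gsum a z)) \<le> ln ((A + 1) * exp (B * (3 + 3 * cmod z)))" using False AB by simp
        also have "\<dots> = c + B * (3 + 3 * cmod z)" using AB by (simp add: ln_mult c_def)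
        also have "\<dots> \<le> (c + 6 * B) * cmod z"
        proof -
          have "c * 1 \<le> c * cmod z" "B * 1 \<le> B * cmod z" using z1 c AB by (intro mult_left_mono; simp)+
          then show ?thesis by (simp add: algebra_simps)
        qed
        also have "\<dots> \<le> cmod z * cmod z" using z by (intro mult_right_mono) auto
        finally have "ln (cmod (gsum a z)) \<le> (cmod z)\<^sup>2" by (simp add: power2_eq_square)
        then show ?thesis using z1 False by (simp add: divide_le_eq_1 one_ereal_def)
      qed simp
    qed
  qed
qed

text \<open>The bounds A B^n / n! and 128^n and the weight combine to the summable
  \<open>h n\<close>, uniformly in \<open>l\<close>, so the norms converge for every
  \<open>K > 0\<close>. Conversely, convergence in one admissible norm fixes every coefficient of
  the limit, and hence the function.\<close>

lemma T_entire_gsum: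
  assumes a: "expo a"
  shows "T_entire (gsum a) = gsum (tauT a)"
proof -
  obtain A B where AB: "A \<ge> 0" "B \<ge> 0" "\<And>n. cmod (a n) \<le> A * B ^ n / fact n" using a by (rule expoE) blast
  define c where "c m l = (\<Sum>n\<le>m. a n * complex_of_real (tau n l))" for m l
  define P where "P m = poly (T_poly (\<Sum>n\<le>m. Polynomial.smult (gegenbauer_coeff (gsum a) n) (gb n)))" for m
  have P: "has_gegenbauer_expansion (c m) (P m)" for m
    unfolding P_def c_def gegenbauer_coeff_eqI[OF gsum_expansion[OF a]] by (rule T_poly_gegenbauer_sum)
  have sm: "summable (\<lambda>n. a n * of_real (tau n l))" for l using summable_norm_cancel[OF summable_tauT[OF a]] .
  have clim: "(\<lambda>m. c m l) \<longlonglongrightarrow> tauT a l" for l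
    using sm[of l] unfolding c_def tauT_def by (rule summable_LIMSEQ')
  have lim: "(\<lambda>m. gegenbauer_norm (1/2) K (\<lambda>t. gsum (tauT a) t - P m t)) \<longlonglongrightarrow> 0" if K: "K > 0" for K
  proof -
    define E where "E = exp (1 / (2 * K))"
    define h where "h n = A * ((B * 128 * E) ^ n / sqrt (fact n))" for n
    have sh: "summable h" unfolding h_def by (intro summable_mult summable_power_div_sqrt_fact) (simp add: AB E_def)
    define tail where "tail m = (\<Sum>n. h (n + Suc m))" for m
    have tail0: "tail \<longlonglongrightarrow> 0"
    proof -
      have "(\<lambda>m. suminf h - (\<Sum>n<Suc m. h n)) \<longlonglongrightarrow> suminf h - suminf h"
        by (intro tendsto_diff tendsto_const LIMSEQ_Suc summable_LIMSEQ sh)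
      moreover have "tail = (\<lambda>m. suminf h - (\<Sum>n<Suc m. h n))"
        unfolding tail_def by (rule ext) (rule suminf_minus_initial_segment[OF sh])
      ultimately show ?thesis by simp
    qed
    have hb: "gweight K l * norm (a n * of_real (tau n l)) \<le> h n" for n l
    proof (cases "l < n")
      case True
      have "gweight K l * (cmod (a n) * tau n l) \<le> (sqrt (fact n) * E ^ n) * ((A * B ^ n / fact n) * 128 ^ n)"
        using True AB gweight_le[OF K, of l n] unfolding E_def[symmetric]
        by (intro mult_mono tau_le) (auto simp: tau_nonneg E_def)
      also have "\<dots> = h n * ((sqrt (fact n) * sqrt (fact n)) / fact n)"
        by (simp add: h_def power_mult_distrib field_simps)
      also have "\<dots> = h n" by simp
      finally show ?thesis by (simp add: norm_mult tau_nonneg)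
    qed (simp add: tau_eq_0 h_def AB E_def)
    have "gweight K l * cmod (tauT a l - c m l) \<le> tail m" for l m
    proof -
      have "tauT a l - c m l = (\<Sum>n. a (n + Suc m) * of_real (tau (n + Suc m) l))"
        using suminf_minus_initial_segment[OF sm[of l], of "Suc m"] unfolding tauT_def c_def lessThan_Suc_atMost ..
      also have "gweight K l * cmod \<dots> \<le> gweight K l * (\<Sum>n. norm (a (n + Suc m) * of_real (tau (n + Suc m) l)))"
        using summable_ignore_initial_segment[OF summable_tauT[OF a, of l], of "Suc m"] gweight_pos[OF K, of l]
        by (intro mult_left_mono summable_norm) auto
      also have "\<dots> = (\<Sum>n. gweight K l * norm (a (n + Suc m) * of_real (tau (n + Suc m) l)))"
        using suminf_mult[OF summable_ignore_initial_segment[OF summable_tauT[OF a, of l], of "Suc m"]] by simp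
      also have "\<dots> \<le> tail m" unfolding tail_def
        using summable_mult[OF summable_ignore_initial_segment[OF summable_tauT[OF a, of l], of "Suc m"]]
          summable_ignore_initial_segment[OF sh, of "Suc m"]
        by (intro suminf_le hb) auto
      finally show ?thesis .
    qed
    then have le: "gegenbauer_norm (1/2) K (\<lambda>t. gsum (tauT a) t - P m t) \<le> ennreal (tail m)" for m
      unfolding gegenbauer_norm_diff[OF gsum_expansion[OF expo_tauT[OF a]] P]
      by (intro SUP_least ennreal_leI)
    show ?thesis
    proof (rule tendsto_sandwich[where f = "\<lambda>_. 0" and h = "\<lambda>m. ennreal (tail m)"])
      show "(\<lambda>m. ennreal (tail m)) \<longlonglongrightarrow> 0" using tendsto_ennrealI[OF tail0] by simp
    qed (auto intro!: always_eventually le)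
  qed
  show ?thesis unfolding T_entire_def P_def[symmetric]
  proof (rule the_equality, intro conjI exI allI impI)
    show "has_gegenbauer_expansion (tauT a) (gsum (tauT a))" by (rule gsum_expansion[OF expo_tauT[OF a]])
    show "(\<lambda>m. gegenbauer_norm (1/2) K (\<lambda>t. gsum (tauT a) t - P m t)) \<longlonglongrightarrow> 0" if "K > 0" for K using lim[OF that] .
  next
    fix g
    assume "(\<exists>b. has_gegenbauer_expansion b g) \<and>
        (\<forall>K>0. ereal (8 * exp 1) * quadratic_growth (gsum a) < ereal K \<longrightarrow>
           (\<lambda>m. gegenbauer_norm (1/2) K (\<lambda>t. g t - P m t)) \<longlonglongrightarrow> 0)"
    then obtain b where b: "has_gegenbauer_expansion b g" and
      g: "\<And>K. K > 0 \<Longrightarrow> ereal (8 * exp 1) * quadratic_growth (gsum a) < ereal K \<Longrightarrow>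
           (\<lambda>m. gegenbauer_norm (1/2) K (\<lambda>t. g t - P m t)) \<longlonglongrightarrow> 0" by blast
    \<comment> \<open>Admissible, since it exceeds 8e times the growth bound 1.\<close>
    define K where "K = 8 * exp 1 + (1 :: real)"
    have K: "K > 0" by (simp add: K_def add_pos_pos)
    have "ereal (8 * exp 1) * quadratic_growth (gsum a) \<le> ereal (8 * exp 1) * 1"
      by (intro ereal_mult_left_mono quadratic_growth_gsum_le a) simp
    also have "\<dots> < ereal K" by (simp add: K_def)
    finally have "(\<lambda>m. gegenbauer_norm (1/2) K (\<lambda>t. g t - P m t)) \<longlonglongrightarrow> 0" using g[OF K] by blast
    then have lim: "(\<lambda>m. SUP l. ennreal (gweight K l * cmod (b l - c m l))) \<longlonglongrightarrow> 0"
      unfolding gegenbauer_norm_diff[OF b P] .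
    have "b l = tauT a l" for l
    proof -
      have "(\<lambda>m. ennreal (gweight K l * cmod (b l - c m l))) \<longlonglongrightarrow> 0"
        by (rule tendsto_sandwich[OF _ _ tendsto_const lim]) (auto intro!: always_eventually SUP_upper)
      then have "(\<lambda>m. gweight K l * cmod (b l - c m l)) \<longlonglongrightarrow> 0"
        using gweight_pos[OF K, of l] by (subst (asm) ennreal_tendsto_0_iff) auto
      then have "(\<lambda>m. gweight K l * cmod (b l - c m l)) \<longlonglongrightarrow> gweight K l * 0" by simp
      then have "(\<lambda>m. cmod (b l - c m l)) \<longlonglongrightarrow> 0"
        using gweight_pos[OF K, of l] by (subst (asm) tendsto_mult_left_iff) auto
      then have "(\<lambda>m. b l - c m l) \<longlonglongrightarrow> 0" by (simp only: tendsto_norm_zero_iff)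
      moreover have "(\<lambda>m. b l - c m l) \<longlonglongrightarrow> b l - tauT a l" by (intro tendsto_diff tendsto_const clim)
      ultimately have "b l - tauT a l = 0" using LIMSEQ_unique by blast
      then show ?thesis by simp
    qed
    then have "b = tauT a" by auto
    with b have "(\<lambda>n. tauT a n * poly (gb n) z) sums g z" for z using has_gegenbauer_expansion_sums by blast
    then show "g = gsum (tauT a)" using sums_unique by (fastforce simp: gsum_def)
  qed
qed

text \<open>\<open>tauT\<close> moves \<open>T\<close> onto the coefficients, while
  \<open>cT\<close> applies the same matrix to the functionals; exchanging the two summations passes
  from one to the other.\<close>

lemma alpha_gsum: "expo a \<Longrightarrow> alpha k (gsum a) = (\<Sum>n. a n * of_real (cT k n))"
proof (induction k arbitrary: a)
  case 0
  then show ?case using semicircle_gsum by (simp add: alpha_def)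
next
  case (Suc k)
  have "alpha (Suc k) (gsum a) = alpha k (gsum (tauT a))"
    unfolding alpha_def funpow_Suc_right o_apply T_entire_gsum[OF Suc.prems] ..
  also have "\<dots> = (\<Sum>l. tauT a l * of_real (cT k l))" by (rule Suc.IH[OF expo_tauT[OF Suc.prems]])
  also have "\<dots> = (\<Sum>n. a n * (\<Sum>l<Suc n. of_real (tau n l) * of_real (cT k l)))"
    unfolding tauT_def
  proof (rule sums_unique[symmetric], rule kernel_sums_swap[where C = 128 and D = "128 ^ k"])
    show "(\<Sum>l<Suc n. tau n l) \<le> 128 ^ n" for n using sum_tau[of n] by (simp add: tau_eq_0)
    show "norm (complex_of_real (cT k l)) \<le> (128 ^ k) ^ l" for l using cT_le[of k l] by (simp add: cT_nonneg)
  qed (use Suc.prems in \<open>auto simp: tau_nonneg tau_eq_0\<close>)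
  also have "\<dots> = (\<Sum>n. a n * of_real (cT (Suc k) n))" by (simp add: tau_eq_0)
  finally show ?case .
qed

section \<open>The Gegenbauer expansion of the exponential\<close>

text \<open>The recurrence coefficients (n + 1)/(n + 2) and (n + 3)/(n + 2) are positive with sum 2.
  Consequently powers of t have coefficient sums at most 2^m.\<close>

lemma gcone_pX_mult_gb: "gcone 2 (n + 2) (pX * gb n)"
proof -
  have ne: "complex_of_real (real (n + 2)) \<noteq> 0" 
  proof -
    have "n + 2 \<noteq> 0" by simp
    then show ?thesis by (simp only: of_real_eq_0_iff of_nat_eq_0_iff not_False_eq_True)
  qed
  have "Polynomial.smult (1 / of_real (real (n + 2))) (of_nat (n + 2) * (pX * gb n)) =
    Polynomial.smult (1 / of_real (real (n + 2))) (of_nat (n + 1) * gb (Suc n) + of_nat (n + 3) * gbm n)"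
    unfolding t_mult_gb ..
  then have eq: "pX * gb n = Polynomial.smult (of_real (real (n + 1) / real (n + 2))) (gb (Suc n)) + Polynomial.smult (of_real (real (n + 3) / real (n + 2))) (gbm n)"
    unfolding of_nat_mult_poly smult_add_right smult_smult using ne by (simp add: field_simps)
  have 1: "gcone (real (n + 1) / real (n + 2) * 1) (n + 2) (Polynomial.smult (of_real (real (n + 1) / real (n + 2))) (gb (Suc n)))"
    by (intro gcone_smult gcone_gb) auto
  have 2: "gcone (2 - real (n + 1) / real (n + 2) * 1) (n + 2) (Polynomial.smult (of_real (real (n + 3) / real (n + 2))) (gbm n))"
  proof (cases n)
    case 0
    then show ?thesis by (simp add: gbm_def gcone_0)
  next
    case (Suc k)
    have "gcone (real (n + 3) / real (n + 2) * 1) (n + 2) (Polynomial.smult (of_real (real (n + 3) / real (n + 2))) (gbm n))"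
      using Suc by (intro gcone_smult) (auto simp: gbm_def gcone_gb)
    moreover have "real (n + 3) / real (n + 2) * 1 = 2 - real (n + 1) / real (n + 2) * 1" by (simp add: field_simps)
    ultimately show ?thesis by (simp only:)
  qed
  show ?thesis using gcone_add[OF 1 2] unfolding eq by simp
qed

lemma gcone_pX_power: "gcone (2 ^ m) (Suc m) (pX ^ m)"
proof (induction m)
  case 0
  then show ?case using gcone_gb[of 0 1] by (simp add: gb_0)
next
  case (Suc m)
  have "gcone (2 * 2 ^ m) (Suc (Suc m)) (pX * pX ^ m)"
  proof (rule gcone_linear[OF _ _ _ Suc.IH])
    fix l assume "l < Suc m"
    then show "gcone 2 (Suc (Suc m)) (pX * gb l)" using gcone_mono[OF gcone_pX_mult_gb[of l]] by simp
  qed (auto simp: distrib_left)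
  then show ?case by simp
qed

text \<open>Powers t^n expand in the basis with a nonnegative triangular kernel of row sums at most
  2^n, so the exponential series may be regrouped by basis index.\<close>

lemma exp_eq_gsum: "\<exists>a. expo a \<and> (\<lambda>t. exp (s * t)) = gsum a"
proof -
  have "\<exists>c :: nat \<Rightarrow> real. (\<forall>l. 0 \<le> c l) \<and> (\<forall>l\<ge>Suc m. c l = 0) \<and> (\<Sum>l<Suc m. c l) \<le> 2 ^ m \<and>
     pX ^ m = (\<Sum>l<Suc m. Polynomial.smult (of_real (c l)) (gb l))" for m
    using gcone_pX_power[of m] unfolding gcone_def .
  then obtain w :: "nat \<Rightarrow> nat \<Rightarrow> real" where w: "\<And>m l. 0 \<le> w m l" "\<And>m l. Suc m \<le> l \<Longrightarrow> w m l = 0"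
    "\<And>m. (\<Sum>l<Suc m. w m l) \<le> 2 ^ m" "\<And>m. pX ^ m = (\<Sum>l<Suc m. Polynomial.smult (of_real (w m l)) (gb l))"
    by metis
  define e where "e n = s ^ n / fact n" for n
  have e: "expo e" unfolding expo_def e_def
    by (rule exI[of _ 1], intro conjI, simp, rule exI[of _ "cmod s"]) (auto simp: norm_divide norm_power)
  have w2: "w m l \<le> 2 ^ m" for m l
  proof (cases "l < Suc m")
    case True
    then have "w m l \<le> (\<Sum>l<Suc m. w m l)" by (intro member_le_sum) (auto simp: w(1))
    then show ?thesis using w(3)[of m] by linarith
  qed (simp add: w(2))
  let ?a = "\<lambda>l. \<Sum>n. e n * of_real (w n l)"
  have "expo ?a" by (rule expo_kernel[OF e, of _ 2]) (auto simp: w(1,2) w2)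
  moreover have "exp (s * z) = gsum ?a z" for z
  proof -
    have "(\<lambda>l. ?a l * poly (gb l) z) sums (\<Sum>n. e n * (\<Sum>l<Suc n. of_real (w n l) * poly (gb l) z))"
      by (rule kernel_sums_swap[OF e, where C = 2 and D = "3 + 3 * cmod z"])
        (auto simp: w(1,2) w(3)[simplified] cmod_poly_gb_le)
    moreover have "(\<Sum>l<Suc n. of_real (w n l) * poly (gb l) z) = z ^ n" for n
    proof -
      have "poly (pX ^ n) z = (\<Sum>l<Suc n. of_real (w n l) * poly (gb l) z)"
        unfolding w(4)[of n] poly_sum by simp
      then show ?thesis by (simp add: pX_def)
    qed
    moreover have "(\<Sum>n. e n * z ^ n) = exp (s * z)"
      by (simp add: e_def exp_def power_mult_distrib scaleR_conv_of_real divide_inverse mult_ac)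
    ultimately show ?thesis unfolding gsum_def by (simp add: sums_unique)
  qed
  ultimately show ?thesis by blast
qed

section \<open>Measures satisfying the moment recursion\<close>

lemma sum_le_sums:
  fixes f :: "nat \<Rightarrow> real"
  assumes "f sums x" "\<And>n. 0 \<le> f n" "finite I"
  shows "sum f I \<le> x"
  using sum_le_suminf[OF sums_summable[OF assms(1)] assms(3)] assms(2) sums_unique[OF assms(1)] by simp

text \<open>To be applied with \<open>\<epsilon>\<close> = 1/N^2. The bound by 1 makes the growth
  estimate of the moments independent of \<open>\<epsilon>\<close>.\<close>

locale moment_recursion = prob_space \<nu> for \<nu> :: "real measure" +
  fixes \<epsilon> :: real
  assumes sets_eq: "sets \<nu> = sets borel"
    and moment_integrable: "integrable \<nu> (\<lambda>t. t ^ n)"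
    and eps_nonneg: "0 \<le> \<epsilon>" and eps_le: "\<epsilon> \<le> 1"
    and recursion: "real k * real (k + 2) * (LINT t|\<nu>. t ^ k) =
      4 * (if k \<ge> 2 then real k * real (k - 1) * (LINT t|\<nu>. t ^ (k - 2)) else 0) +
      \<epsilon> * (if k \<ge> 4 then real k * real (k - 1) * real (k - 2) * real (k - 3) * (LINT t|\<nu>. t ^ (k - 4)) else 0)"
begin

definition moment :: "nat \<Rightarrow> real" where "moment k = (LINT t|\<nu>. t ^ k)"

definition mean :: "complex poly \<Rightarrow> complex" where "mean p = (LINT t|\<nu>. poly p (of_real t))"

lemma integrable_poly: "integrable \<nu> (\<lambda>t. poly p (complex_of_real t))"
proof -
  have "integrable \<nu> (\<lambda>t. complex_of_real (t ^ n))" for n by (intro integrable_of_real moment_integrable)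
  then show ?thesis unfolding poly_altdef by (auto intro!: Bochner_Integration.integrable_sum integrable_mult_right simp flip: of_real_power)
qed

lemma mean_add: "mean (p + q) = mean p + mean q"
  unfolding mean_def poly_add by (intro Bochner_Integration.integral_add integrable_poly)

lemma mean_smult: "mean (Polynomial.smult c p) = c * mean p"
  unfolding mean_def poly_smult by simp

lemma mean_sum: "mean (\<Sum>i\<in>I. p i) = (\<Sum>i\<in>I. mean (p i))"
  unfolding mean_def poly_sum by (intro Bochner_Integration.integral_sum integrable_poly)

lemma mean_monom: "mean (monom 1 k) = of_real (moment k)"
proof -
  have "mean (monom 1 k) = (LINT t|\<nu>. complex_of_real (t ^ k))" by (simp add: mean_def poly_monom)
  then show ?thesis unfolding moment_def integral_complex_of_real .
qed

lemma moment_0: "moment 0 = 1"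
  unfolding moment_def using prob_space by simp

lemma mean_const: "mean [:c:] = c"
proof -
  have "mean [:1:] = 1" using mean_monom[of 0] by (simp add: moment_0 monom_0)
  then show ?thesis using mean_smult[of c "[:1:]"] by simp
qed

lemma mean_S_op: "mean (S_op h) = of_real \<epsilon> * mean (pderiv (pderiv (pderiv h)))"
proof -
  have mon: "mean (S_op (monom 1 j)) = of_real \<epsilon> * mean (pderiv (pderiv (pderiv (monom 1 j))))" for j
  proof -
    have "S_op (monom 1 j) = Polynomial.smult (of_real (real (j + 3))) (monom 1 (Suc j)) + Polynomial.smult (of_real (- 4 * real j)) (monom 1 (j - 1))"
      by (cases j) (simp_all add: S_op_def pderiv_monom poly_eq_iff coeff_pCons algebra_simps split: nat.split)
    then have "mean (S_op (monom 1 j)) = of_real (real (j + 3) * moment (Suc j) - 4 * real j * moment (j - 1))"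
      by (simp only: mean_add mean_smult mean_monom) simp
    also have "real (j + 3) * moment (Suc j) - 4 * real j * moment (j - 1) = \<epsilon> * (if j \<ge> 3 then real j * real (j - 1) * real (j - 2) * moment (j - 3) else 0)"
    proof -
      \<comment> \<open>The recursion at index j + 1 carries a common factor j + 1, which is
        cancelled here.\<close>
      have "real (Suc j) * (real (j + 3) * moment (Suc j)) = 
        real (Suc j) * (4 * real j * moment (j - 1) + \<epsilon> * (if j \<ge> 3 then real j * real (j - 1) * real (j - 2) * moment (j - 3) else 0))"
        using recursion[of "Suc j"] unfolding moment_def[symmetric]
        by (cases "j = 0") (auto simp: algebra_simps numeral_eq_Suc)
      then show ?thesis by (simp only: mult_cancel_left) simp
    qed
    also have "complex_of_real \<dots> = of_real \<epsilon> * mean (pderiv (pderiv (pderiv (monom 1 j))))"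
    proof -
      have "pderiv (pderiv (pderiv (monom (1 :: complex) j))) = Polynomial.smult (of_real (if j \<ge> 3 then real j * real (j - 1) * real (j - 2) else 0)) (monom 1 (j - 3))"
        by (auto simp: pderiv_monom smult_monom numeral_eq_Suc mult_ac not_le less_Suc_eq)
      then show ?thesis by (simp only: mean_smult mean_monom) simp
    qed
    finally show ?thesis .
  qed
  have hs: "h = (\<Sum>i\<le>degree h. Polynomial.smult (coeff h i) (monom 1 i))"
    by (simp add: smult_monom poly_as_sum_of_monoms)
  have S0: "S_op 0 = 0" by (simp add: S_op_def)
  have Ss: "S_op (\<Sum>i\<in>I. p i) = (\<Sum>i\<in>I. S_op (p i))" for I :: "nat set" and p
    by (induction I rule: infinite_finite_induct) (simp_all add: S0 S_op_add)
  have "mean (S_op h) = (\<Sum>i\<le>degree h. coeff h i * mean (S_op (monom 1 i)))"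
    by (subst hs) (simp only: Ss S_op_smult mean_sum mean_smult)
  moreover have "mean (pderiv (pderiv (pderiv h))) = (\<Sum>i\<le>degree h. coeff h i * mean (pderiv (pderiv (pderiv (monom 1 i)))))"
    by (subst hs) (simp only: pderiv_sum pderiv_smult mean_sum mean_smult)
  ultimately show ?thesis unfolding mon by (simp add: sum_distrib_left mult_ac)
qed

lemma mean_T_poly: "mean g = sc g + of_real \<epsilon> * mean (T_poly g)"
proof -
  have "mean g = mean [:sc g:] + mean (S_op (S_poly g))" by (subst S_poly_eq) (simp only: mean_add)
  then show ?thesis by (simp only: mean_const mean_S_op T_poly_eq)
qed

definition gmean :: "nat \<Rightarrow> real" where "gmean n = (\<Sum>k\<le>n. \<epsilon> ^ k * cT k n)"

text \<open>Iterating \<open>mean_T_poly\<close> stops after finitely many steps, because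
  \<open>T\<close> lowers the index.\<close>

lemma mean_gb: "mean (gb n) = of_real (gmean n)"
proof (induction n rule: less_induct)
  case (less n)
  have "mean (gb n) = of_real (cT 0 n) + of_real \<epsilon> * (\<Sum>l<n. of_real (tau n l) * mean (gb l))"
    by (subst mean_T_poly) (simp only: sc_gb T_poly_gb mean_sum mean_smult)
  also have "(\<Sum>l<n. complex_of_real (tau n l) * mean (gb l)) = of_real (\<Sum>l<n. tau n l * gmean l)"
    using less by simp
  finally have "mean (gb n) = of_real (cT 0 n + \<epsilon> * (\<Sum>l<n. tau n l * gmean l))" by simp
  also have "(\<Sum>l<n. tau n l * gmean l) = (\<Sum>l<n. \<Sum>k<n. tau n l * (\<epsilon> ^ k * cT k l))"
  proof (rule sum.cong[OF refl])
    fix l assume "l \<in> {..<n}"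
    then have "gmean l = (\<Sum>k<n. \<epsilon> ^ k * cT k l)"
      unfolding gmean_def by (intro sum.mono_neutral_left) (auto simp: cT_eq_0)
    then show "tau n l * gmean l = (\<Sum>k<n. tau n l * (\<epsilon> ^ k * cT k l))" by (simp add: sum_distrib_left)
  qed
  also have "\<dots> = (\<Sum>k<n. \<epsilon> ^ k * cT (Suc k) n)"
    by (subst sum.swap) (simp add: sum_distrib_left mult_ac)
  also have "cT 0 n + \<epsilon> * (\<Sum>k<n. \<epsilon> ^ k * cT (Suc k) n) = gmean n"
    unfolding gmean_def sum.atMost_shift by (simp add: sum_distrib_left mult_ac)
  finally show ?case .
qed

section \<open>Growth of moments and exponential integrability\<close>

lemma moment_even_nonneg: "0 \<le> moment (2 * q)"
  unfolding moment_def by (intro integral_nonneg_AE) auto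

text \<open>A crude estimate is enough: division by (2q)! \<ge> (q!)^2 still leaves a factor 1/q!,
  so all exponential moments exist.\<close>

lemma moment_even_le: "moment (2 * q) \<le> 8 ^ q * fact q"
proof (induction q rule: less_induct)
  case (less q)
  show ?case
  proof (cases q)
    case 0 then show ?thesis by (simp add: moment_0)
  next
    case q: (Suc p)
    show ?thesis
    proof (cases p)
      case 0
      have "moment 2 = moment 0" using recursion[of 2] by (simp add: moment_def)
      then show ?thesis by (simp add: q 0 moment_0)
    next
      case p: (Suc r)
      let ?r = "real r"
      have nn: "0 \<le> moment (2 * Suc r)" "0 \<le> moment (2 * r)" by (rule moment_even_nonneg)+
      have "real (2 * r + 4) * real (2 * r + 6) * moment (2 * r + 4) = 4 * (real (2 * r + 4) * real (2 * r + 3) * moment (2 * r + 2)) +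
        \<epsilon> * (real (2 * r + 4) * real (2 * r + 3) * real (2 * r + 2) * real (2 * r + 1) * moment (2 * r))"
        using recursion[of "2 * r + 4"] by (simp add: moment_def numeral_eq_Suc)
      then have "real (2 * r + 4) * (real (2 * r + 6) * moment (2 * r + 4)) = real (2 * r + 4) * (real (2 * r + 3) * (4 * moment (2 * r + 2) +
        \<epsilon> * (real (2 * r + 2) * real (2 * r + 1) * moment (2 * r))))" by (simp only: distrib_left mult_ac)
      then have eq: "real (2 * r + 6) * moment (2 * r + 4) = real (2 * r + 3) * (4 * moment (2 * r + 2) +
        \<epsilon> * (real (2 * r + 2) * real (2 * r + 1) * moment (2 * r)))" by (simp only: mult_cancel_left) simp
      define Y where "Y = real (2 * r + 2) * real (2 * r + 1) * moment (2 * r)"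
      have Y: "0 \<le> Y" unfolding Y_def using nn by (intro mult_nonneg_nonneg) auto
      have "4 * moment (2 * r + 2) + \<epsilon> * Y \<le> 4 * moment (2 * r + 2) + Y"
        using mult_right_mono[OF eps_le Y] by simp
      then have "real (2 * r + 6) * moment (2 * r + 4) \<le> real (2 * r + 6) * (4 * moment (2 * r + 2) + Y)"
        unfolding eq Y_def[symmetric] using nn Y eps_nonneg by (intro mult_mono) auto
      then have "moment (2 * r + 4) \<le> 4 * moment (2 * r + 2) + real (2 * r + 2) * real (2 * r + 1) * moment (2 * r)"
        unfolding Y_def by (simp only: mult_le_cancel_left_pos of_nat_0_less_iff)
      also have "\<dots> \<le> 4 * (8 ^ Suc r * fact (Suc r)) + real (2 * r + 2) * real (2 * r + 1) * (8 ^ r * fact r)"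
        using less[of "Suc r"] less[of r] q p by (intro add_mono mult_left_mono) auto
      also have "\<dots> = (8 ^ r * fact r) * (32 * (?r + 1) + (2 * ?r + 2) * (2 * ?r + 1))" by (simp add: algebra_simps)
      \<comment> \<open>64 = 8^2 and (r + 2)(r + 1) are what the claimed bound gains from index r to
        r + 2.\<close>
      also have "\<dots> \<le> (8 ^ r * fact r) * (64 * (?r + 2) * (?r + 1))"
      proof (intro mult_left_mono)
        have "0 \<le> ?r * ?r" by simp
        then show "32 * (?r + 1) + (2 * ?r + 2) * (2 * ?r + 1) \<le> 64 * (?r + 2) * (?r + 1)"
          by (simp add: algebra_simps)
      qed auto
      also have "\<dots> = 8 ^ q * fact q" by (simp add: q p algebra_simps)
      finally have "moment (2 * r + 4) \<le> 8 ^ q * fact q" .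
      moreover have "2 * q = 2 * r + 4" by (simp add: q p)
      ultimately show ?thesis by (simp only:)
    qed
  qed
qed

text \<open>exp (c|t|) is at most 2 cosh (ct), whose series has nonnegative terms and involves even
  moments only.\<close>

lemma integrable_exp_abs: "integrable \<nu> (\<lambda>t. exp (c * \<bar>t\<bar>))" if c: "0 \<le> c"
proof -
  define f where "f q t = (c * t) ^ (2 * q) / fact (2 * q)" for q and t :: real
  have fs: "(\<lambda>q. f q t) sums cosh (c * t)" for t
  proof -
    have "strict_mono (\<lambda>q :: nat. 2 * q)" by (simp add: strict_mono_def)
    moreover have "n \<notin> range (\<lambda>q. 2 * q) \<Longrightarrow> (if even n then (c * t) ^ n /\<^sub>R fact n else 0) = 0" for n by auto
    ultimately have "(\<lambda>q. (if even (2 * q) then (c * t) ^ (2 * q) /\<^sub>R fact (2 * q) else 0)) sums cosh (c * t)"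
      using sums_mono_reindex[of "\<lambda>q. 2 * q" "\<lambda>n. (if even n then (c * t) ^ n /\<^sub>R fact n else 0)" "cosh (c * t)"] cosh_converges[of "c * t"] by blast
    then show ?thesis by (simp add: f_def divide_inverse mult.commute)
  qed
  have fnn: "0 \<le> f q t" for q t by (simp add: f_def)
  have fi: "integrable \<nu> (f q)" for q
    unfolding f_def power_mult_distrib by (intro integrable_divide_zero integrable_mult_right moment_integrable)
  have If: "(LINT t|\<nu>. f q t) = c ^ (2 * q) * moment (2 * q) / fact (2 * q)" for q
    unfolding f_def power_mult_distrib by (simp add: moment_def)
  have "integrable \<nu> (\<lambda>t. \<Sum>q. f q t)"
  proof (rule integrable_suminf)
    show "AE t in \<nu>. summable (\<lambda>q. norm (f q t))" using fs fnn by (intro AE_I2) (simp add: sums_iff)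
    show "summable (\<lambda>q. LINT t|\<nu>. norm (f q t))"
    proof (rule summable_comparison_test'[OF summable_power_div_fact[of "8 * c\<^sup>2"]])
      fix q :: nat
      have "fact q * fact q dvd (fact (q + q) :: nat)" by (rule fact_fact_dvd_fact)
      then have "fact q * fact q \<le> (fact (2 * q) :: nat)" by (intro dvd_imp_le) (simp_all add: mult_2)
      then have ff: "fact q * fact q \<le> (fact (2 * q) :: real)" by (metis of_nat_fact of_nat_le_iff of_nat_mult)
      have "c ^ (2 * q) * moment (2 * q) / fact (2 * q) \<le> c ^ (2 * q) * (8 ^ q * fact q) / (fact q * fact q)"
        using c ff moment_even_nonneg[of q] by (intro frac_le mult_left_mono moment_even_le mult_nonneg_nonneg) auto
      also have "\<dots> = (8 * c\<^sup>2) ^ q / fact q"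
      proof -
        have "x * (8 ^ q * fact q) / (fact q * fact q) = 8 ^ q * x / fact q" for x :: real by simp
        then show ?thesis by (simp only: power_mult power_mult_distrib)
      qed
      finally show "norm (LINT t|\<nu>. norm (f q t)) \<le> (8 * c\<^sup>2) ^ q / fact q"
        using fnn c moment_even_nonneg[of q] by (simp add: If)
    qed
  qed (rule fi)
  then have "integrable \<nu> (\<lambda>t. 2 * cosh (c * t))" using fs by (simp add: sums_iff)
  then show ?thesis
  proof (rule Bochner_Integration.integrable_bound)
    show "AE t in \<nu>. norm (exp (c * \<bar>t\<bar>)) \<le> norm (2 * cosh (c * t))"
    proof (rule AE_I2)
      fix t
      have "exp (c * \<bar>t\<bar>) \<le> 2 * cosh (c * t)" by (auto simp: cosh_def abs_if)
      then show "norm (exp (c * \<bar>t\<bar>)) \<le> norm (2 * cosh (c * t))" by simp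
    qed
    show "(\<lambda>t. exp (c * \<bar>t\<bar>)) \<in> borel_measurable \<nu>"
      unfolding measurable_cong_sets[OF sets_eq refl] by measurable
  qed
qed

text \<open>The absolute partial sums are dominated by the integrable \<open>F\<close>, via
  \<open>cmod_poly_gb_le\<close>. As the modulus of a mean is at most the mean of the modulus,
  summability passes on to \<open>gmean\<close>.\<close>

lemma gsum_mean:
  assumes a: "expo a"
  shows "integrable \<nu> (\<lambda>t. gsum a (of_real t))" and "summable (\<lambda>n. norm (a n) * gmean n)"
    and "(LINT t|\<nu>. gsum a (of_real t)) = (\<Sum>n. a n * of_real (gmean n))"
proof -
  obtain A B where AB: "A \<ge> 0" "B \<ge> 0" "\<And>n. cmod (a n) \<le> A * B ^ n / fact n" using a by (rule expoE) blast
  define f where "f n t = a n * poly (gb n) (complex_of_real t)" for n t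
  have fi: "integrable \<nu> (f n)" for n unfolding f_def by (intro integrable_mult_right integrable_poly)
  have If: "(LINT t|\<nu>. f n t) = a n * of_real (gmean n)" for n
    unfolding f_def mean_gb[symmetric] mean_def by simp
  define F where "F t = A * exp (3 * B) * exp (3 * B * \<bar>t\<bar>)" for t :: real
  have Fi: "integrable \<nu> F" unfolding F_def using AB by (intro integrable_mult_right integrable_exp_abs) auto
  have fb: "norm (f n t) \<le> A * ((B * (3 + 3 * \<bar>t\<bar>)) ^ n / fact n)" for n t
  proof -
    have "cmod (a n) * cmod (poly (gb n) (of_real t)) \<le> (A * B ^ n / fact n) * (3 + 3 * \<bar>t\<bar>) ^ n"
      using AB cmod_poly_gb_le[of n "of_real t"] by (intro mult_mono) auto
    then show ?thesis by (simp add: f_def norm_mult power_mult_distrib)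
  qed
  have Fs: "(\<lambda>n. A * ((B * (3 + 3 * \<bar>t\<bar>)) ^ n / fact n)) sums F t" for t
  proof -
    have "(\<lambda>n. (B * (3 + 3 * \<bar>t\<bar>)) ^ n / fact n) sums exp (B * (3 + 3 * \<bar>t\<bar>))"
      using summable_sums[OF summable_power_div_fact] unfolding suminf_power_div_fact .
    from sums_mult[OF this, of A] show ?thesis by (simp add: F_def distrib_left exp_add mult_ac)
  qed
  have ae: "AE t in \<nu>. summable (\<lambda>n. norm (f n t))"
  proof (rule AE_I2)
    fix t
    show "summable (\<lambda>n. norm (f n t))"
      by (rule summable_comparison_test'[OF sums_summable[OF Fs[of t]]]) (use fb[of _ t] in simp)
  qed
  have sm: "summable (\<lambda>n. LINT t|\<nu>. norm (f n t))"
  proof (rule summableI_nonneg_bounded)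
    fix k
    have "(\<Sum>n<k. LINT t|\<nu>. norm (f n t)) = (LINT t|\<nu>. (\<Sum>n<k. norm (f n t)))"
      by (intro Bochner_Integration.integral_sum[symmetric] integrable_norm fi)
    also have "\<dots> \<le> (LINT t|\<nu>. F t)"
    proof (rule integral_mono)
      fix t
      have "(\<Sum>n<k. norm (f n t)) \<le> (\<Sum>n<k. A * ((B * (3 + 3 * \<bar>t\<bar>)) ^ n / fact n))" by (intro sum_mono fb)
      also have "\<dots> \<le> F t" using AB by (intro sum_le_sums[OF Fs]) (auto intro!: mult_nonneg_nonneg divide_nonneg_nonneg zero_le_power)
      finally show "(\<Sum>n<k. norm (f n t)) \<le> F t" .
    qed (intro Bochner_Integration.integrable_sum integrable_norm fi Fi)+
    finally show "(\<Sum>n<k. LINT t|\<nu>. norm (f n t)) \<le> (LINT t|\<nu>. F t)" .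
  qed auto
  have gf: "gsum a (of_real t) = (\<Sum>n. f n t)" for t unfolding gsum_def f_def ..
  show "integrable \<nu> (\<lambda>t. gsum a (of_real t))" unfolding gf by (rule integrable_suminf[OF fi ae sm])
  show "(LINT t|\<nu>. gsum a (of_real t)) = (\<Sum>n. a n * of_real (gmean n))"
    unfolding gf integral_suminf[OF fi ae sm] If ..
  show "summable (\<lambda>n. norm (a n) * gmean n)"
  proof (rule summable_comparison_test'[OF sm])
    fix n
    have "norm (a n * of_real (gmean n)) \<le> (LINT t|\<nu>. norm (f n t))"
      unfolding If[symmetric] by (rule integral_norm_bound)
    then show "norm (norm (a n) * gmean n) \<le> (LINT t|\<nu>. norm (f n t))" by (simp add: norm_mult abs_mult)
  qed
qed

text \<open>Positivity does the work: \<open>gmean n\<close> is its own absolute sum over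
  \<open>k\<close>, so its summability against the moduli of \<open>a n\<close> justifies the
  interchange.\<close>

lemma gsum_series:
  assumes a: "expo a"
  shows "(\<lambda>k. of_real (\<epsilon> ^ k) * (\<Sum>n. a n * of_real (cT k n))) sums (LINT t|\<nu>. gsum a (of_real t))"
proof -
  have nn: "0 \<le> \<epsilon> ^ k * cT k n" for k n using eps_nonneg by (simp add: cT_nonneg)
  have sums: "(\<lambda>k. \<epsilon> ^ k * cT k n) sums gmean n" for n
    unfolding gmean_def by (rule sums_finite) (auto simp: cT_eq_0)
  have "(\<lambda>k. \<Sum>n. a n * of_real (\<epsilon> ^ k * cT k n)) sums (\<Sum>n. a n * of_real (gmean n))"
  proof (rule sums_swap[where S = gmean])
    show "(\<lambda>k. complex_of_real (\<epsilon> ^ k * cT k n)) sums of_real (gmean n)" for n using sums by (rule sums_of_real)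
    show "(\<Sum>i<k. norm (complex_of_real (\<epsilon> ^ i * cT i n))) \<le> gmean n" for n k
      using sum_le_sums[OF sums[of n], of "{..<k}"] nn by (simp del: of_real_mult of_real_power)
  qed (rule gsum_mean(2)[OF a])
  moreover have "(\<Sum>n. a n * of_real (\<epsilon> ^ k * cT k n)) = of_real (\<epsilon> ^ k) * (\<Sum>n. a n * of_real (cT k n))" for k
  proof -
    have "summable (\<lambda>n. a n * complex_of_real (cT k n))"
      by (rule summable_norm_cancel[OF summable_expo_kernel[OF a, of _ "128 ^ k"]]) (auto simp: cT_nonneg cT_le)
    from suminf_mult[OF this, of "of_real (\<epsilon> ^ k)"] show ?thesis by (simp add: mult_ac)
  qed
  ultimately show ?thesis unfolding gsum_mean(3)[OF a] by simp
qed

end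

theorem mainTheorem3:
  fixes M :: "'a measure" and N :: nat and X :: "'a \<Rightarrow> complex mat"
    and p :: "real \<Rightarrow> real" and s :: complex
  assumes "N \<ge> 1"
    and "GUE M N X"
    and "mean_eigenvalue_density M N X p"
  shows "integrable lborel (\<lambda>t. exp (s * of_real t) * of_real (p t)) \<and>
    (\<lambda>k. alpha_laplace k s / of_nat N ^ (2 * k)) sums
      (LINT t|lborel. exp (s * of_real t) * of_real (p t)) \<and>
    alpha_laplace 0 s =
      1 / (2 * of_real pi) *
      (LINT x:{-2..2}|lborel. exp (s * of_real x) * of_real (sqrt (4 - x\<^sup>2)))"
proof -
  define \<nu> where "\<nu> = density lborel (\<lambda>x. ennreal (p x))"
  note D = GUE_density_moments[OF assms, folded \<nu>_def]
  interpret moment_recursion \<nu> "1 / (real N)\<^sup>2"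
  proof (rule moment_recursion.intro[OF D(3)], unfold_locales)
    show "sets \<nu> = sets borel" by (simp add: \<nu>_def)
    have "1 \<le> (real N)\<^sup>2" using assms(1) by simp
    then show "1 / (real N)\<^sup>2 \<le> 1" using assms(1) by (auto simp: divide_le_eq_1)
  qed (use D(4,5) in simp_all)
  obtain a where a: "expo a" "(\<lambda>t. exp (s * t)) = gsum a" using exp_eq_gsum by blast
  have lap: "alpha_laplace k s = (\<Sum>n. a n * of_real (cT k n))" for k
    unfolding alpha_laplace_def a(2) by (rule alpha_gsum[OF a(1)])
  let ?f = "\<lambda>t. exp (s * complex_of_real t)"
  have f: "?f t = gsum a (of_real t)" for t using fun_cong[OF a(2)] .
  have meas: "?f \<in> borel_measurable lborel" "p \<in> borel_measurable lborel"
    using D(1) by (auto intro!: borel_measurable_continuous_onI continuous_intros)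
  have int: "(LINT t|\<nu>. ?f t) = (LINT t|lborel. ?f t * of_real (p t))"
    unfolding \<nu>_def by (subst integral_density[OF meas D(2)]) (simp add: scaleR_conv_of_real mult.commute)
  have "integrable \<nu> ?f" unfolding f by (rule gsum_mean(1)[OF a(1)])
  then have "integrable lborel (\<lambda>t. ?f t * of_real (p t))"
    unfolding \<nu>_def by (subst (asm) integrable_density[OF meas D(2)]) (simp add: scaleR_conv_of_real mult.commute)
  moreover have "(\<lambda>k. alpha_laplace k s / of_nat N ^ (2 * k)) sums (LINT t|lborel. ?f t * of_real (p t))"
  proof -
    have eq: "of_real ((1 / (real N)\<^sup>2) ^ k) * (\<Sum>n. a n * of_real (cT k n)) = alpha_laplace k s / of_nat N ^ (2 * k)" for k
      by (simp add: lap power_divide power_mult)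
    have "(\<lambda>k. alpha_laplace k s / of_nat N ^ (2 * k)) sums (LINT t|\<nu>. ?f t)"
      using gsum_series[OF a(1)] unfolding f eq .
    then show ?thesis unfolding int .
  qed
  moreover have "alpha_laplace 0 s = 1 / (2 * of_real pi) *
      (LINT x:{-2..2}|lborel. exp (s * of_real x) * of_real (sqrt (4 - x\<^sup>2)))"
    by (simp add: alpha_laplace_def alpha_def semicircle_def)
  ultimately show ?thesis by blast
qed

end
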